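(* The following decision problem is NP-complete: given a finite, simple, undirected graph $G=(V,E)$ with nonnegative integer edge weights, and a positive number $W$, decide whether $G$ has a minimum spanning $2$-forest of weight $W$.
   Context: A graph $G=(V,E)$ consists of a set $V$ of vertices and a set $E$ of edges, each edge being an unordered pair of distinct vertices, each pair occurring at most once. A subgraph of $G$ is a pair $(V',E')$ with $V'\subseteq V$, $E'\subseteq E$ that is itself a graph. Each edge is assigned a weight, which is a nonnegative integer; the weight $w(H)$ of a graph $H$ is the sum of the weights of all edges of $H$. A tree is a connected graph with no cycles (a single vertex with no edges is a tree, of weight $0$). For a positive integer $k$, a spanning $k$-forest of $G$ is a collection of $k$ pairwise (vertex-)disjoint trees $T_1,\ldots,T_k$, each a subgraph of $G$, such that each vertex of $G$ is contained in $T_i$ for some $i\in\{1,\ldots,k\}$. A minimum spanning $k$-forest of $G$ is a spanning $k$-forest such that the quantity $\max\{w(T_1),\ldots,w(T_k)\}$ is minimum among all spanning $k$-forests of $G$. This quantity $\max\{w(T_1),\ldots,w(T_k)\}$ is called the weight of the minimum spanning $k$-forest. Numbers in the input (edge weights and $W$) are encoded in binary, and NP-completeness is in the usual sense (membership in NP together with NP-hardness under polynomial-time reductions).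
   Formalization: "Of weight W" is read as the usual decision version: G has a minimum spanning 2-forest and its weight is at most W; with weight exactly W, membership in NP would imply NP = coNP. *)

theory Defs
  imports "HOL-Computational_Algebra.Polynomial"
begin

section \<open>Graphs, trees and minimum spanning forests\<close>

type_synonym 'a graph = "'a set \<times> 'a set set"

abbreviation verts :: "'a graph \<Rightarrow> 'a set" where
  "verts G \<equiv> fst G"

abbreviation edges :: "'a graph \<Rightarrow> 'a set set" where
  "edges G \<equiv> snd G"

definition is_graph :: "'a graph \<Rightarrow> bool" where
  "is_graph G \<longleftrightarrow> (\<forall>e\<in>edges G. e \<subseteq> verts G \<and> card e = 2)"

definition subgraph :: "'a graph \<Rightarrow> 'a graph \<Rightarrow> bool" where
  "subgraph H G \<longleftrightarrow> is_graph H \<and> verts H \<subseteq> verts G \<and> edges H \<subseteq> edges G"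

definition connected_graph :: "'a graph \<Rightarrow> bool" where
  "connected_graph G \<longleftrightarrow>
     (\<forall>u\<in>verts G. \<forall>v\<in>verts G. (u, v) \<in> {(a, b). {a, b} \<in> edges G}\<^sup>*)"

definition is_cycle :: "'a graph \<Rightarrow> 'a list \<Rightarrow> bool" where
  "is_cycle G xs \<longleftrightarrow> 3 \<le> length xs \<and> distinct xs \<and>
     (\<forall>i<length xs. {xs ! i, xs ! (Suc i mod length xs)} \<in> edges G)"

(* As usual, the graph without vertices is not a tree. *)
definition is_tree :: "'a graph \<Rightarrow> bool" where
  "is_tree T \<longleftrightarrow> is_graph T \<and> verts T \<noteq> {} \<and> connected_graph T \<and> (\<nexists>xs. is_cycle T xs)"

definition weight :: "('a set \<Rightarrow> nat) \<Rightarrow> 'a graph \<Rightarrow> nat" where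
  "weight w H = (\<Sum>e\<in>edges H. w e)"

definition spanning_forest :: "nat \<Rightarrow> 'a graph \<Rightarrow> 'a graph list \<Rightarrow> bool" where
  "spanning_forest k G Ts \<longleftrightarrow> 0 < k \<and> length Ts = k \<and>
     (\<forall>T\<in>set Ts. is_tree T \<and> subgraph T G) \<and>
     (\<forall>i<k. \<forall>j<k. i \<noteq> j \<longrightarrow> verts (Ts ! i) \<inter> verts (Ts ! j) = {}) \<and>
     (\<forall>v\<in>verts G. \<exists>T\<in>set Ts. v \<in> verts T)"

definition forest_weight :: "('a set \<Rightarrow> nat) \<Rightarrow> 'a graph list \<Rightarrow> nat" where
  "forest_weight w Ts = Max (weight w ` set Ts)"

definition min_spanning_forest ::
    "nat \<Rightarrow> 'a graph \<Rightarrow> ('a set \<Rightarrow> nat) \<Rightarrow> 'a graph list \<Rightarrow> bool" where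
  "min_spanning_forest k G w Ts \<longleftrightarrow> spanning_forest k G Ts \<and>
     (\<forall>Ts'. spanning_forest k G Ts' \<longrightarrow> forest_weight w Ts \<le> forest_weight w Ts')"


section \<open>Binary encodings\<close>

(* Self-delimiting: every bit is preceded by True, and False marks the end. *)
definition delimit :: "bool list \<Rightarrow> bool list" where
  "delimit xs = concat (map (\<lambda>b. [True, b]) xs) @ [False]"

definition encode_pair :: "bool list \<Rightarrow> bool list \<Rightarrow> bool list" where
  "encode_pair x y = delimit x @ y"

(* Least significant bit first, without superfluous zeros. *)
fun bits :: "nat \<Rightarrow> bool list" where
  "bits n = (if n = 0 then [] else odd n # bits (n div 2))"

declare bits.simps [simp del]

definition encode_nat :: "nat \<Rightarrow> bool list" where
  "encode_nat n = delimit (bits n)"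

definition encode_edge :: "nat \<times> nat \<times> nat \<Rightarrow> bool list" where
  "encode_edge e = (case e of (u, v, c) \<Rightarrow> encode_nat u @ encode_nat v @ encode_nat c)"

(* The number of vertices is written in unary, so that the length of the code is at least the
   number of vertices, just as if all vertices were listed.  All other numbers are in binary. *)
definition encode_instance :: "nat \<Rightarrow> (nat \<times> nat \<times> nat) list \<Rightarrow> nat \<Rightarrow> bool list" where
  "encode_instance n es W =
     replicate n True @ [False] @ concat (map (\<lambda>e. True # encode_edge e) es) @ [False] @
     encode_nat W"

lemma delimit_Nil [simp]: "delimit [] = [False]"
  by (simp add: delimit_def)

lemma delimit_Cons [simp]: "delimit (x # xs) = True # x # delimit xs"
  by (simp add: delimit_def)

lemma delimit_append_eq: "delimit xs @ r = delimit ys @ s \<longleftrightarrow> xs = ys \<and> r = s"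
  by (induction xs arbitrary: ys) (case_tac ys; simp; blast)+

lemma bits_inject: "bits m = bits n \<Longrightarrow> m = n"
proof (induction m arbitrary: n rule: bits.induct)
  case (1 m)
  show ?case
  proof (cases "m = 0 \<or> n = 0")
    case True with 1(2) show ?thesis by (subst (asm) (1 2) bits.simps) (auto split: if_splits)
  next
    case False
    with 1(2) have "odd m = odd n" "bits (m div 2) = bits (n div 2)"
      using bits.simps[of m] bits.simps[of n] by auto
    with 1(1) False have "m div 2 = n div 2" by blast
    with \<open>odd m = odd n\<close> show ?thesis by (metis div_mult_mod_eq odd_iff_mod_2_eq_one even_iff_mod_2_eq_zero)
  qed
qed

lemma encode_nat_append_eq:
  "encode_nat m @ r = encode_nat n @ s \<longleftrightarrow> m = n \<and> r = s"
  using bits_inject by (auto simp: encode_nat_def delimit_append_eq)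

lemma encode_edges_inject:
  "concat (map (\<lambda>e. True # encode_edge e) es) @ False # r =
   concat (map (\<lambda>e. True # encode_edge e) es') @ False # s \<Longrightarrow>
   es = es' \<and> r = s"
proof (induction es arbitrary: es')
  case Nil
  then show ?case by (cases es') auto
next
  case (Cons a es)
  then show ?case by (cases es') (auto simp: encode_edge_def encode_nat_append_eq split: prod.splits)
qed

lemma encode_unary_inject:
  "replicate n True @ False # r = replicate m True @ False # s \<Longrightarrow> n = m \<and> r = s"
proof (induction n arbitrary: m)
  case 0
  then show ?case by (cases m) auto
next
  case (Suc n)
  then show ?case by (cases m) auto
qed

lemma encode_instance_inject:
  "encode_instance n e W = encode_instance n' e' W' \<Longrightarrow> n = n' \<and> e = e' \<and> W = W'"
  unfolding encode_instance_def using encode_nat_append_eq[of W "[]" W' "[]"] by (auto dest!: encode_unary_inject encode_edges_inject)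

(* Up to isomorphism the vertex set of a finite graph is {..<n}; each edge is listed exactly once,
   as a pair with the smaller endpoint first, followed by its weight.  As for every minimisation
   problem, the number W of an instance of the decision problem is a bound: the question is
   whether the minimum is at most W. *)
definition min_spanning_forest_problem :: "nat \<Rightarrow> bool list set" where
  "min_spanning_forest_problem k =
     {encode_instance n (map (\<lambda>(u, v). (u, v, w {u, v})) es) W | n es w W.
        0 < W \<and> distinct es \<and> (\<forall>(u, v)\<in>set es. u < v \<and> v < n) \<and>
        (\<exists>Ts. min_spanning_forest k ({..<n}, {{u, v} | u v. (u, v) \<in> set es}) w Ts \<and>
              forest_weight w Ts \<le> W)}"


section \<open>Multi-tape Turing machines\<close>

type_synonym symbol = nat

abbreviation (input) blank :: symbol where "blank \<equiv> 0"
abbreviation (input) start :: symbol where "start \<equiv> 1"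

definition bit_symbol :: "bool \<Rightarrow> symbol" where
  "bit_symbol b = (if b then 3 else 2)"

datatype direction = Go_Left | Stay | Go_Right

(* Contents of the cells of a one-sided infinite tape, and head position. *)
type_synonym tape = "(nat \<Rightarrow> symbol) \<times> nat"

(* States are numbered 0, ..., num_states, where 0 is the initial and num_states the halting
   state.  A transition maps the current state and the list of scanned symbols (one per tape) to
   the next state and, for each tape, the symbol to be written and the head movement. *)
record tm =
  num_tapes :: nat
  num_symbols :: nat
  num_states :: nat
  trans :: "nat \<Rightarrow> symbol list \<Rightarrow> nat \<times> (symbol \<times> direction) list"

definition wf_tm :: "tm \<Rightarrow> bool" where
  "wf_tm M \<longleftrightarrow> 1 \<le> num_tapes M \<and> 4 \<le> num_symbols M \<and>
     (\<forall>q<num_states M. \<forall>rs. length rs = num_tapes M \<and> (\<forall>s\<in>set rs. s < num_symbols M) \<longrightarrow>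
        (case trans M q rs of (q', as) \<Rightarrow>
           q' \<le> num_states M \<and> length as = num_tapes M \<and> (\<forall>(s, d)\<in>set as. s < num_symbols M)))"

type_synonym config = "nat \<times> tape list"

fun read_tape :: "tape \<Rightarrow> symbol" where
  "read_tape (c, i) = c i"

(* Moving left in cell 0 has no effect, by truncated subtraction. *)
fun act_tape :: "symbol \<times> direction \<Rightarrow> tape \<Rightarrow> tape" where
  "act_tape (s, d) (c, i) =
     (c(i := s), case d of Go_Left \<Rightarrow> i - 1 | Stay \<Rightarrow> i | Go_Right \<Rightarrow> Suc i)"

definition step :: "tm \<Rightarrow> config \<Rightarrow> config" where
  "step M cfg = (case cfg of (q, ts) \<Rightarrow>
     if q < num_states M
     then (case trans M q (map read_tape ts) of (q', as) \<Rightarrow> (q', map2 act_tape as ts))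
     else cfg)"

definition tape_of :: "bool list \<Rightarrow> nat \<Rightarrow> symbol" where
  "tape_of xs i =
     (if i = 0 then start else if i \<le> length xs then bit_symbol (xs ! (i - 1)) else blank)"

definition init_config :: "tm \<Rightarrow> bool list \<Rightarrow> config" where
  "init_config M xs = (0, (tape_of xs, 0) # replicate (num_tapes M - 1) (tape_of [], 0))"

(* The output is the string on the first tape, from cell 1 up to the first blank. *)
definition halts_with :: "tm \<Rightarrow> config \<Rightarrow> bool list \<Rightarrow> bool" where
  "halts_with M cfg ys \<longleftrightarrow> (case cfg of (q, ts) \<Rightarrow>
     q = num_states M \<and> (\<forall>i\<in>{1..Suc (length ys)}. fst (hd ts) i = tape_of ys i))"


section \<open>Polynomial time and NP-completeness\<close>

definition polytime :: "(bool list \<Rightarrow> bool list) \<Rightarrow> bool" where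
  "polytime f \<longleftrightarrow> (\<exists>M p. wf_tm M \<and>
     (\<forall>x. \<exists>t \<le> poly p (length x). halts_with M ((step M ^^ t) (init_config M x)) (f x)))"

definition in_NP :: "bool list set \<Rightarrow> bool" where
  "in_NP L \<longleftrightarrow> (\<exists>f p. polytime f \<and>
     (\<forall>x. x \<in> L \<longleftrightarrow> (\<exists>y. length y \<le> poly p (length x) \<and> f (encode_pair x y) = [True])))"

definition polytime_reducible :: "bool list set \<Rightarrow> bool list set \<Rightarrow> bool" where
  "polytime_reducible L L' \<longleftrightarrow> (\<exists>f. polytime f \<and> (\<forall>x. x \<in> L \<longleftrightarrow> f x \<in> L'))"

definition NP_hard :: "bool list set \<Rightarrow> bool" where
  "NP_hard L \<longleftrightarrow> (\<forall>L'. in_NP L' \<longrightarrow> polytime_reducible L' L)"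

definition NP_complete :: "bool list set \<Rightarrow> bool" where
  "NP_complete L \<longleftrightarrow> in_NP L \<and> NP_hard L"

end

theory Submission
  imports Defs
begin

text \<open>
  Membership in NP: a certificate describes each of the two trees by the order in which its vertices
  can be attached as leaves, together with the difference between the bound and the weight of the
  tree, so that its verification needs only additions and tests for equality.

  Hardness: the space-time diagram of a verifier becomes an exact cover problem, whose items are
  tiles that carry values from one time step to the next.  Exact cover becomes subset sum by giving
  each label a block of binary digits.  In the graph of a subset sum instance every summand is a
  vertex joined to two hubs by edges of that weight.  Further leaves at the hubs are such that the
  weights of all vertices other than the hubs add up to twice the bound; hence a forest of bounded
  weight has to separate the hubs and to split the total weight evenly, and the summands on the side
  of the first hub attain the target.

  Polynomial time: data are binary trees in prefix code, processed by structured programs on four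
  stacks.  The length of the output of a program is bounded by that of the input plus the running
  time, so that polynomial time bounds are closed under composition.
\<close>

section \<open>Structured programs on stacks\<close>

text \<open>Exact cover is a convenient intermediate problem because of its uniqueness: agreement of
  two neighbouring tiles becomes a condition on labels without auxiliary formulas, and the number of
  selected sets at a label is directly a digit of a sum. The resulting weights have as many digits
  as there are labels times the width of a block, so the reduction depends on the binary encoding of
  weights. All other numbers, such as times, positions and vertices, are polynomially bounded and
  can be handled in unary. The obstacle in the diagram is a certificate of unknown length:
  \<open>encode_pair x y\<close> puts \<open>y\<close> behind \<open>x\<close> on the same tape, so
  the place where the blanks begin is itself a choice. It is made by a single tile, which also holds
  the initial configuration and the test for acceptance.\<close>

datatype com =
    Push nat nat
  | Pop nat
  | Seq com com (infixr ";;" 60)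
  | Cond nat "nat set" com com
  | Loop nat "nat set" com

(* The empty stack shows the marker of the leftmost cell. *)
definition peek :: "nat list \<Rightarrow> nat" where
  "peek xs = (case xs of [] \<Rightarrow> start | x # _ \<Rightarrow> x)"

lemma peek_simps [simp]: "peek [] = start" "peek (x # xs) = x"
  by (simp_all add: peek_def)

text \<open>The costs are those of the compiled machine, step for step: a push moves the head and
  then writes, a true branch has to jump over the other one, and each iteration tests and jumps
  back.\<close>

inductive exec :: "com \<Rightarrow> nat list list \<Rightarrow> nat \<Rightarrow> nat list list \<Rightarrow> bool" where
  exec_Push: "k < length s \<Longrightarrow> exec (Push k a) s 2 (s[k := a # s ! k])"
| exec_Pop: "k < length s \<Longrightarrow> s ! k = a # r \<Longrightarrow> exec (Pop k) s 1 (s[k := r])"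
| exec_Seq: "exec c s t s' \<Longrightarrow> exec d s' t' s'' \<Longrightarrow> exec (c ;; d) s (t + t') s''"
| exec_CondT: "k < length s \<Longrightarrow> peek (s ! k) \<in> S \<Longrightarrow> exec c s t s' \<Longrightarrow> exec (Cond k S c d) s (Suc (t + 1)) s'"
| exec_CondF: "k < length s \<Longrightarrow> peek (s ! k) \<notin> S \<Longrightarrow> exec d s t s' \<Longrightarrow> exec (Cond k S c d) s (Suc t) s'"
| exec_LoopF: "k < length s \<Longrightarrow> peek (s ! k) \<notin> S \<Longrightarrow> exec (Loop k S c) s 1 s"
| exec_LoopT: "k < length s \<Longrightarrow> peek (s ! k) \<in> S \<Longrightarrow> exec c s t s' \<Longrightarrow>
    exec (Loop k S c) s' t' s'' \<Longrightarrow> exec (Loop k S c) s (Suc (t + Suc t')) s''"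

lemma exec_length: "exec c s t s' \<Longrightarrow> length s' = length s"
  by (induction rule: exec.induct) auto

lemma sum_list_length_update:
  "k < length s \<Longrightarrow> sum_list (map length (s[k := r])) + length (s ! k) = sum_list (map length s) + length r"
proof (induction s arbitrary: k)
  case (Cons a s)
  then show ?case by (cases k) (simp_all, fastforce?)
qed simp

lemma exec_sum_length: "exec c s t s' \<Longrightarrow> sum_list (map length s') \<le> sum_list (map length s) + t"
proof (induction rule: exec.induct)
  case (exec_Push k s a)
  then show ?case using sum_list_length_update[of k s "a # s ! k"] by simp
next
  case (exec_Pop k s a r)
  then show ?case using sum_list_length_update[of k s r] by simp
qed auto

text \<open>Four stacks, and the symbols 0 to 4: blank, end marker, the two values of
  \<open>bit_symbol\<close>, and 4 as a delimiter.\<close>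

fun com_ok :: "com \<Rightarrow> bool" where
  "com_ok (Push k a) \<longleftrightarrow> k < 4 \<and> a < 5"
| "com_ok (Pop k) \<longleftrightarrow> k < 4"
| "com_ok (c ;; d) \<longleftrightarrow> com_ok c \<and> com_ok d"
| "com_ok (Cond k S c d) \<longleftrightarrow> k < 4 \<and> com_ok c \<and> com_ok d"
| "com_ok (Loop k S c) \<longleftrightarrow> k < 4 \<and> com_ok c"


section \<open>Compilation to Turing machines\<close>

text \<open>The bottom of the stack is in cell 1, and the head rests on the top or, for the empty
  stack, on the marker in cell 0. So the scanned symbol is always \<open>peek\<close>.\<close>

definition tape_rep :: "nat list \<Rightarrow> tape" where
  "tape_rep xs = (\<lambda>i. if i = 0 then start else if i \<le> length xs then rev xs ! (i - 1) else blank, length xs)"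

lemma read_tape_rep [simp]: "read_tape (tape_rep xs) = peek xs"
  by (cases xs) (auto simp: tape_rep_def nth_append)

lemma act_Stay [simp]: "act_tape (peek xs, Stay) (tape_rep xs) = tape_rep xs"
  by (cases xs) (auto simp: tape_rep_def nth_append fun_eq_iff)

lemma act_Stay_Nil [simp]: "act_tape (Suc 0, Stay) (tape_rep []) = tape_rep []"
  using act_Stay[of "[]"] by simp

lemma act_Pop: "act_tape (blank, Go_Left) (tape_rep (x # xs)) = tape_rep xs"
  by (auto simp: tape_rep_def nth_append fun_eq_iff)

lemma act_Push: "act_tape (a, Stay) (act_tape (peek xs, Go_Right) (tape_rep xs)) = tape_rep (a # xs)"
  by (cases xs) (auto simp: tape_rep_def nth_append fun_eq_iff)

definition keep :: "symbol list \<Rightarrow> (symbol \<times> direction) list" where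
  "keep rs = map (\<lambda>r. (r, Stay)) rs"

fun csize :: "com \<Rightarrow> nat" where
  "csize (Push k a) = 2"
| "csize (Pop k) = 1"
| "csize (c ;; d) = csize c + csize d"
| "csize (Cond k S c d) = csize c + csize d + 2"
| "csize (Loop k S c) = csize c + 2"

type_synonym instr = "symbol list \<Rightarrow> nat \<times> (symbol \<times> direction) list"

text \<open>Jumps are absolute, hence the parameter \<open>n\<close>, the state of the first
  instruction; control leaves the code at state \<open>n + csize c\<close>.\<close>

fun compile :: "com \<Rightarrow> nat \<Rightarrow> instr list" where
  "compile (Push k a) n =
     [\<lambda>rs. (n + 1, (keep rs)[k := (rs ! k, Go_Right)]), \<lambda>rs. (n + 2, (keep rs)[k := (a, Stay)])]"
| "compile (Pop k) n = [\<lambda>rs. (n + 1, (keep rs)[k := (blank, Go_Left)])]"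
| "compile (c ;; d) n = compile c n @ compile d (n + csize c)"
| "compile (Cond k S c d) n =
     (\<lambda>rs. (if rs ! k \<in> S then n + 1 else n + 2 + csize c, keep rs)) # compile c (n + 1) @
     (\<lambda>rs. (n + 2 + csize c + csize d, keep rs)) # compile d (n + 2 + csize c)"
| "compile (Loop k S c) n =
     (\<lambda>rs. (if rs ! k \<in> S then n + 1 else n + 2 + csize c, keep rs)) # compile c (n + 1) @
     [\<lambda>rs. (n, keep rs)]"

lemma length_compile [simp]: "length (compile c n) = csize c"
  by (induction c arbitrary: n) auto

definition at_code :: "tm \<Rightarrow> nat \<Rightarrow> instr list \<Rightarrow> bool" where
  "at_code M n is \<longleftrightarrow> (\<forall>i<length is. n + i < num_states M \<and> trans M (n + i) = is ! i)"

lemma at_code_Nil [simp]: "at_code M n []"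
  by (simp add: at_code_def)

lemma at_code_Cons [simp]:
  "at_code M n (x # is) \<longleftrightarrow> n < num_states M \<and> trans M n = x \<and> at_code M (Suc n) is"
  unfolding at_code_def by (auto simp: All_less_Suc2)

lemma at_code_append [simp]:
  "at_code M n (is @ js) \<longleftrightarrow> at_code M n is \<and> at_code M (n + length is) js"
  by (induction "is" arbitrary: n) auto

lemma step_cfg:
  "n < num_states M \<Longrightarrow> trans M n (map peek s) = (n', as) \<Longrightarrow>
   step M (n, map tape_rep s) = (n', map2 act_tape as (map tape_rep s))"
  by (simp add: step_def comp_def)

lemma map2_keep [simp]: "map2 act_tape (keep (map peek s)) (map tape_rep s) = map tape_rep s"
  by (induction s) (auto simp: keep_def)

lemma map2_keep_update:
  assumes "k < length s"
  shows "map2 act_tape ((keep (map peek s))[k := a]) (map tape_rep s) =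
    (map tape_rep s)[k := act_tape a (tape_rep (s ! k))]"
  using assms by (intro nth_equalityI) (auto simp: nth_list_update keep_def)

lemma map2_keep_update2:
  assumes "k < length ts"
  shows "map2 act_tape ((keep (map read_tape ts))[k := a]) ts = (map2 act_tape (keep (map read_tape ts)) ts)[k := act_tape a (ts ! k)]"
  using assms by (intro nth_equalityI) (auto simp: nth_list_update keep_def)

lemma act_read [simp]: "act_tape (read_tape t, Stay) t = t"
  by (cases t) auto

lemma map2_keep_read [simp]: "map2 act_tape (keep (map read_tape ts)) ts = ts"
  by (induction ts) (auto simp: keep_def)

text \<open>Subprograms sit at other addresses inside larger code, so the machine and
  \<open>n\<close> are arbitrary and only \<open>at_code\<close> is assumed.\<close>

theorem compile_correct:
  assumes "exec c s t s'" "at_code M n (compile c n)"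
  shows "(step M ^^ t) (n, map tape_rep s) = (n + csize c, map tape_rep s')"
  using assms
proof (induction arbitrary: n rule: exec.induct)
  case (exec_Push k s a)
  let ?ts = "(map tape_rep s)[k := act_tape (peek (s ! k), Go_Right) (tape_rep (s ! k))]"
  have 1: "step M (n, map tape_rep s) = (n + 1, ?ts)"
    using exec_Push by (subst step_cfg) (auto simp: map2_keep_update)
  have 2: "step M (n + 1, ?ts) = (n + 2, map tape_rep (s[k := a # s ! k]))"
  proof -
    have "step M (n + 1, ?ts) = (n + 2, map2 act_tape ((keep (map read_tape ?ts))[k := (a, Stay)]) ?ts)"
      using exec_Push by (simp add: step_def)
    also have "\<dots> = (n + 2, ?ts[k := act_tape (a, Stay) (?ts ! k)])"
      using exec_Push by (simp only: map2_keep_update2 length_map length_list_update map2_keep_read)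
    finally show ?thesis
      using exec_Push act_Push[of a "s ! k"] by (simp add: map_update)
  qed
  from 1 2 show ?case by (simp add: numeral_2_eq_2)
next
  case (exec_Pop k s a r)
  then show ?case
    by (simp, subst step_cfg) (auto simp: map2_keep_update map_update act_Pop simp del: act_tape.simps)
next
  case (exec_Seq c s t s' d t' s'')
  then show ?case by (simp add: add.commute[of t] funpow_add add.assoc)
next
  case (exec_CondT k s S c t s' d)
  let ?i = "length (compile c (Suc n))"
  have "step M (n, map tape_rep s) = (n + 1, map tape_rep s)"
    using exec_CondT by (subst step_cfg) auto
  moreover have "(step M ^^ t) (n + 1, map tape_rep s) = (n + 1 + csize c, map tape_rep s')"
    using exec_CondT by simp
  moreover have "step M (n + 1 + csize c, map tape_rep s') = (n + csize (Cond k S c d), map tape_rep s')"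
    using exec_CondT by (subst step_cfg) (auto simp: exec_length)
  ultimately show ?case by (simp add: funpow_swap1)
next
  case (exec_CondF k s S d t s' c)
  have "step M (n, map tape_rep s) = (n + 2 + csize c, map tape_rep s)"
    using exec_CondF by (subst step_cfg) auto
  moreover have "(step M ^^ t) (n + 2 + csize c, map tape_rep s) = (n + 2 + csize c + csize d, map tape_rep s')"
    using exec_CondF by simp
  ultimately show ?case by (simp add: funpow_swap1 algebra_simps)
next
  case (exec_LoopF k s S c)
  then show ?case by (simp, subst step_cfg) auto
next
  case (exec_LoopT k s S c t s' t' s'')
  have "step M (n, map tape_rep s) = (n + 1, map tape_rep s)"
    using exec_LoopT by (subst step_cfg) auto
  moreover have "(step M ^^ t) (n + 1, map tape_rep s) = (n + 1 + csize c, map tape_rep s')"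
    using exec_LoopT by simp
  moreover have "step M (n + 1 + csize c, map tape_rep s') = (n, map tape_rep s')"
    using exec_LoopT by (subst step_cfg) (auto simp: exec_length)
  moreover have "(step M ^^ t') (n, map tape_rep s') = (n + csize (Loop k S c), map tape_rep s'')"
    using exec_LoopT by simp
  moreover have "(step M ^^ Suc (t + Suc t')) x = (step M ^^ t') (step M ((step M ^^ t) (step M x)))" for x
    by (simp only: add.commute[of t] funpow_add funpow_Suc_right funpow.simps o_apply)
  ultimately show ?case by simp
qed

lemma compile_wf:
  "com_ok c \<Longrightarrow> length rs = 4 \<Longrightarrow> \<forall>s\<in>set rs. s < 5 \<Longrightarrow> i < csize c \<Longrightarrow> (compile c n ! i) rs = (q', as) \<Longrightarrow>
   q' \<le> n + csize c \<and> length as = 4 \<and> (\<forall>(s, d)\<in>set as. s < 5)"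
proof (induction c arbitrary: i n)
  case (Push k a)
  then show ?case
    by (auto simp: less_Suc_eq numeral_2_eq_2 keep_def dest!: set_update_subset_insert[THEN subsetD])
next
  case (Pop k)
  then show ?case
    by (auto simp: keep_def dest!: set_update_subset_insert[THEN subsetD])
next
  case (Seq c1 c2)
  show ?case
  proof (cases "i < csize c1")
    case True
    with Seq.prems Seq.IH(1)[of i n] show ?thesis by (auto simp: nth_append)
  next
    case False
    with Seq.prems Seq.IH(2)[of "i - csize c1" "n + csize c1"] show ?thesis by (auto simp: nth_append algebra_simps)
  qed
next
  case (Cond k S c1 c2)
  consider "i = 0" | j where "i = Suc j" "j < csize c1" | "i = Suc (csize c1)"
    | j where "i = Suc (Suc (csize c1 + j))" "j < csize c2"
  proof (cases i)
    case (Suc j)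
    then show ?thesis using that(2)[of j] that(3) that(4)[of "j - Suc (csize c1)"] Cond.prems
      by (cases "j < csize c1"; cases "j = csize c1") auto
  qed (use that in auto)
  then show ?case
  proof cases
    case 1
    with Cond.prems show ?thesis by (auto simp: keep_def split: if_splits)
  next
    case (2 j)
    with Cond.prems Cond.IH(1)[of j "Suc n"] show ?thesis by (auto simp: nth_append)
  next
    case 3
    with Cond.prems show ?thesis by (auto simp: keep_def nth_append)
  next
    case (4 j)
    with Cond.prems Cond.IH(2)[of j "n + 2 + csize c1"] show ?thesis by (auto simp: nth_append algebra_simps)
  qed
next
  case (Loop k S c)
  consider "i = 0" | j where "i = Suc j" "j < csize c" | "i = Suc (csize c)"
  proof (cases i)
    case (Suc j)
    then show ?thesis using that(2)[of j] that(3) Loop.prems by (cases "j < csize c") auto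
  qed (use that in auto)
  then show ?case
  proof cases
    case 1
    with Loop.prems show ?thesis by (auto simp: keep_def split: if_splits)
  next
    case (2 j)
    with Loop.prems Loop.IH[of j "Suc n"] show ?thesis by (auto simp: nth_append)
  next
    case 3
    with Loop.prems show ?thesis by (auto simp: keep_def nth_append)
  qed
qed

(* State 0 moves the head of the input tape to the last input symbol, which turns the input into
   a stack. *)
definition machine :: "com \<Rightarrow> tm" where
  "machine c = \<lparr>num_tapes = 4, num_symbols = 5, num_states = Suc (csize c),
     trans = \<lambda>q rs. (((\<lambda>rs. if rs ! 0 = blank then (1, (keep rs)[0 := (blank, Go_Left)])
        else (0, (keep rs)[0 := (rs ! 0, Go_Right)])) # compile c 1) ! q) rs\<rparr>"

lemma wf_machine: "com_ok c \<Longrightarrow> wf_tm (machine c)"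
proof -
  assume ok: "com_ok c"
  have "case trans (machine c) q rs of (q', as) \<Rightarrow>
      q' \<le> num_states (machine c) \<and> length as = num_tapes (machine c) \<and> (\<forall>(s, d)\<in>set as. s < num_symbols (machine c))"
    if q: "q < num_states (machine c)" and rs: "length rs = 4" "\<forall>s\<in>set rs. s < 5" for q rs
  proof (cases q)
    case 0
    with rs show ?thesis
      by (auto simp: machine_def keep_def dest!: set_update_subset_insert[THEN subsetD])
  next
    case (Suc i)
    with q compile_wf[OF ok rs, of i 1] show ?thesis
      by (auto simp: machine_def split: prod.splits)
  qed
  then show ?thesis by (auto simp: wf_tm_def machine_def)
qed

lemma at_code_machine: "at_code (machine c) 1 (compile c 1)"
  by (auto simp: at_code_def machine_def)

lemma tape_of_Nil: "(tape_of [], 0) = tape_rep []"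
  by (auto simp: tape_of_def tape_rep_def fun_eq_iff)

lemma bit_symbol_neq_blank [simp]: "bit_symbol b \<noteq> blank" "0 < bit_symbol b"
  by (simp_all add: bit_symbol_def)

lemma tape_of_rep: "fst (tape_rep (rev (map bit_symbol xs))) = tape_of xs"
  by (auto simp: tape_of_def tape_rep_def fun_eq_iff)

text \<open>The marker and the symbols of \<open>x\<close> are passed in \<open>length x + 1\<close>
  steps; the blank behind them sends the head back by one cell, onto the top of the input
  stack.\<close>

lemma machine_load:
  "(step (machine c) ^^ (length x + 2)) (init_config (machine c) x) =
    (1, map tape_rep [rev (map bit_symbol x), [], [], []])"
proof -
  let ?M = "machine c"
  let ?r = "[tape_rep [], tape_rep [], tape_rep []]"
  have init: "init_config ?M x = (0, (tape_of x, 0) # ?r)"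
    by (simp add: init_config_def machine_def eval_nat_numeral tape_of_Nil)
  have right: "(step ?M ^^ i) (0, (tape_of x, 0) # ?r) = (0, (tape_of x, i) # ?r)" if "i \<le> Suc (length x)" for i
    using that
  proof (induction i)
    case (Suc i)
    have "tape_of x i \<noteq> blank"
      using Suc.prems by (auto simp: tape_of_def)
    then show ?case using Suc
      by (simp add: step_def machine_def keep_def fun_upd_idem)
  qed simp
  have "tape_of x (Suc (length x)) = blank" by (simp add: tape_of_def)
  then have "step ?M (0, (tape_of x, Suc (length x)) # ?r) = (1, (tape_of x, length x) # ?r)"
    by (simp add: step_def machine_def keep_def fun_upd_idem)
  moreover have "(tape_of x, length x) = tape_rep (rev (map bit_symbol x))"
    using tape_of_rep[of x] by (simp add: tape_rep_def)
  ultimately show ?thesis using right[of "Suc (length x)"] init by simp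
qed

lemma polytime_machine:
  fixes p :: "nat poly"
  assumes ok: "com_ok c"
    and ex: "\<And>x. \<exists>t\<le>poly p (length x). exec c [rev (map bit_symbol x), [], [], []] t [rev (map bit_symbol (f x)), [], [], []]"
  shows "polytime f"
  unfolding polytime_def
proof (rule exI[of _ "machine c"], rule exI[of _ "p + [:2, 1:]"], intro conjI allI)
  fix x
  obtain t where t: "t \<le> poly p (length x)"
    and e: "exec c [rev (map bit_symbol x), [], [], []] t [rev (map bit_symbol (f x)), [], [], []]"
    using ex by blast
  let ?M = "machine c" and ?s = "map tape_rep [rev (map bit_symbol (f x)), [], [], []]"
  have "(step ?M ^^ (t + (length x + 2))) (init_config ?M x) = (1 + csize c, ?s)"
    unfolding funpow_add[of t] o_apply machine_load using compile_correct[OF e at_code_machine] by blast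
  moreover have "halts_with ?M (1 + csize c, ?s) (f x)"
    by (simp add: halts_with_def machine_def tape_of_rep)
  ultimately have "halts_with ?M ((step ?M ^^ (t + (length x + 2))) (init_config ?M x)) (f x)"
    by simp
  moreover have "t + (length x + 2) \<le> poly (p + [:2, 1:]) (length x)"
    using t by simp
  ultimately show "\<exists>t\<le>poly (p + [:2, 1:]) (length x). halts_with ?M ((step ?M ^^ t) (init_config ?M x)) (f x)"
    by blast
qed (use ok wf_machine in auto)

section \<open>Execution within a time budget\<close>

definition runs :: "com \<Rightarrow> nat list list \<Rightarrow> nat \<Rightarrow> nat list list \<Rightarrow> bool" where
  "runs c s b s' \<longleftrightarrow> (\<exists>t\<le>b. exec c s t s')"

lemma runs_append:
  "runs c s b s1 \<Longrightarrow> runs d s1 b' s' \<Longrightarrow> runs (c ;; d) s (b + b') s'"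
  unfolding runs_def by (meson add_le_mono exec_Seq)

lemma runs_mono: "runs c s b s' \<Longrightarrow> b \<le> b' \<Longrightarrow> runs c s b' s'"
  using le_trans unfolding runs_def by blast

lemma runs_Seq: "runs c s b s1 \<Longrightarrow> runs d s1 b' s' \<Longrightarrow> b + b' \<le> b'' \<Longrightarrow> runs (c ;; d) s b'' s'"
  unfolding runs_def by (meson add_le_mono exec_Seq le_trans)

lemma runs_Push: "k < length s \<Longrightarrow> s' = s[k := a # s ! k] \<Longrightarrow> 2 \<le> b \<Longrightarrow> runs (Push k a) s b s'"
  unfolding runs_def using exec_Push by blast

lemma runs_Pop: "k < length s \<Longrightarrow> s ! k \<noteq> [] \<Longrightarrow> s' = s[k := tl (s ! k)] \<Longrightarrow> 1 \<le> b \<Longrightarrow> runs (Pop k) s b s'"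
  unfolding runs_def using exec_Pop[of k s "hd (s ! k)" "tl (s ! k)"] by auto

text \<open>The budget is passed on and diminished. In this form the rules apply backwards to
  straight-line programs, without a choice of intermediate times.\<close>

lemma runs_Push_Seq:
  "k < length s \<Longrightarrow> 2 \<le> b \<Longrightarrow> runs d (s[k := a # s ! k]) (b - 2) s' \<Longrightarrow> runs (Push k a ;; d) s b s'"
  by (rule runs_Seq[OF runs_Push[OF _ refl order.refl]]) auto

lemma runs_Pop_Seq:
  "k < length s \<Longrightarrow> s ! k \<noteq> [] \<Longrightarrow> 1 \<le> b \<Longrightarrow> runs d (s[k := tl (s ! k)]) (b - 1) s' \<Longrightarrow> runs (Pop k ;; d) s b s'"
  by (rule runs_Seq[OF runs_Pop[OF _ _ refl order.refl], of k s d "b - 1"]) auto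

lemma runs_CondT:
  "k < length s \<Longrightarrow> peek (s ! k) \<in> S \<Longrightarrow> 2 \<le> b \<Longrightarrow> runs c s (b - 2) s' \<Longrightarrow> runs (Cond k S c d) s b s'"
  unfolding runs_def by (metis (no_types, lifting) Suc_eq_plus1 add_2_eq_Suc' exec_CondT le_diff_conv2)

lemma runs_CondF:
  "k < length s \<Longrightarrow> peek (s ! k) \<notin> S \<Longrightarrow> 2 \<le> b \<Longrightarrow> runs d s (b - 2) s' \<Longrightarrow> runs (Cond k S c d) s b s'"
proof -
  assume a: "k < length s" "peek (s ! k) \<notin> S" "2 \<le> b" "runs d s (b - 2) s'"
  then obtain t where "t \<le> b - 2" "exec d s t s'" by (auto simp: runs_def)
  with exec_CondF[OF a(1,2), of d t s' c] a(3) show ?thesis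
    unfolding runs_def by (intro exI[of _ "Suc t"]) auto
qed

lemma runs_LoopF: "k < length s \<Longrightarrow> peek (s ! k) \<notin> S \<Longrightarrow> 1 \<le> b \<Longrightarrow> s' = s \<Longrightarrow> runs (Loop k S c) s b s'"
  unfolding runs_def using exec_LoopF by blast

lemma runs_LoopT:
  assumes "k < length s" "peek (s ! k) \<in> S" "runs c s b s1" "runs (Loop k S c) s1 b1 s'" "b + b1 + 2 \<le> b'"
  shows "runs (Loop k S c) s b' s'"
proof -
  from assms obtain t u where "t \<le> b" "exec c s t s1" "u \<le> b1" "exec (Loop k S c) s1 u s'" by (auto simp: runs_def)
  with exec_LoopT[OF assms(1,2), of c t s1 u s'] assms(5) show ?thesis
    unfolding runs_def by (intro exI[of _ "Suc (t + Suc u)"]) auto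
qed


section \<open>Binary trees in prefix code\<close>

datatype tree = Leaf | Node tree tree

fun code :: "tree \<Rightarrow> nat list" where
  "code Leaf = [2]"
| "code (Node a b) = 3 # code a @ code b"

lemma code_pos [simp]: "code x \<noteq> []" "0 < length (code x)"
  by (cases x; simp)+

lemma set_code: "set (code x) \<subseteq> {2, 3}"
  by (induction x) auto

lemma code_append_inject: "code x @ r = code y @ r' \<longleftrightarrow> x = y \<and> r = r'"
proof (induction x arbitrary: y r r')
  case Leaf
  then show ?case by (cases y) auto
next
  case (Node a b)
  then show ?case by (cases y) auto
qed

lemma code_inject [simp]: "code x = code y \<longleftrightarrow> x = y"
  using code_append_inject[of x "[]" y "[]"] by simp

(* Moves the tree on top of stack 1 in reverse to stack k; the number of trees still missing is
   counted in unary on stack 3, above a delimiter 4. *)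
definition scan_body :: "nat \<Rightarrow> com" where
  "scan_body k = Cond 1 {3} (Pop 1 ;; Push k 3 ;; Push 3 2) (Pop 1 ;; Push k 2 ;; Pop 3)"

definition scan :: "nat \<Rightarrow> com" where
  "scan k = Push 3 4 ;; Push 3 2 ;; Loop 3 {2} (scan_body k) ;; Pop 3"

text \<open>Scanning reverses a code and moving restores its order. The delimiter 4 shows where the
  moved word ends, since other data may lie below it.\<close>

definition move :: "nat \<Rightarrow> nat \<Rightarrow> com" where
  "move k j = Loop k {2, 3} (Cond k {3} (Pop k ;; Push j 3) (Pop k ;; Push j 2)) ;; Pop k"

definition move2 :: "nat \<Rightarrow> nat \<Rightarrow> nat \<Rightarrow> com" where
  "move2 k i j = Loop k {2, 3} (Cond k {3} (Pop k ;; Push i 3 ;; Push j 3) (Pop k ;; Push i 2 ;; Push j 2)) ;; Pop k"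

definition clear_loop :: "nat \<Rightarrow> com" where
  "clear_loop k = Loop k {2, 3} (Pop k)"

lemma length_4: "length s = 4 \<Longrightarrow> \<exists>a b c d. s = [a, b, c, d]"
  by (auto simp: length_Suc_conv eval_nat_numeral)

text \<open>In continuation style: a run from the state behind the tree \<open>x\<close> extends to
  a run from the state in front of it. A node thus chains the hypotheses for its subtrees, the right
  one first, while the counter holds one 2 more in between. Each symbol costs 10 steps of the body
  and 2 of the loop.\<close>

lemma scan_loop:
  assumes "k = 0 \<or> k = 2" "length s = 4"
    "runs (Loop 3 {2} (scan_body k)) (s[1 := A, 3 := C, k := rev (code x) @ s ! k]) b s'"
    "s ! 1 = code x @ A" "s ! 3 = 2 # C"
  shows "runs (Loop 3 {2} (scan_body k)) s (b + 12 * length (code x)) s'"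
  using assms
proof (induction x arbitrary: s A C b)
  case Leaf
  then obtain I B where s: "s = [I, 2 # A, B, 2 # C]" using length_4[OF Leaf.prems(2)] by auto
  have "runs (scan_body k) s 10 (s[1 := A, 3 := C, k := 2 # s ! k])"
    unfolding scan_body_def
    by (rule runs_CondF runs_Pop_Seq runs_Push_Seq runs_Pop | (use Leaf.prems(1) s in auto)[1])+
  then show ?case using Leaf.prems s
    by (intro runs_LoopT[of 3 s "{2}" _ 10 "s[1 := A, 3 := C, k := 2 # s ! k]" b]) simp_all
next
  case (Node x y)
  then obtain I B where s: "s = [I, 3 # code x @ code y @ A, B, 2 # C]"
    using length_4[OF Node.prems(2)] by auto
  let ?s = "s[1 := code x @ code y @ A, 3 := 2 # 2 # C, k := 3 # s ! k]"
  have 1: "runs (scan_body k) s 10 ?s"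
    unfolding scan_body_def
    by (rule runs_CondT runs_Pop_Seq runs_Push_Seq runs_Push | (use Node.prems(1) s in auto)[1])+
  let ?s1 = "?s[1 := code y @ A, 3 := 2 # C, k := rev (code x) @ 3 # s ! k]"
  have "?s1[1 := A, 3 := C, k := rev (code y) @ ?s1 ! k] = s[1 := A, 3 := C, k := rev (code (Node x y)) @ s ! k]"
    using Node.prems(1) s by auto
  then have "runs (Loop 3 {2} (scan_body k)) ?s1 (b + 12 * length (code y)) s'"
    using Node.prems(1,3) s by (intro Node.IH(2)[of _ A C]) auto
  then have "runs (Loop 3 {2} (scan_body k)) ?s (b + 12 * length (code y) + 12 * length (code x)) s'"
    using Node.prems(1) s by (intro Node.IH(1)[of _ "code y @ A" "2 # C"]) auto
  with 1 show ?case using s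
    by (intro runs_LoopT[of 3 s "{2}" _ 10 ?s "b + 12 * length (code y) + 12 * length (code x)"]) simp_all
qed

lemma runs_scan:
  assumes "k = 0 \<or> k = 2"
  shows "runs (scan k) [I, code x @ A, B, C] (12 * length (code x) + 10) ([I, A, B, C][k := rev (code x) @ [I, A, B, C] ! k])"
proof -
  let ?s = "[I, code x @ A, B, 2 # 4 # C]" and ?s' = "[I, A, B, 4 # C][k := rev (code x) @ [I, A, B, C] ! k]"
  have 1: "runs (Push 3 4 ;; Push 3 2) [I, code x @ A, B, C] 4 ?s"
    by (rule runs_Push_Seq runs_Push | simp)+
  have 2: "runs (Loop 3 {2} (scan_body k)) ?s (1 + 12 * length (code x)) ?s'"
    using assms by (intro scan_loop[of _ _ A "4 # C"] runs_LoopF) auto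
  have "runs (Pop 3) ?s' 1 ([I, A, B, C][k := rev (code x) @ [I, A, B, C] ! k])"
    using assms by (intro runs_Pop) auto
  from runs_append[OF 2 this] show ?thesis unfolding scan_def
    by - (rule runs_Push_Seq, simp, simp, rule runs_Push_Seq, simp, simp, simp add: runs_mono)
qed

lemma runs_move_loop:
  assumes "k < 4" "j < 4" "k \<noteq> j" "length s = 4" "set xs \<subseteq> {2, 3}" "s ! k = xs @ 4 # r"
  shows "runs (Loop k {2, 3} (Cond k {3} (Pop k ;; Push j 3) (Pop k ;; Push j 2))) s
    (10 * length xs + 1) (s[k := 4 # r, j := rev xs @ s ! j])"
  using assms
proof (induction xs arbitrary: s)
  case Nil
  then have "s[k := 4 # r] = s" by (metis append_Nil list_update_id)
  with Nil show ?case by (intro runs_LoopF) auto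
next
  case (Cons a xs)
  let ?s = "s[k := xs @ 4 # r, j := a # s ! j]"
  have "runs (Cond k {3} (Pop k ;; Push j 3) (Pop k ;; Push j 2)) s 8 ?s"
  proof (cases "a = 3")
    case True
    then show ?thesis
      by - (rule runs_CondT runs_Pop_Seq runs_Push | (use Cons.prems in auto)[1])+
  next
    case False
    then show ?thesis
      by - (rule runs_CondF runs_Pop_Seq runs_Push | (use Cons.prems in auto)[1])+
  qed
  moreover have "?s[k := 4 # r, j := rev xs @ ?s ! j] = s[k := 4 # r, j := rev (a # xs) @ s ! j]"
    using Cons.prems by (intro nth_equalityI) (auto simp: nth_list_update)
  moreover have "runs (Loop k {2, 3} (Cond k {3} (Pop k ;; Push j 3) (Pop k ;; Push j 2))) ?s
    (10 * length xs + 1) (?s[k := 4 # r, j := rev xs @ ?s ! j])"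
    by (rule Cons.IH) (use Cons.prems in auto)
  ultimately show ?case
    by (intro runs_LoopT[of k s _ _ 8 ?s "10 * length xs + 1"]) (use Cons.prems in simp_all)
qed

lemma runs_move:
  assumes "k < 4" "j < 4" "k \<noteq> j" "length s = 4" "set xs \<subseteq> {2, 3}" "s ! k = xs @ 4 # r"
    and "10 * length xs + 5 \<le> b" "s' = s[k := r, j := rev xs @ s ! j]"
  shows "runs (move k j) s b s'"
  unfolding move_def
proof (rule runs_Seq[OF runs_move_loop[OF assms(1-6)] runs_Pop[where b = 1]])
  let ?s = "s[k := 4 # r, j := rev xs @ s ! j]"
  have "?s ! k = 4 # r" using assms(1-4) by simp
  then show "?s ! k \<noteq> []" "s' = ?s[k := tl (?s ! k)]"
    using assms(1-4,8) by (auto intro!: nth_equalityI simp: nth_list_update)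
qed (use assms in simp_all)

lemma runs_move2_loop:
  assumes "k < 4" "i < 4" "j < 4" "distinct [k, i, j]" "length s = 4" "set xs \<subseteq> {2, 3}" "s ! k = xs @ 4 # r"
  shows "runs (Loop k {2, 3} (Cond k {3} (Pop k ;; Push i 3 ;; Push j 3) (Pop k ;; Push i 2 ;; Push j 2))) s
    (10 * length xs + 1) (s[k := 4 # r, i := rev xs @ s ! i, j := rev xs @ s ! j])"
  using assms
proof (induction xs arbitrary: s)
  case Nil
  then have "s[k := 4 # r] = s" by (metis append_Nil list_update_id)
  with Nil show ?case by (intro runs_LoopF) auto
next
  case (Cons a xs)
  let ?s = "s[k := xs @ 4 # r, i := a # s ! i, j := a # s ! j]"
  have "runs (Cond k {3} (Pop k ;; Push i 3 ;; Push j 3) (Pop k ;; Push i 2 ;; Push j 2)) s 8 ?s"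
  proof (cases "a = 3")
    case True
    then show ?thesis
      by - (rule runs_CondT runs_Pop_Seq runs_Push_Seq runs_Push | (use Cons.prems in auto)[1])+
  next
    case False
    then show ?thesis
      by - (rule runs_CondF runs_Pop_Seq runs_Push_Seq runs_Push | (use Cons.prems in auto)[1])+
  qed
  moreover have "?s[k := 4 # r, i := rev xs @ ?s ! i, j := rev xs @ ?s ! j] =
      s[k := 4 # r, i := rev (a # xs) @ s ! i, j := rev (a # xs) @ s ! j]"
    using Cons.prems by (intro nth_equalityI) (auto simp: nth_list_update)
  moreover have "runs (Loop k {2, 3} (Cond k {3} (Pop k ;; Push i 3 ;; Push j 3) (Pop k ;; Push i 2 ;; Push j 2))) ?s
    (10 * length xs + 1) (?s[k := 4 # r, i := rev xs @ ?s ! i, j := rev xs @ ?s ! j])"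
    by (rule Cons.IH) (use Cons.prems in auto)
  ultimately show ?case
    by (intro runs_LoopT[of k s _ _ 8 ?s "10 * length xs + 1"]) (use Cons.prems in simp_all)
qed

lemma runs_move2:
  assumes "k < 4" "i < 4" "j < 4" "distinct [k, i, j]" "length s = 4" "set xs \<subseteq> {2, 3}" "s ! k = xs @ 4 # r"
    and "10 * length xs + 5 \<le> b" "s' = s[k := r, i := rev xs @ s ! i, j := rev xs @ s ! j]"
  shows "runs (move2 k i j) s b s'"
  unfolding move2_def
proof (rule runs_Seq[OF runs_move2_loop[OF assms(1-7)] runs_Pop[where b = 1]])
  let ?s = "s[k := 4 # r, i := rev xs @ s ! i, j := rev xs @ s ! j]"
  have "?s ! k = 4 # r" using assms(1-5) by simp
  then show "?s ! k \<noteq> []" "s' = ?s[k := tl (?s ! k)]"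
    using assms(1-5,9) by (auto intro!: nth_equalityI simp: nth_list_update)
qed (use assms in simp_all)

lemma runs_clear_loop:
  assumes "k < length s" "set xs \<subseteq> {2, 3}" "s ! k = xs @ 4 # r" "3 * length xs + 1 \<le> b"
  shows "runs (clear_loop k) s b (s[k := 4 # r])"
  using assms
proof (induction xs arbitrary: s b)
  case Nil
  then have "s[k := 4 # r] = s" by (metis append_Nil list_update_id)
  with Nil show ?case unfolding clear_loop_def by (simp add: runs_LoopF)
next
  case (Cons a xs)
  have "runs (Pop k) s 1 (s[k := xs @ 4 # r])"
    using Cons.prems by (intro runs_Pop) auto
  moreover have "runs (clear_loop k) (s[k := xs @ 4 # r]) (3 * length xs + 1) (s[k := 4 # r])"
    using Cons.IH[of "s[k := xs @ 4 # r]" "3 * length xs + 1"] Cons.prems by simp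
  ultimately show ?case using Cons.prems unfolding clear_loop_def
    by (intro runs_LoopT[of k s "{2, 3}" "Pop k" 1 "s[k := xs @ 4 # r]" "3 * length xs + 1"]) simp_all
qed

section \<open>Copying, exchanging, discarding and comparing trees\<close>

definition dup :: com where
  "dup = Push 2 4 ;; scan 2 ;; Push 3 4 ;; move2 2 1 3 ;; Push 2 4 ;; move 3 2 ;; move 2 1"

definition swap :: com where
  "swap = Push 2 4 ;; scan 2 ;; Push 0 4 ;; scan 0 ;; move 2 1 ;; move 0 1"

definition drop_tree :: com where
  "drop_tree = Push 2 4 ;; scan 2 ;; clear_loop 2 ;; Pop 2"

lemma runs_Push4: "runs (Push 2 4) [I, A, B, C] 2 [I, A, 4 # B, C]"
  "runs (Push 0 4) [I, A, B, C] 2 [4 # I, A, B, C]"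
  "runs (Push 3 4) [I, A, B, C] 2 [I, A, B, 4 # C]"
  by (rule runs_Push, simp, simp, simp)+

lemma runs_scan4: "runs (scan 2) [I, code x @ A, B, C] (12 * length (code x) + 10) [I, A, rev (code x) @ B, C]"
  "runs (scan 0) [I, code x @ A, B, C] (12 * length (code x) + 10) [rev (code x) @ I, A, B, C]"
  using runs_scan[of 2] runs_scan[of 0] by simp_all

lemma runs_move4:
  assumes "set xs \<subseteq> {2, 3}"
  shows "runs (move 2 1) [I, A, xs @ 4 # B, C] (10 * length xs + 5) [I, rev xs @ A, B, C]"
    "runs (move 0 1) [xs @ 4 # I, A, B, C] (10 * length xs + 5) [I, rev xs @ A, B, C]"
    "runs (move 3 2) [I, A, B, xs @ 4 # C] (10 * length xs + 5) [I, A, rev xs @ B, C]"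
    "runs (move2 2 1 3) [I, A, xs @ 4 # B, C] (10 * length xs + 5) [I, rev xs @ A, B, rev xs @ C]"
  using runs_move[OF _ _ _ _ assms _ order.refl refl, of 2 1 "[I, A, xs @ 4 # B, C]" B]
    runs_move[OF _ _ _ _ assms _ order.refl refl, of 0 1 "[xs @ 4 # I, A, B, C]" I]
    runs_move[OF _ _ _ _ assms _ order.refl refl, of 3 2 "[I, A, B, xs @ 4 # C]" C]
    runs_move2[OF _ _ _ _ _ assms _ order.refl refl, of 2 1 3 "[I, A, xs @ 4 # B, C]" B]
  by simp_all

lemma set_code_rev: "set (rev (code x)) \<subseteq> {2, 3}"
  using set_code by simp

lemmas runs_move_code = runs_move4[OF set_code] runs_move4[OF set_code_rev, unfolded rev_rev_ident length_rev]

text \<open>\<open>move2\<close> writes both copies in the right order. The one on stack 3 reaches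
  stack 1 through stack 2, because two reversals cancel.\<close>

lemma runs_dup:
  "runs dup [I, code x @ A, B, C] (42 * length (code x) + 40) [I, code x @ code x @ A, B, C]"
  unfolding dup_def
  by (rule runs_mono,
      ((rule runs_Push4 runs_scan4 runs_move_code | (rule runs_append, (rule runs_Push4 runs_scan4 runs_move_code)[1]))+)[1], simp)

lemma runs_swap:
  "runs swap [I, code x @ code y @ A, B, C] (22 * length (code x) + 22 * length (code y) + 40)
     [I, code y @ code x @ A, B, C]"
  unfolding swap_def
  by (rule runs_mono,
      ((rule runs_Push4 runs_scan4 runs_move_code | (rule runs_append, (rule runs_Push4 runs_scan4 runs_move_code)[1]))+)[1], simp)

lemma runs_drop_tree: "runs drop_tree [I, code x @ A, B, C] (15 * length (code x) + 20) [I, A, B, C]"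
proof -
  have 1: "runs (clear_loop 2) [I, A, rev (code x) @ 4 # B, C] (3 * length (code x) + 1) [I, A, 4 # B, C]"
    using runs_clear_loop[of 2 "[I, A, rev (code x) @ 4 # B, C]" "rev (code x)" B] set_code_rev[of x] by simp
  have 2: "runs (Pop 2) [I, A, 4 # B, C] 1 [I, A, B, C]" by (rule runs_Pop) auto
  show ?thesis unfolding drop_tree_def
    by (rule runs_mono[OF runs_append[OF runs_Push4(1) runs_append[OF runs_scan4(1) runs_append[OF 1 2]]]]) simp
qed

text \<open>The pushed symbol makes the word on stack 0 nonempty for certain: after the loop,
  \<open>eq_tree\<close> takes an empty word there as equality.\<close>

definition eq_mismatch :: com where
  "eq_mismatch = clear_loop 2 ;; Push 0 2"

definition eq_body :: com where
  "eq_body = Cond 2 {3} (Cond 0 {3} (Pop 2 ;; Pop 0) eq_mismatch) (Cond 0 {2} (Pop 2 ;; Pop 0) eq_mismatch)"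

definition eq_tree :: com where
  "eq_tree = Push 2 4 ;; scan 2 ;; Push 0 4 ;; scan 0 ;; Loop 2 {2, 3} eq_body ;;
     Cond 0 {4} (Push 1 2 ;; Push 1 2 ;; Push 1 3) (Push 1 2) ;; clear_loop 0 ;; Pop 0 ;; Pop 2"

lemma eq_loop:
  assumes "set us \<subseteq> {2, 3}" "set vs \<subseteq> {2, 3}"
  shows "\<exists>ws. set ws \<subseteq> {2, 3} \<and> length ws \<le> Suc (length us) \<and> (ws = [] \<longleftrightarrow> us = vs) \<and>
    runs (Loop 2 {2, 3} eq_body) [us @ 4 # I, A, vs @ 4 # B, C] (12 * length vs + 20) [ws @ 4 # I, A, 4 # B, C]"
  using assms
proof (induction vs arbitrary: us)
  case Nil
  then show ?case by (intro exI[of _ us]) (auto intro: runs_LoopF)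
next
  case (Cons v vs)
  from Cons.prems have v: "v = 2 \<or> v = 3" by auto
  show ?case
  proof (cases "\<exists>us'. us = v # us'")
    case True
    then obtain us' where us: "us = v # us'" by blast
    have "runs eq_body [us @ 4 # I, A, (v # vs) @ 4 # B, C] 10 [us' @ 4 # I, A, vs @ 4 # B, C]"
      using v
    proof
      assume "v = 2"
      then show ?thesis unfolding eq_body_def using us
        by - (rule runs_CondF, simp, simp, simp, (rule runs_CondT runs_Pop_Seq runs_Pop | simp)+)
    next
      assume "v = 3"
      then show ?thesis unfolding eq_body_def using us
        by - (rule runs_CondT runs_Pop_Seq runs_Pop | simp)+
    qed
    note step = runs_LoopT[OF _ _ this]
    from Cons.IH[of us'] Cons.prems us obtain ws where "set ws \<subseteq> {2, 3}" "length ws \<le> Suc (length us')"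
      "ws = [] \<longleftrightarrow> us' = vs"
      "runs (Loop 2 {2, 3} eq_body) [us' @ 4 # I, A, vs @ 4 # B, C] (12 * length vs + 20) [ws @ 4 # I, A, 4 # B, C]"
      by auto
    with v us Cons.prems show ?thesis by (intro exI[of _ ws] conjI step) auto
  next
    case False
    then have hd: "peek (us @ 4 # I) \<noteq> v" using v by (cases us) auto
    let ?s = "[us @ 4 # I, A, (v # vs) @ 4 # B, C]" and ?s' = "[(2 # us) @ 4 # I, A, 4 # B, C]"
    have 1: "runs (clear_loop 2) ?s (3 * length (v # vs) + 1) [us @ 4 # I, A, 4 # B, C]"
      using runs_clear_loop[of 2 ?s "v # vs" B "3 * length (v # vs) + 1"] Cons.prems by simp
    have 2: "runs (Push 0 2) [us @ 4 # I, A, 4 # B, C] 2 ?s'" by (rule runs_Push) auto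
    have mis: "runs eq_mismatch ?s (3 * length vs + 6) ?s'"
      unfolding eq_mismatch_def by (rule runs_mono[OF runs_append[OF 1 2]]) simp
    have "runs eq_body ?s (3 * length vs + 10) ?s'"
      using v
    proof
      assume "v = 2"
      with hd show ?thesis unfolding eq_body_def
        by - (rule runs_CondF, simp, simp, simp, rule runs_CondF, simp, simp, simp, rule runs_mono[OF mis], simp)
    next
      assume "v = 3"
      with hd show ?thesis unfolding eq_body_def
        by - (rule runs_CondT, simp, simp, simp, rule runs_CondF, simp, simp, simp, rule runs_mono[OF mis], simp)
    qed
    note step = runs_LoopT[OF _ _ this]
    have "us \<noteq> v # vs" using False by blast
    with v Cons.prems show ?thesis
      by (intro exI[of _ "2 # us"] conjI step[OF _ _ runs_LoopF]) auto
  qed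
qed

lemma runs_eq_tree:
  "runs eq_tree [I, code x @ code y @ A, B, C] (40 * length (code x) + 40 * length (code y) + 80)
     [I, code (if x = y then Node Leaf Leaf else Leaf) @ A, B, C]"
proof -
  let ?x = "rev (code x)" and ?y = "rev (code y)"
  obtain ws where ws: "set ws \<subseteq> {2, 3}" "length ws \<le> Suc (length ?y)" "ws = [] \<longleftrightarrow> ?y = ?x"
    and 1: "runs (Loop 2 {2, 3} eq_body) [?y @ 4 # I, A, ?x @ 4 # B, C] (12 * length ?x + 20) [ws @ 4 # I, A, 4 # B, C]"
    using eq_loop[OF set_code_rev set_code_rev] by blast
  let ?A = "code (if x = y then Node Leaf Leaf else Leaf) @ A"
  have peek: "peek (ws @ 4 # I) = 4 \<longleftrightarrow> x = y" using ws by (cases ws) auto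
  have 2: "runs (Cond 0 {4} (Push 1 2 ;; Push 1 2 ;; Push 1 3) (Push 1 2)) [ws @ 4 # I, A, 4 # B, C] 10
    [ws @ 4 # I, ?A, 4 # B, C]"
  proof (cases "x = y")
    case True
    with peek show ?thesis by - (rule runs_CondT runs_Push_Seq runs_Push | simp)+
  next
    case False
    with peek show ?thesis by - (rule runs_CondF runs_Push_Seq runs_Push | simp)+
  qed
  have 3: "runs (clear_loop 0) [ws @ 4 # I, ?A, 4 # B, C] (3 * length ws + 1) [4 # I, ?A, 4 # B, C]"
    using runs_clear_loop[of 0 "[ws @ 4 # I, ?A, 4 # B, C]" ws I] ws by simp
  have 4: "runs (Pop 0 ;; Pop 2) [4 # I, ?A, 4 # B, C] 2 [I, ?A, B, C]"
    by (rule runs_Pop_Seq runs_Pop | simp)+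
  show ?thesis unfolding eq_tree_def
    by (rule runs_mono[OF runs_append[OF runs_Push4(1) runs_append[OF runs_scan4(1) runs_append[OF runs_Push4(2)
      runs_append[OF runs_scan4(2) runs_append[OF 1 runs_append[OF 2 runs_append[OF 3 4]]]]]]]]) (use ws in simp)
qed

lemma com_ok_primitives: "com_ok dup" "com_ok swap" "com_ok drop_tree" "com_ok eq_tree"
  by (simp_all add: dup_def swap_def drop_tree_def eq_tree_def eq_body_def eq_mismatch_def clear_loop_def
      scan_def scan_body_def move_def move2_def)

section \<open>Encodable types and polynomial bounds\<close>

text \<open>Injectivity is demanded within a type only. Values of different types may share a code,
  and \<open>pt_cast\<close> takes advantage of this.\<close>

class enc =
  fixes tr :: "'a \<Rightarrow> tree"
  assumes tr_inject [simp]: "tr x = tr y \<longleftrightarrow> x = y"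

instantiation tree :: enc
begin
definition "tr (x :: tree) = x"
instance by standard (simp add: tr_tree_def)
end

instantiation bool :: enc
begin
definition "tr b = (if b then Node Leaf Leaf else Leaf)"
instance by standard (simp add: tr_bool_def)
end

text \<open>Unary, as lists of \<open>Leaf\<close>. The type is therefore used for quantities
  polynomial in the input; weights are kept as lists of bits.\<close>

instantiation nat :: enc
begin
fun tr_nat :: "nat \<Rightarrow> tree" where
  "tr_nat 0 = Leaf"
| "tr_nat (Suc n) = Node Leaf (tr_nat n)"
instance
proof
  show "tr x = tr y \<longleftrightarrow> x = y" for x y :: nat
    by (induction x arbitrary: y; case_tac y; simp)
qed
end

instantiation prod :: (enc, enc) enc
begin
definition "tr p = Node (tr (fst p)) (tr (snd p))"
instance by standard (auto simp: tr_prod_def prod_eq_iff)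
end

instantiation list :: (enc) enc
begin
fun tr_list :: "'a list \<Rightarrow> tree" where
  "tr_list [] = Leaf"
| "tr_list (x # xs) = Node (tr x) (tr_list xs)"
instance
proof
  show "tr x = tr y \<longleftrightarrow> x = y" for x y :: "'a list"
    by (induction x arbitrary: y; case_tac y; simp)
qed
end

lemmas tr_simps = tr_tree_def tr_bool_def tr_prod_def

definition sz :: "'a::enc \<Rightarrow> nat" where
  "sz x = length (code (tr x))"

lemma sz_pos [simp]: "0 < sz x"
  by (simp add: sz_def)

lemma sz_simps [simp]:
  "sz (0::nat) = 1" "sz (Suc n) = sz n + 2" "sz (a, b) = sz a + sz b + 1"
  "sz [] = 1" "sz (x # xs) = sz x + sz xs + 1" "sz Leaf = 1" "sz (Node l r) = sz l + sz r + 1"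
  "sz False = 1" "sz True = 3" "sz (tr a) = sz a"
  by (auto simp: sz_def tr_simps)

lemma sz_nat: "sz (n::nat) = 2 * n + 1"
  by (induction n) auto

lemma length_le_sz: "2 * length xs + 1 \<le> sz xs"
proof (induction xs)
  case (Cons a xs)
  then show ?case using sz_pos[of a] by (simp del: sz_pos)
qed simp

lemma sz_append: "sz (xs @ ys) + 1 = sz xs + sz ys"
  by (induction xs) auto

lemma poly_nat_mono: "m \<le> n \<Longrightarrow> poly p m \<le> poly (p :: nat poly) n"
  by (induction p) (auto intro: add_mono mult_mono)

definition pbd :: "('a::enc \<Rightarrow> nat) \<Rightarrow> bool" where
  "pbd g \<longleftrightarrow> (\<exists>p::nat poly. \<forall>x. g x \<le> poly p (sz x))"

named_theorems pbdi

lemma pbd_const [pbdi]: "pbd (\<lambda>x. n)"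
  unfolding pbd_def by (intro exI[of _ "[:n:]"]) simp

lemma pbd_sz: "pbd sz"
  unfolding pbd_def by (intro exI[of _ "[:0, 1:]"]) simp

lemma pbd_add [pbdi]: "pbd f \<Longrightarrow> pbd g \<Longrightarrow> pbd (\<lambda>x. f x + g x)"
  unfolding pbd_def by (metis add_mono poly_add)

lemma pbd_mult [pbdi]: "pbd f \<Longrightarrow> pbd g \<Longrightarrow> pbd (\<lambda>x. f x * g x)"
  unfolding pbd_def by (metis mult_mono' poly_mult zero_le)

lemma pbd_mono: "pbd g \<Longrightarrow> (\<And>x. f x \<le> g x) \<Longrightarrow> pbd f"
  unfolding pbd_def by (meson le_trans)

lemma pbd_poly [pbdi]: "pbd g \<Longrightarrow> pbd (\<lambda>x. poly (p :: nat poly) (g x))"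
  unfolding pbd_def by (metis poly_pcompose poly_nat_mono le_trans)

text \<open>Polynomials with natural coefficients are monotone, so an upper bound on the size of
  \<open>f x\<close> may be inserted into the bound for \<open>g\<close>.\<close>

lemma pbd_comp: "pbd g \<Longrightarrow> pbd (\<lambda>x. sz (f x)) \<Longrightarrow> pbd (\<lambda>x. g (f x))"
  unfolding pbd_def by (metis poly_pcompose poly_nat_mono le_trans)

lemma pbd_Suc [pbdi]: "pbd f \<Longrightarrow> pbd (\<lambda>x. Suc (f x))"
  using pbd_add[OF _ pbd_const[of 1]] by auto

lemma pbd_sz_simps [pbdi]:
  "pbd (\<lambda>x. sz x)" "pbd (\<lambda>x. sz (f x)) \<Longrightarrow> pbd (\<lambda>x. sz (g x)) \<Longrightarrow> pbd (\<lambda>x. sz (f x, g x))"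
  using pbd_sz by (auto intro!: pbdi)


section \<open>Functions computable in polynomial time\<close>

text \<open>The quantification over \<open>I\<close>, \<open>A\<close>, \<open>B\<close> and
  \<open>C\<close> is a frame condition: everything below the argument survives, so a program can
  run while other trees wait on the stacks.\<close>

definition pt :: "('a::enc \<Rightarrow> 'b::enc) \<Rightarrow> bool" where
  "pt f \<longleftrightarrow> (\<exists>c T. com_ok c \<and> pbd T \<and> (\<forall>x I A B C.
     runs c [I, code (tr x) @ A, B, C] (T x) [I, code (tr (f x)) @ A, B, C]))"

lemma ptI:
  assumes "com_ok c" "pbd T"
    "\<And>x I A B C. runs c [I, code (tr x) @ A, B, C] (T x) [I, code (tr (f x)) @ A, B, C]"
  shows "pt f"
  using assms unfolding pt_def by blast

lemma pt_sz:
  assumes "pt f"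
  shows "pbd (\<lambda>x. sz (f x))"
proof -
  from assms obtain c T where "pbd T" and
    c: "\<And>x I A B C. runs c [I, code (tr x) @ A, B, C] (T x) [I, code (tr (f x)) @ A, B, C]"
    unfolding pt_def by blast
  have "sz (f x) \<le> sz x + T x" for x
    using c[of "[]" x "[]" "[]" "[]"] exec_sum_length unfolding runs_def sz_def by fastforce
  then show ?thesis by (rule pbd_mono[rotated]) (intro pbdi \<open>pbd T\<close>)
qed

text \<open>A program sees codes only, so the one for \<open>f\<close> also computes any function
  that agrees with \<open>f\<close> on the level of codes. This changes types for free: a nonempty
  list is a pair of head and tail, and \<open>Suc n\<close> is a pair of \<open>False\<close> and
  \<open>n\<close>.\<close>

lemma pt_cast:
  assumes "pt f" "\<And>x. \<exists>y. tr y = tr x \<and> tr (f y) = tr (g x)"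
  shows "pt g"
proof -
  from assms(1) obtain c T where c: "com_ok c" "pbd T"
    "\<And>x I A B C. runs c [I, code (tr x) @ A, B, C] (T x) [I, code (tr (f x)) @ A, B, C]"
    unfolding pt_def by blast
  then obtain p where p: "\<And>x. T x \<le> poly p (sz x)" unfolding pbd_def by blast
  show ?thesis
  proof (rule ptI[OF c(1)])
    show "pbd (\<lambda>x. poly p (sz x))" by (intro pbdi)
    fix x I A B C
    from assms(2)[of x] obtain y where y: "tr y = tr x" "tr (f y) = tr (g x)" by blast
    then have "T y \<le> poly p (sz x)" using p[of y] by (simp add: sz_def)
    from runs_mono[OF c(3)[of I y A B C] this] y
    show "runs c [I, code (tr x) @ A, B, C] (poly p (sz x)) [I, code (tr (g x)) @ A, B, C]" by simp
  qed
qed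

lemma pt_comp:
  assumes "pt f" "pt g"
  shows "pt (\<lambda>x. f (g x))"
proof -
  from assms obtain c T d U where c: "com_ok c" "pbd T"
    "\<And>x I A B C. runs c [I, code (tr x) @ A, B, C] (T x) [I, code (tr (f x)) @ A, B, C]"
    and d: "com_ok d" "pbd U"
    "\<And>x I A B C. runs d [I, code (tr x) @ A, B, C] (U x) [I, code (tr (g x)) @ A, B, C]"
    unfolding pt_def by blast
  show ?thesis
  proof (rule ptI)
    show "com_ok (d ;; c)" using c d by simp
    show "pbd (\<lambda>x. U x + T (g x))" by (intro pbdi d pbd_comp[OF c(2)] pt_sz assms)
    show "runs (d ;; c) [I, code (tr x) @ A, B, C] (U x + T (g x)) [I, code (tr (f (g x))) @ A, B, C]" for x I A B C
      by (rule runs_append[OF d(3) c(3)])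
  qed
qed

named_theorems pti

definition skip :: com where
  "skip = Push 1 2 ;; Pop 1"

lemma com_ok_skip [simp]: "com_ok skip"
  by (simp add: skip_def)

lemma runs_skip: "length s = 4 \<Longrightarrow> runs skip s 3 s"
  unfolding skip_def by (rule runs_Push_Seq runs_Pop | simp)+

lemma pt_id [pti]: "pt (\<lambda>x. x)"
  by (rule ptI[of skip "\<lambda>x. 3"]) (auto intro: runs_skip pbdi)

fun push_list :: "nat list \<Rightarrow> com" where
  "push_list [] = skip"
| "push_list (a # xs) = push_list xs ;; Push 1 a"

lemma runs_push_list: "runs (push_list xs) [I, A, B, C] (2 * length xs + 3) [I, xs @ A, B, C]"
proof (induction xs)
  case (Cons a xs)
  show ?case by (simp, rule runs_Seq[OF Cons runs_Push]) auto
qed (simp add: runs_skip)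

lemma com_ok_push_list: "set xs \<subseteq> {2, 3} \<Longrightarrow> com_ok (push_list xs)"
  by (induction xs) auto

lemma pt_const [pti]: "pt (\<lambda>x. a)"
proof (rule ptI)
  show "com_ok (drop_tree ;; push_list (code (tr a)))"
    using com_ok_push_list[OF set_code] by (simp add: com_ok_primitives)
  show "pbd (\<lambda>x. (15 * sz x + 20) + (2 * length (code (tr a)) + 3))" by (intro pbdi)
  show "runs (drop_tree ;; push_list (code (tr a))) [I, code (tr x) @ A, B, C]
    ((15 * sz x + 20) + (2 * length (code (tr a)) + 3)) [I, code (tr a) @ A, B, C]" for x :: 'a and I A B C
    unfolding sz_def by (rule runs_append[OF runs_drop_tree runs_push_list])
qed

lemma pt_Pair [pti]:
  assumes "pt f" "pt g"
  shows "pt (\<lambda>x. (f x, g x))"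
proof -
  from assms obtain c T d U where c: "com_ok c" "pbd T"
    "\<And>x I A B C. runs c [I, code (tr x) @ A, B, C] (T x) [I, code (tr (f x)) @ A, B, C]"
    and d: "com_ok d" "pbd U"
    "\<And>x I A B C. runs d [I, code (tr x) @ A, B, C] (U x) [I, code (tr (g x)) @ A, B, C]"
    unfolding pt_def by blast
  show ?thesis
  proof (rule ptI)
    show "com_ok (dup ;; d ;; swap ;; c ;; Push 1 3)" using c d by (simp add: com_ok_primitives)
    show "pbd (\<lambda>x. (42 * sz x + 40) + (U x + ((22 * sz (g x) + 22 * sz x + 40) + (T x + 2))))"
      by (intro pbdi d c pt_sz assms)
    show "runs (dup ;; d ;; swap ;; c ;; Push 1 3) [I, code (tr x) @ A, B, C]
      ((42 * sz x + 40) + (U x + ((22 * sz (g x) + 22 * sz x + 40) + (T x + 2))))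
      [I, code (tr (f x, g x)) @ A, B, C]" for x I A B C
      unfolding sz_def
      by (rule runs_append[OF runs_dup runs_append[OF d(3) runs_append[OF runs_swap runs_append[OF c(3) runs_Push]]]])
        (auto simp: tr_prod_def)
  qed
qed

fun left :: "tree \<Rightarrow> tree" where
  "left Leaf = Leaf"
| "left (Node a b) = a"

fun right :: "tree \<Rightarrow> tree" where
  "right Leaf = Leaf"
| "right (Node a b) = b"

lemma pt_left: "pt left"
proof (rule ptI)
  let ?c = "Cond 1 {3} (Pop 1 ;; swap ;; drop_tree) skip"
  show "com_ok ?c" by (simp add: com_ok_primitives)
  show "pbd (\<lambda>x. 63 + 59 * sz x)" by (intro pbdi)
  show "runs ?c [I, code (tr x) @ A, B, C] (63 + 59 * sz x) [I, code (tr (left x)) @ A, B, C]" for x :: tree and I A B C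
  proof (cases x)
    case Leaf
    then show ?thesis by - (rule runs_CondF runs_mono[OF runs_skip] | simp add: tr_tree_def)+
  next
    case (Node a b)
    then show ?thesis
      by - (rule runs_CondT, simp add: tr_tree_def, simp add: tr_tree_def, simp, rule runs_Pop_Seq,
          simp, simp, simp, rule runs_mono[OF runs_append[OF _ runs_drop_tree]], simp add: tr_tree_def,
          rule runs_swap, simp add: sz_def tr_tree_def)
  qed
qed

lemma pt_right: "pt right"
proof (rule ptI)
  let ?c = "Cond 1 {3} (Pop 1 ;; drop_tree) skip"
  show "com_ok ?c" by (simp add: com_ok_primitives)
  show "pbd (\<lambda>x. 33 + 15 * sz x)" by (intro pbdi)
  show "runs ?c [I, code (tr x) @ A, B, C] (33 + 15 * sz x) [I, code (tr (right x)) @ A, B, C]" for x :: tree and I A B C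
  proof (cases x)
    case Leaf
    then show ?thesis by - (rule runs_CondF runs_mono[OF runs_skip] | simp add: tr_tree_def)+
  next
    case (Node a b)
    then show ?thesis
      by - (rule runs_CondT, simp add: tr_tree_def, simp add: tr_tree_def, simp, rule runs_Pop_Seq,
          simp, simp, simp, rule runs_mono, simp add: tr_tree_def,
          rule runs_drop_tree, simp add: sz_def tr_tree_def)
  qed
qed

lemma pt_via_tree:
  assumes "pt F" "pt f" "\<And>x. tr (h x) = F (tr (f x))"
  shows "pt h"
  by (rule pt_cast[OF pt_comp[OF assms(1) pt_cast[OF assms(2), of "\<lambda>x. tr (f x)"]]])
    (auto simp: assms(3) tr_tree_def)

lemma pt_fst [pti]: "pt f \<Longrightarrow> pt (\<lambda>x. fst (f x))"
  by (rule pt_via_tree[OF pt_left]) (auto simp: tr_prod_def)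

lemma pt_snd [pti]: "pt f \<Longrightarrow> pt (\<lambda>x. snd (f x))"
  by (rule pt_via_tree[OF pt_right]) (auto simp: tr_prod_def)

lemma pt_eq [pti]:
  fixes f g :: "'a::enc \<Rightarrow> 'b::enc"
  assumes "pt f" "pt g"
  shows "pt (\<lambda>x. f x = g x)"
proof -
  have "pt (\<lambda>p :: 'b \<times> 'b. fst p = snd p)"
  proof (rule ptI)
    show "com_ok (Pop 1 ;; eq_tree)" by (simp add: com_ok_primitives)
    show "pbd (\<lambda>x. 80 * sz x + 81)" by (intro pbdi)
    show "runs (Pop 1 ;; eq_tree) [I, code (tr p) @ A, B, C] (80 * sz p + 81) [I, code (tr (fst p = snd p)) @ A, B, C]"
      for p :: "'b \<times> 'b" and I A B C
      using runs_mono[OF runs_eq_tree[of I "tr (fst p)" "tr (snd p)" A B C]]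
      by - (rule runs_Pop_Seq, simp, simp add: tr_prod_def, simp, simp add: tr_prod_def tr_bool_def sz_def)
  qed
  from pt_comp[OF this pt_Pair[OF assms]] show ?thesis by simp
qed


text \<open>The code of \<open>True\<close> is 3, 2, 2 and that of \<open>False\<close> is 2: the
  top symbol decides, and three pops or one remove the value.\<close>

lemma runs_branch:
  assumes d: "\<And>I A B C. runs d [I, code (tr x) @ A, B, C] n [I, code (tr (b :: bool)) @ A, B, C]"
    and "b \<Longrightarrow> runs c1 [I, code (tr x) @ A, B, C] m s'"
    and "\<not> b \<Longrightarrow> runs c2 [I, code (tr x) @ A, B, C] m s'"
  shows "runs (dup ;; d ;; Cond 1 {3} (Pop 1 ;; Pop 1 ;; Pop 1 ;; c1) (Pop 1 ;; c2))
    [I, code (tr x) @ A, B, C] ((42 * sz x + 40) + (n + (5 + m))) s'"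
proof -
  have "runs (Cond 1 {3} (Pop 1 ;; Pop 1 ;; Pop 1 ;; c1) (Pop 1 ;; c2))
    [I, code (tr b) @ code (tr x) @ A, B, C] (5 + m) s'"
  proof (cases b)
    case True
    with assms(2) show ?thesis
      by - (rule runs_CondT runs_Pop_Seq | simp add: tr_bool_def)+
  next
    case False
    with assms(3) show ?thesis
      by - (rule runs_CondF runs_Pop_Seq | simp add: tr_bool_def runs_mono)+
  qed
  from runs_append[OF runs_dup runs_append[OF d this]] show ?thesis by (simp add: sz_def)
qed

text \<open>\<open>f\<close> receives \<open>l x\<close> through its code, as a value
  \<open>y\<close> of its own type that has to exist only if the test succeeds. Thus a pair of
  \<open>x\<close> and a list can be reread as \<open>x\<close>, head and tail once the list is
  known to be nonempty.\<close>

lemma pt_branch: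
  assumes "pt b" "pt f" "pt g" "pt l"
    and F: "\<And>x. b x \<Longrightarrow> \<exists>y. tr y = tr (l x) \<and> tr (f y) = tr (h x)"
    and G: "\<And>x. \<not> b x \<Longrightarrow> tr (g x) = tr (h x)"
  shows "pt h"
proof -
  from assms(1) obtain d U where d: "com_ok d" "pbd U"
    "\<And>x I A B C. runs d [I, code (tr x) @ A, B, C] (U x) [I, code (tr (b x)) @ A, B, C]"
    unfolding pt_def by blast
  from assms(2) obtain c1 T1 where c1: "com_ok c1" "pbd T1"
    "\<And>x I A B C. runs c1 [I, code (tr x) @ A, B, C] (T1 x) [I, code (tr (f x)) @ A, B, C]"
    unfolding pt_def by blast
  from assms(3) obtain c2 T2 where c2: "com_ok c2" "pbd T2"
    "\<And>x I A B C. runs c2 [I, code (tr x) @ A, B, C] (T2 x) [I, code (tr (g x)) @ A, B, C]"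
    unfolding pt_def by blast
  from assms(4) obtain c3 T3 where c3: "com_ok c3" "pbd T3"
    "\<And>x I A B C. runs c3 [I, code (tr x) @ A, B, C] (T3 x) [I, code (tr (l x)) @ A, B, C]"
    unfolding pt_def by blast
  from c1(2) obtain p where p: "\<And>x. T1 x \<le> poly p (sz x)" unfolding pbd_def by blast
  let ?c = "dup ;; d ;; Cond 1 {3} (Pop 1 ;; Pop 1 ;; Pop 1 ;; c3 ;; c1) (Pop 1 ;; c2)"
  show ?thesis
  proof (rule ptI)
    show "com_ok ?c" using c1 c2 c3 d by (simp add: com_ok_primitives)
    show "pbd (\<lambda>x. (42 * sz x + 40) + (U x + (5 + (T2 x + (T3 x + poly p (sz (l x)))))))"
      by (intro pbdi d c2 c3 pt_sz assms)
    show "runs ?c [I, code (tr x) @ A, B, C] ((42 * sz x + 40) + (U x + (5 + (T2 x + (T3 x + poly p (sz (l x)))))))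
      [I, code (tr (h x)) @ A, B, C]" for x I A B C
    proof (rule runs_branch[OF d(3)])
      assume "b x"
      then obtain y where y: "tr y = tr (l x)" "tr (f y) = tr (h x)" using F by blast
      then have "T1 y \<le> poly p (sz (l x))" using p[of y] by (simp add: sz_def)
      then show "runs (c3 ;; c1) [I, code (tr x) @ A, B, C] (T2 x + (T3 x + poly p (sz (l x)))) [I, code (tr (h x)) @ A, B, C]"
        using runs_append[OF c3(3)[of I x A B C] c1(3)[of I y A B C, unfolded y]]
        by - (erule runs_mono, simp)
    next
      assume "\<not> b x"
      then show "runs c2 [I, code (tr x) @ A, B, C] (T2 x + (T3 x + poly p (sz (l x)))) [I, code (tr (h x)) @ A, B, C]"
        using runs_mono[OF c2(3)[of I x A B C]] G by fastforce
    qed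
  qed
qed

lemma pt_if [pti]: "pt b \<Longrightarrow> pt f \<Longrightarrow> pt g \<Longrightarrow> pt (\<lambda>x. if b x then f x else g x)"
  by (rule pt_branch[of b f g "\<lambda>x. x"]) (auto intro: pti)

lemma runs_Pop_True:
  "runs c [I, A, B, C] b s' \<Longrightarrow>
   runs (Pop 1 ;; Pop 1 ;; Pop 1 ;; c) [I, code (tr True) @ A, B, C] (b + 3) s'"
  by (rule runs_Pop_Seq | simp add: tr_bool_def)+

(* Between two iterations the value of the test is on top of the stack; its first symbol, which is
   3 for True and 2 for False, controls the loop. *)
lemma pt_iterate:
  fixes b :: "'a::enc \<Rightarrow> bool" and a :: "'x::enc \<Rightarrow> 'a"
  assumes b: "pt b" and f: "pt f" and a: "pt a" and N: "pbd N" and S: "pbd S"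
    and h: "\<And>x. \<exists>n\<le>N x. h x = (f ^^ n) (a x) \<and> \<not> b ((f ^^ n) (a x)) \<and>
      (\<forall>i<n. b ((f ^^ i) (a x))) \<and> (\<forall>i\<le>n. sz ((f ^^ i) (a x)) \<le> S x)"
  shows "pt h"
proof -
  from b obtain d U where d: "com_ok d" "pbd U"
    "\<And>x I A B C. runs d [I, code (tr x) @ A, B, C] (U x) [I, code (tr (b x)) @ A, B, C]"
    unfolding pt_def by blast
  from f obtain c T where c: "com_ok c" "pbd T"
    "\<And>x I A B C. runs c [I, code (tr x) @ A, B, C] (T x) [I, code (tr (f x)) @ A, B, C]"
    unfolding pt_def by blast
  from a obtain e V where e: "com_ok e" "pbd V"
    "\<And>x I A B C. runs e [I, code (tr x) @ A, B, C] (V x) [I, code (tr (a x)) @ A, B, C]"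
    unfolding pt_def by blast
  from d(2) obtain p where p: "\<And>x. U x \<le> poly p (sz x)" unfolding pbd_def by blast
  from c(2) obtain q where q: "\<And>x. T x \<le> poly q (sz x)" unfolding pbd_def by blast
  let ?test = "dup ;; d"
  let ?body = "Pop 1 ;; Pop 1 ;; Pop 1 ;; c ;; dup ;; d"
  let ?loop = "Loop 1 {3} ?body"
  let ?B = "\<lambda>s. 42 * s + 40 + poly p s"
  have test: "runs ?test [I, code (tr x) @ A, B, C] (?B s) [I, code (tr (b x)) @ code (tr x) @ A, B, C]"
    if "sz x \<le> s" for x s I A B C
    using p[of x] poly_nat_mono[OF that, of p] that
    by (intro runs_mono[OF runs_append[OF runs_dup d(3)]]) (simp add: sz_def)
  have loop: "runs ?loop [I, code (tr (b x)) @ code (tr x) @ A, B, C] (n * (poly q s + ?B s + 5) + 1)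
      [I, code (tr (b ((f ^^ n) x))) @ code (tr ((f ^^ n) x)) @ A, B, C]"
    if "\<not> b ((f ^^ n) x)" "\<forall>i<n. b ((f ^^ i) x)" "\<forall>i\<le>n. sz ((f ^^ i) x) \<le> s" for n s x I A B C
    using that
  proof (induction n arbitrary: x)
    case 0
    then show ?case by (intro runs_LoopF) (auto simp: tr_bool_def)
  next
    case (Suc n)
    from Suc.prems(2) have bx: "b x" by (metis funpow_0 zero_less_Suc)
    have s: "sz x \<le> s" "sz (f x) \<le> s"
      using Suc.prems(3)[rule_format, of 0] Suc.prems(3)[rule_format, of 1] by auto
    have Tx: "T x \<le> poly q s" using q[of x] poly_nat_mono[OF s(1), of q] by simp
    have 1: "runs ?body [I, code (tr (b x)) @ code (tr x) @ A, B, C] (poly q s + ?B s + 3)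
      [I, code (tr (b (f x))) @ code (tr (f x)) @ A, B, C]"
      using bx runs_Pop_True[OF runs_append[OF runs_mono[OF c(3) Tx] test[OF s(2)]]]
      by (simp add: tr_bool_def)
    have 2: "runs ?loop [I, code (tr (b (f x))) @ code (tr (f x)) @ A, B, C] (n * (poly q s + ?B s + 5) + 1)
      [I, code (tr (b ((f ^^ n) (f x)))) @ code (tr ((f ^^ n) (f x))) @ A, B, C]"
    proof (rule Suc.IH)
      show "\<not> b ((f ^^ n) (f x))" using Suc.prems(1) by (simp add: funpow_swap1)
      show "\<forall>i<n. b ((f ^^ i) (f x))"
        using Suc.prems(2) by (metis Suc_less_eq comp_apply funpow_Suc_right)
      show "\<forall>i\<le>n. sz ((f ^^ i) (f x)) \<le> s"
        using Suc.prems(3) by (metis Suc_le_mono comp_apply funpow_Suc_right)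
    qed
    show ?case
      unfolding funpow_Suc_right o_apply
      by (rule runs_LoopT[OF _ _ 1 2]) (use bx in \<open>auto simp: tr_bool_def\<close>)
  qed
  show ?thesis
  proof (rule ptI)
    show "com_ok (e ;; ?test ;; ?loop ;; Pop 1)" using c d e by (simp add: com_ok_primitives)
    let ?T = "\<lambda>x. V x + (?B (S x) + ((N x * (poly q (S x) + ?B (S x) + 5) + 1) + 1))"
    show "pbd ?T" by (intro pbdi N S e)
    show "runs (e ;; ?test ;; ?loop ;; Pop 1) [I, code (tr x) @ A, B, C] (?T x) [I, code (tr (h x)) @ A, B, C]" for x I A B C
    proof -
      from h[of x] obtain n where n: "n \<le> N x" "h x = (f ^^ n) (a x)" "\<not> b ((f ^^ n) (a x))"
        "\<forall>i<n. b ((f ^^ i) (a x))" "\<forall>i\<le>n. sz ((f ^^ i) (a x)) \<le> S x" by blast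
      have s: "sz (a x) \<le> S x" using n(5)[rule_format, of 0] by simp
      have l: "runs ?loop [I, code (tr (b (a x))) @ code (tr (a x)) @ A, B, C] (N x * (poly q (S x) + ?B (S x) + 5) + 1)
        [I, code (tr (b ((f ^^ n) (a x)))) @ code (tr ((f ^^ n) (a x))) @ A, B, C]"
        by (rule runs_mono[OF loop[OF n(3-5)]]) (intro add_mono mult_mono n(1), auto)
      have pop: "runs (Pop 1) [I, code (tr (b ((f ^^ n) (a x)))) @ code (tr ((f ^^ n) (a x))) @ A, B, C] 1 [I, code (tr (h x)) @ A, B, C]"
        using n(2,3) by (intro runs_Pop) (auto simp: tr_bool_def)
      show ?thesis by (rule runs_append[OF e(3) runs_append[OF test[OF s] runs_append[OF l pop]]])
    qed
  qed
qed


section \<open>Conversion between bit strings on tapes and codes of lists\<close>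

definition load :: com where
  "load = Push 1 2 ;; Loop 0 {2, 3} (Cond 0 {3}
     (Pop 0 ;; Push 1 2 ;; Push 1 2 ;; Push 1 3 ;; Push 1 3) (Pop 0 ;; Push 1 2 ;; Push 1 3))"

definition unload :: com where
  "unload = Loop 1 {3} (Pop 1 ;; Cond 1 {3} (Pop 1 ;; Pop 1 ;; Pop 1 ;; Push 0 3) (Pop 1 ;; Push 0 2)) ;; Pop 1"

text \<open>The last input symbol is on top of stack 0, so the list is built from its end: each bit
  pushes the code of an element and a node symbol above it.\<close>

lemma runs_load:
  "runs load [rev (map bit_symbol x), [], [], []] (13 * length x + 3) [[], code (tr x), [], []]"
proof -
  let ?b = "Cond 0 {3} (Pop 0 ;; Push 1 2 ;; Push 1 2 ;; Push 1 3 ;; Push 1 3) (Pop 0 ;; Push 1 2 ;; Push 1 3)"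
  have "runs (Loop 0 {2, 3} ?b) [rev (map bit_symbol x), code (tr y), [], []] (13 * length x + 1)
    [[], code (tr (x @ y)), [], []]" for y
  proof (induction x arbitrary: y rule: rev_induct)
    case Nil
    show ?case by (rule runs_LoopF) auto
  next
    case (snoc b x)
    have "runs ?b [rev (map bit_symbol (x @ [b])), code (tr y), [], []] 11
      [rev (map bit_symbol x), code (tr (b # y)), [], []]"
    proof (cases b)
      case True
      then show ?thesis
        by - (rule runs_CondT runs_Pop_Seq runs_Push_Seq runs_Push | simp add: bit_symbol_def tr_bool_def)+
    next
      case False
      then show ?thesis
        by - (rule runs_CondF runs_Pop_Seq runs_Push_Seq runs_Push | simp add: bit_symbol_def tr_bool_def)+
    qed
    moreover have "bit_symbol b = 2 \<or> bit_symbol b = 3" by (simp add: bit_symbol_def)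
    ultimately show ?case using runs_LoopT[OF _ _ _ snoc[of "b # y"]] by simp
  qed
  from this[of "[]"] show ?thesis
    unfolding load_def by - (rule runs_Push_Seq, simp, simp, simp)
qed

lemma runs_unload:
  "runs unload [[], code (tr x), [], []] (10 * length x + 2) [rev (map bit_symbol x), [], [], []]"
proof -
  let ?b = "Pop 1 ;; Cond 1 {3} (Pop 1 ;; Pop 1 ;; Pop 1 ;; Push 0 3) (Pop 1 ;; Push 0 2)"
  have "runs (Loop 1 {3} ?b) [I, code (tr x), [], []] (10 * length x + 1)
    [rev (map bit_symbol x) @ I, [2], [], []]" for I
  proof (induction x arbitrary: I)
    case Nil
    show ?case by (rule runs_LoopF) auto
  next
    case (Cons b x)
    have "runs ?b [I, code (tr (b # x)), [], []] 8 [bit_symbol b # I, code (tr x), [], []]"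
    proof (cases b)
      case True
      then show ?thesis
        by - (rule runs_CondT runs_Pop_Seq runs_Push_Seq runs_Push | simp add: bit_symbol_def tr_bool_def)+
    next
      case False
      then show ?thesis
        by - (rule runs_CondF runs_Pop_Seq runs_Push_Seq runs_Push | simp add: bit_symbol_def tr_bool_def)+
    qed
    from runs_LoopT[OF _ _ this Cons[of "bit_symbol b # I"]] show ?case by simp
  qed
  note 1 = this[of "[]"]
  have "runs (Pop 1) [rev (map bit_symbol x) @ [], [2], [], []] 1 [rev (map bit_symbol x), [], [], []]"
    by (rule runs_Pop) auto
  from runs_append[OF 1 this] show ?thesis unfolding unload_def by simp
qed

lemma sz_bool_list: "sz (x :: bool list) \<le> 4 * length x + 1"
proof (induction x)
  case (Cons b x)
  then show ?case by (cases b) auto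
qed simp

theorem polytime_if_pt:
  fixes f :: "bool list \<Rightarrow> bool list"
  assumes "pt f"
  shows "polytime f"
proof -
  from assms obtain c T where c: "com_ok c" "pbd T"
    "\<And>x I A B C. runs c [I, code (tr x) @ A, B, C] (T x) [I, code (tr (f x)) @ A, B, C]"
    unfolding pt_def by blast
  from c(2) obtain p where p: "\<And>x. T x \<le> poly p (sz x)" unfolding pbd_def by blast
  from pt_sz[OF assms] obtain q where q: "\<And>x. sz (f x) \<le> poly q (sz x)" unfolding pbd_def by blast
  \<comment> \<open>\<open>[:1, 4:]\<close> is the bound of \<open>sz_bool_list\<close>, which turns
    the length of a bit string into a size; the outer summands are the times of \<open>load\<close>
    and \<open>unload\<close>.\<close>
  let ?P = "[:3, 13:] + (p \<circ>\<^sub>p [:1, 4:] + (10 * (q \<circ>\<^sub>p [:1, 4:]) + 2))"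
  show ?thesis
  proof (rule polytime_machine)
    show "com_ok (load ;; c ;; unload)" using c by (simp add: load_def unload_def)
    fix x
    have T: "T x \<le> poly p (1 + 4 * length x)"
      using p[of x] poly_nat_mono[OF sz_bool_list[of x], of p] by simp
    have "length (f x) \<le> poly q (1 + 4 * length x)"
      using q[of x] poly_nat_mono[OF sz_bool_list[of x], of q] length_le_sz[of "f x"] by simp
    then have "runs (load ;; c ;; unload) [rev (map bit_symbol x), [], [], []] (poly ?P (length x))
       [rev (map bit_symbol (f x)), [], [], []]"
      using T
      by (intro runs_mono[OF runs_append[OF runs_load runs_append[OF c(3)[of "[]" x "[]", simplified] runs_unload]]])
        (simp add: poly_pcompose algebra_simps)
    then show "\<exists>t\<le>poly ?P (length x). exec (load ;; c ;; unload) [rev (map bit_symbol x), [], [], []] t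
       [rev (map bit_symbol (f x)), [], [], []]"
      unfolding runs_def .
  qed
qed

section \<open>Closure properties\<close>

lemma pt_comp2:
  assumes "pt (\<lambda>p. g (fst p) (snd p))" "pt a" "pt b"
  shows "pt (\<lambda>x. g (a x) (b x))"
  using pt_comp[OF assms(1) pt_Pair[OF assms(2,3)]] by simp

lemma pt_comp3:
  assumes "pt (\<lambda>p. g (fst p) (fst (snd p)) (snd (snd p)))" "pt a" "pt b" "pt c"
  shows "pt (\<lambda>x. g (a x) (b x) (c x))"
  using pt_comp[OF assms(1) pt_Pair[OF assms(2) pt_Pair[OF assms(3,4)]]] by simp

lemma pt_Cons [pti]: "pt f \<Longrightarrow> pt g \<Longrightarrow> pt (\<lambda>x. f x # g x)"
  by (rule pt_cast[OF pt_Pair[of f g]]) (auto simp: tr_prod_def)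

lemma pt_Suc [pti]: "pt f \<Longrightarrow> pt (\<lambda>x. Suc (f x))"
  by (rule pt_cast[OF pt_Pair[OF pt_const[of False], of f]]) (auto simp: tr_prod_def tr_bool_def)

lemma pt_Not [pti]: "pt b \<Longrightarrow> pt (\<lambda>x. \<not> b x)"
  by (rule pt_cast[OF pt_if[OF _ pt_const[of False] pt_const[of True], of b]]) auto

lemma pt_conj [pti]: "pt b \<Longrightarrow> pt c \<Longrightarrow> pt (\<lambda>x. b x \<and> c x)"
  by (rule pt_cast[OF pt_if[OF _ _ pt_const[of False], of b c]]) auto

lemma pt_disj [pti]: "pt b \<Longrightarrow> pt c \<Longrightarrow> pt (\<lambda>x. b x \<or> c x)"
  by (rule pt_cast[OF pt_if[OF _ pt_const[of True], of b c]]) auto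

lemma pt_case_list [pti]:
  assumes "pt l" "pt a" "pt (\<lambda>p. f (fst p) (fst (snd p)) (snd (snd p)))"
  shows "pt (\<lambda>x. case l x of [] \<Rightarrow> a x | y # ys \<Rightarrow> f x y ys)"
proof (rule pt_branch[OF _ assms(3,2)])
  show "pt (\<lambda>x. (x, l x))" by (intro pti assms)
  show "pt (\<lambda>x. l x \<noteq> [])" by (intro pti assms)
  show "\<exists>y. tr y = tr (x, l x) \<and> tr (f (fst y) (fst (snd y)) (snd (snd y))) =
      tr (case l x of [] \<Rightarrow> a x | y # ys \<Rightarrow> f x y ys)" if "l x \<noteq> []" for x
    using that by (intro exI[of _ "(x, hd (l x), tl (l x))"]) (auto simp: tr_prod_def neq_Nil_conv)
qed auto

lemma pt_tl [pti]: "pt l \<Longrightarrow> pt (\<lambda>x. tl (l x))"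
  unfolding tl_def by (intro pti)

text \<open>Iteration on triples of the input, the remaining list and the accumulator. A step of
  polynomial cost may double the accumulator, so its size has to be bounded after every prefix of
  the list.\<close>

lemma pt_fold:
  assumes g: "pt (\<lambda>p. g (fst p) (fst (snd p)) (snd (snd p)))" and l: "pt l" and a: "pt a"
    and S: "pbd S" "\<And>x i. i \<le> length (l x) \<Longrightarrow> sz (fold (g x) (take i (l x)) (a x)) \<le> S x"
  shows "pt (\<lambda>x. fold (g x) (l x) (a x))"
proof -
  let ?b = "\<lambda>s. fst (snd s) \<noteq> []"
  let ?f = "\<lambda>s. case fst (snd s) of [] \<Rightarrow> s | y # ys \<Rightarrow> (fst s, ys, g (fst s) y (snd (snd s)))"
  have f: "(?f ^^ i) (x, l x, a x) = (x, drop i (l x), fold (g x) (take i (l x)) (a x))" if "i \<le> length (l x)" for i x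
    using that
  proof (induction i)
    case (Suc i)
    then have "drop i (l x) = l x ! i # drop (Suc i) (l x)" "take (Suc i) (l x) = take i (l x) @ [l x ! i]"
      by (auto simp: Cons_nth_drop_Suc take_Suc_conv_app_nth)
    with Suc show ?case by simp
  qed simp
  have sz_drop: "sz (drop i ys) \<le> sz ys" for i and ys :: "'z::enc list"
    by (induction ys arbitrary: i) (auto simp: drop_Cons' intro: trans_le_add2 le_SucI)
  have "pt (\<lambda>x. (x, drop (length (l x)) (l x), fold (g x) (l x) (a x)))"
  proof (rule pt_iterate)
    show "pt ?b" by (intro pti)
    show "pt ?f" by (intro pti pt_comp3[of g, OF g])
    show "pt (\<lambda>x. (x, l x, a x))" by (intro pti l a)
    show "pbd (\<lambda>x. sz (l x))" by (rule pt_sz[OF l])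
    show "pbd (\<lambda>x. sz x + (sz (l x) + S x + 1) + 1)" by (intro pbdi S pt_sz[OF l])
    show "\<exists>n\<le>sz (l x). (x, drop (length (l x)) (l x), fold (g x) (l x) (a x)) = (?f ^^ n) (x, l x, a x) \<and>
       \<not> ?b ((?f ^^ n) (x, l x, a x)) \<and> (\<forall>i<n. ?b ((?f ^^ i) (x, l x, a x))) \<and>
       (\<forall>i\<le>n. sz ((?f ^^ i) (x, l x, a x)) \<le> sz x + (sz (l x) + S x + 1) + 1)" for x
    proof (intro exI[of _ "length (l x)"] conjI allI impI)
      show "length (l x) \<le> sz (l x)" using length_le_sz[of "l x"] by simp
      show "sz ((?f ^^ i) (x, l x, a x)) \<le> sz x + (sz (l x) + S x + 1) + 1" if "i \<le> length (l x)" for i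
        using S(2)[OF that] sz_drop[of i "l x"] unfolding f[OF that] by simp
    qed (simp_all only: f[OF order.refl] f[OF less_imp_le], simp_all)
  qed
  from pt_snd[OF pt_snd[OF this]] show ?thesis by simp
qed

lemma sz_rev [simp]: "sz (rev xs) = sz xs"
proof (induction xs)
  case (Cons a xs)
  then show ?case using sz_append[of "rev xs" "[a]"] by simp
qed simp

lemma sz_take: "sz (take i ys) \<le> sz ys"
  by (induction ys arbitrary: i) (auto simp: take_Cons')

lemma fold_Cons: "fold (#) xs ys = rev xs @ ys"
  by (induction xs arbitrary: ys) auto

lemma sz_append_le: "sz (xs @ ys) \<le> sz xs + sz ys"
  using sz_append[of xs ys] by simp

lemma pt_rev [pti]:
  assumes "pt l"
  shows "pt (\<lambda>x. rev (l x))"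
proof -
  have "pt (\<lambda>x. fold (#) (l x) [])"
  proof (rule pt_fold)
    show "pbd (\<lambda>x. sz (l x))" by (rule pt_sz[OF assms])
    show "sz (fold (#) (take i (l x)) []) \<le> sz (l x)" for x i
      by (simp add: fold_Cons sz_take)
  qed (intro pti assms)+
  then show ?thesis by (simp add: fold_Cons)
qed

lemma pt_append [pti]:
  assumes "pt l" "pt m"
  shows "pt (\<lambda>x. l x @ m x)"
proof -
  have "pt (\<lambda>x. fold (#) (rev (l x)) (m x))"
  proof (rule pt_fold)
    show "pbd (\<lambda>x. sz (l x) + sz (m x))" by (intro pbdi pt_sz assms)
    show "sz (fold (#) (take i (rev (l x))) (m x)) \<le> sz (l x) + sz (m x)" for x i
      using sz_append_le[of "rev (take i (rev (l x)))" "m x"] sz_take[of i "rev (l x)"] by (simp add: fold_Cons)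
  qed (intro pti assms)+
  then show ?thesis by (simp add: fold_Cons)
qed

lemma fold_append: "fold (\<lambda>y acc. y @ acc) xss ys = concat (rev xss) @ ys"
  by (induction xss arbitrary: ys) auto

lemma sz_concat: "sz (concat xss) \<le> sz xss"
  by (induction xss) (auto intro: order.trans[OF sz_append_le])

lemma pt_concat [pti]:
  assumes "pt l"
  shows "pt (\<lambda>x. concat (l x))"
proof -
  have "pt (\<lambda>x. fold (\<lambda>y acc. y @ acc) (rev (l x)) [])"
  proof (rule pt_fold)
    show "pbd (\<lambda>x. sz (l x))" by (intro pt_sz assms)
    show "sz (fold (\<lambda>y acc. y @ acc) (take i (rev (l x))) []) \<le> sz (l x)" for x i
      using sz_concat[of "rev (take i (rev (l x)))"] sz_take[of i "rev (l x)"] by (simp add: fold_append)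
  qed (intro pti assms)+
  then show ?thesis by (simp add: fold_append)
qed

lemma sz_mem: "y \<in> set l \<Longrightarrow> sz y \<le> sz l"
  by (induction l) auto

lemma sz_map_le:
  assumes "\<And>y. y \<in> set l \<Longrightarrow> sz (g y) \<le> K"
  shows "sz (map g l) \<le> sz l * (K + 1) + 1"
  using assms
proof (induction l)
  case (Cons y l)
  have "sz (map g l) \<le> sz l * (K + 1) + 1" "sz (g y) \<le> K" using Cons by auto
  moreover have "(sz y + sz l + 1) * (K + 1) \<ge> K + 1 + sz l * (K + 1)"
    by (simp add: algebra_simps)
  ultimately show ?case by simp
qed simp

lemma pt_map [pti]:
  assumes g: "pt (\<lambda>p. g (fst p) (snd p))" and l: "pt l"
  shows "pt (\<lambda>x. map (g x) (l x))"
proof -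
  from pt_sz[OF g] obtain q where q: "\<And>x y. sz (g x y) \<le> poly q (sz (x, y))"
    unfolding pbd_def by (metis fst_conv snd_conv)
  have *: "fold (\<lambda>y acc. g x y # acc) ys acc = rev (map (g x) ys) @ acc" for x ys acc
    by (induction ys arbitrary: acc) auto
  have "pt (\<lambda>x. fold (\<lambda>y acc. g x y # acc) (l x) [])"
  proof (rule pt_fold)
    show "pt (\<lambda>p. g (fst p) (fst (snd p)) # snd (snd p))"
      by (intro pti pt_comp2[of g, OF g])
    show "pbd (\<lambda>x. sz (l x) * (poly q (sz x + sz (l x) + 1) + 1) + 1)"
      by (intro pbdi pt_sz l)
    show "sz (fold (\<lambda>y acc. g x y # acc) (take i (l x)) []) \<le> sz (l x) * (poly q (sz x + sz (l x) + 1) + 1) + 1" for x i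
    proof -
      have "sz (g x y) \<le> poly q (sz x + sz (l x) + 1)" if "y \<in> set (take i (l x))" for y
        using sz_mem[of y "l x"] in_set_takeD[OF that]
        by (intro order.trans[OF q] poly_nat_mono) auto
      from sz_map_le[OF this] have "sz (map (g x) (take i (l x))) \<le> sz (take i (l x)) * (poly q (sz x + sz (l x) + 1) + 1) + 1" .
      also have "\<dots> \<le> sz (l x) * (poly q (sz x + sz (l x) + 1) + 1) + 1"
        by (intro add_mono mult_mono sz_take) auto
      finally show ?thesis by (simp add: *)
    qed
  qed (intro pti l)+
  from pt_rev[OF this] show ?thesis by (simp add: *)
qed

lemma pt_filter [pti]:
  assumes g: "pt (\<lambda>p. P (fst p) (snd p))" and l: "pt l"
  shows "pt (\<lambda>x. filter (P x) (l x))"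
proof -
  have "filter Q ys = concat (map (\<lambda>y. if Q y then [y] else []) ys)" for Q and ys :: "'b list"
    by (induction ys) auto
  then show ?thesis by (simp only:) (intro pti g l pt_comp2[of P, OF g])
qed

lemma pt_list_all [pti]:
  assumes "pt (\<lambda>p. P (fst p) (snd p))" "pt l"
  shows "pt (\<lambda>x. \<forall>y\<in>set (l x). P x y)"
proof -
  have "(\<forall>y\<in>set ys. Q y) \<longleftrightarrow> filter (\<lambda>y. \<not> Q y) ys = []" for Q and ys :: "'b list"
    by (simp add: filter_empty_conv)
  then show ?thesis by (simp only:) (intro pti assms)
qed

lemma pt_list_ex [pti]:
  assumes "pt (\<lambda>p. P (fst p) (snd p))" "pt l"
  shows "pt (\<lambda>x. \<exists>y\<in>set (l x). P x y)"
proof -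
  have "(\<exists>y\<in>set ys. Q y) \<longleftrightarrow> filter Q ys \<noteq> []" for Q and ys :: "'b list"
    by (simp add: filter_empty_conv)
  then show ?thesis by (simp only:) (intro pti assms)
qed

lemma pt_in_set [pti]: "pt f \<Longrightarrow> pt l \<Longrightarrow> pt (\<lambda>x. f x \<in> set (l x))"
proof -
  assume f: "pt f" and l: "pt l"
  have "(f x \<in> set (l x)) = (\<exists>y\<in>set (l x). f x = y)" for x by auto
  then show ?thesis by (simp only:) (intro pti f l pt_comp[OF f])
qed


subsection \<open>Arithmetic on numbers in unary\<close>

text \<open>A number and the list of that many zeros have the same code; unary arithmetic thereby
  reduces to operations on lists.\<close>

lemma pt_replicate_0 [pti]: "pt n \<Longrightarrow> pt (\<lambda>x. replicate (n x) (0::nat))"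
proof (rule pt_cast)
  have "tr (replicate n (0::nat)) = tr n" for n by (induction n) auto
  then show "\<exists>y. tr y = tr x \<and> tr (n y) = tr (replicate (n x) (0::nat))" for x by metis
qed

lemma pt_length [pti]:
  assumes "pt l"
  shows "pt (\<lambda>x. length (l x))"
proof (rule pt_cast)
  show "pt (\<lambda>x. map (\<lambda>y. 0::nat) (l x))" by (intro pti assms)
  have "tr (map (\<lambda>y. 0::nat) ys) = tr (length ys)" for ys :: "'b list" by (induction ys) auto
  then show "\<exists>y. tr y = tr x \<and> tr (map (\<lambda>y. 0::nat) (l y)) = tr (length (l x))" for x by metis
qed

lemma pt_add [pti]:
  assumes "pt m" "pt n"
  shows "pt (\<lambda>x. m x + n x :: nat)"
proof -
  have "pt (\<lambda>x. length (replicate (m x) (0::nat) @ replicate (n x) (0::nat)))" by (intro pti assms)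
  then show ?thesis by simp
qed

lemma pt_mult [pti]:
  assumes "pt m" "pt n"
  shows "pt (\<lambda>x. m x * n x :: nat)"
proof -
  have "pt (\<lambda>x. length (concat (map (\<lambda>y. replicate (n x) (0::nat)) (replicate (m x) (0::nat)))))"
    by (intro pti assms pt_comp[OF assms(2)])
  then show ?thesis by (simp add: length_concat comp_def sum_list_replicate)
qed

lemma pt_poly [pti]:
  assumes "pt f"
  shows "pt (\<lambda>x. poly p (f x :: nat))"
proof (induction p)
  case (pCons a p)
  show ?case by (simp, intro pti assms pCons)
qed (simp add: pt_const)

lemma sz_drop: "sz (drop i ys) \<le> sz ys"
  by (induction ys arbitrary: i) (auto simp: drop_Cons' intro: trans_le_add2 le_SucI)

lemma fold_tl: "fold (\<lambda>_. tl) xs ys = drop (length xs) ys"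
  by (induction xs arbitrary: ys) (auto simp: drop_Suc)

lemma pt_drop [pti]:
  assumes "pt n" "pt l"
  shows "pt (\<lambda>x. drop (n x) (l x))"
proof -
  have "pt (\<lambda>x. fold (\<lambda>_. tl) (replicate (n x) (0::nat)) (l x))"
  proof (rule pt_fold)
    show "pbd (\<lambda>x. sz (l x))" by (intro pt_sz assms)
    show "sz (fold (\<lambda>_. tl) (take i (replicate (n x) (0::nat))) (l x)) \<le> sz (l x)" for x i
      by (simp only: fold_tl sz_drop)
  qed (intro pti assms)+
  then show ?thesis by (simp only: fold_tl length_replicate)
qed

lemma pt_diff [pti]:
  assumes "pt m" "pt n"
  shows "pt (\<lambda>x. m x - n x :: nat)"
proof -
  have "pt (\<lambda>x. length (drop (n x) (replicate (m x) (0::nat))))" by (intro pti assms)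
  then show ?thesis by simp
qed

lemma pt_le [pti]:
  assumes "pt m" "pt n"
  shows "pt (\<lambda>x. (m x :: nat) \<le> n x)"
proof -
  have "pt (\<lambda>x. m x - n x = 0)" by (intro pti assms)
  then show ?thesis by simp
qed

lemma pt_less [pti]:
  assumes "pt m" "pt n"
  shows "pt (\<lambda>x. (m x :: nat) < n x)"
proof -
  have "pt (\<lambda>x. Suc (m x) \<le> n x)" by (intro pti assms)
  then show ?thesis by (simp add: Suc_le_eq)
qed

lemma pt_upt [pti]:
  assumes "pt m" "pt n"
  shows "pt (\<lambda>x. [m x..<n x])"
proof -
  \<comment> \<open>The accumulator is the reversed interval, whose head is the largest number so
    far and yields the next one.\<close>
  let ?g = "\<lambda>_ acc. case acc of [] \<Rightarrow> [0::nat] | y # ys \<Rightarrow> Suc y # acc"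
  have *: "fold ?g (xs :: nat list) [] = rev [0..<length xs]" for xs
  proof (induction xs rule: rev_induct)
    case (snoc x xs)
    then show ?case by (cases "length xs") auto
  qed simp
  have "pt (\<lambda>x. fold ?g (replicate (n x) (0::nat)) [])"
  proof (rule pt_fold)
    show "pbd (\<lambda>x. sz (n x) * (2 * sz (n x) + 2) + 1)" by (intro pbdi pt_sz assms)
    show "sz (fold ?g (take i (replicate (n x) (0::nat))) []) \<le> sz (n x) * (2 * sz (n x) + 2) + 1" for x i
    proof -
      have "sz [0..<k] \<le> k * (2 * k + 2) + 1" for k
      proof (induction k)
        case (Suc k)
        then show ?case using sz_append[of "[0..<k]" "[k]"] by (simp add: sz_nat)
      qed simp
      also have "min i (n x) * (2 * min i (n x) + 2) + 1 \<le> sz (n x) * (2 * sz (n x) + 2) + 1"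
        by (intro add_mono mult_mono) (auto simp: sz_nat)
      finally show ?thesis unfolding * by simp
    qed
  qed (intro pti assms)+
  then have "pt (\<lambda>x. drop (m x) (rev (fold ?g (replicate (n x) (0::nat)) [])))" by (intro pti assms)
  then show ?thesis by (simp only: * length_replicate rev_rev_ident drop_upt add_0)
qed

text \<open>The common shape of distinctness and of the attachment of leaves in a certificate: a
  condition on each element and the elements behind it.\<close>

fun all_suffixes :: "('a \<Rightarrow> 'a list \<Rightarrow> bool) \<Rightarrow> 'a list \<Rightarrow> bool" where
  "all_suffixes P [] \<longleftrightarrow> True"
| "all_suffixes P (y # ys) \<longleftrightarrow> P y ys \<and> all_suffixes P ys"

lemma pt_all_suffixes [pti]:
  assumes "pt (\<lambda>p. P (fst p) (fst (snd p)) (snd (snd p)))" "pt l"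
  shows "pt (\<lambda>x. all_suffixes (P x) (l x))"
proof -
  have "all_suffixes Q ys \<longleftrightarrow> (\<forall>i\<in>set [0..<length ys]. case drop i ys of [] \<Rightarrow> True | z # zs \<Rightarrow> Q z zs)"
    for Q and ys :: "'b list"
  proof (induction ys)
    case (Cons y ys)
    have "[0..<length (y # ys)] = 0 # map Suc [0..<length ys]"
      by (simp add: upt_conv_Cons map_Suc_upt del: upt_Suc)
    then show ?case using Cons
      by (simp only: list.set(2) set_map ball_simps all_suffixes.simps) simp
  qed simp
  then show ?thesis by (simp only:) (intro pti assms pt_comp[OF assms(2)] pt_comp3[of P, OF assms(1)])
qed

lemma distinct_all_suffixes: "distinct xs \<longleftrightarrow> all_suffixes (\<lambda>y ys. y \<notin> set ys) xs"
  by (induction xs) auto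

lemma pt_distinct [pti]: "pt l \<Longrightarrow> pt (\<lambda>x. distinct (l x))"
  unfolding distinct_all_suffixes by (intro pti)


section \<open>Binary numbers\<close>

fun val :: "bool list \<Rightarrow> nat" where
  "val [] = 0"
| "val (b # bs) = of_bool b + 2 * val bs"

lemma val_append: "val (xs @ ys) = val xs + 2 ^ length xs * val ys"
  by (induction xs) (auto simp: algebra_simps)

lemma val_bits [simp]: "val (bits n) = n"
proof (induction n rule: bits.induct)
  case (1 n)
  then show ?case by (subst bits.simps) auto
qed

definition norm_bits :: "bool list \<Rightarrow> bool list" where
  "norm_bits xs = fold (\<lambda>b acc. if b = False \<and> acc = [] then [] else b # acc) (rev xs) []"

lemma norm_bits_simps:
  "norm_bits [] = []"
  "norm_bits (b # xs) = (if b = False \<and> norm_bits xs = [] then [] else b # norm_bits xs)"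
  by (auto simp: norm_bits_def)

lemma norm_bits_eq: "norm_bits xs = bits (val xs)"
proof (induction xs)
  case Nil
  show ?case by (subst bits.simps) (simp add: norm_bits_simps)
next
  case (Cons b xs)
  have "bits n = [] \<longleftrightarrow> n = 0" for n by (subst bits.simps) auto
  with Cons show ?case by (subst bits.simps) (auto simp: norm_bits_simps)
qed

lemma norm_bits_bits [simp]: "norm_bits (bits n) = bits n"
  by (simp add: norm_bits_eq)

lemma pt_norm_bits [pti]:
  assumes "pt f"
  shows "pt (\<lambda>x. norm_bits (f x))"
proof -
  let ?g = "\<lambda>b acc. if b = False \<and> acc = [] then [] else b # acc"
  have le: "sz (fold ?g xs []) \<le> sz xs" for xs
  proof (induction xs rule: rev_induct)
    case (snoc b xs)
    then show ?case using sz_append[of xs "[b]"] by (auto simp del: sz_pos)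
  qed simp
  then have *: "sz (fold ?g (take i (rev xs)) []) \<le> sz xs" for i xs
    using order.trans[OF le sz_take[of i "rev xs"]] by simp
  have "pt (\<lambda>x. fold ?g (rev (f x)) [])"
    by (rule pt_fold[OF _ _ _ pt_sz[OF assms]]) ((intro pti assms)+, rule *)
  then show ?thesis by (simp only: norm_bits_def)
qed

(* The state consists of the carry, the remaining digits of the second summand, and the digits of
   the sum in reverse. *)
definition add_step :: "bool \<Rightarrow> bool \<times> bool list \<times> bool list \<Rightarrow> bool \<times> bool list \<times> bool list" where
  "add_step b s =
     (let c = fst s; d = (case fst (snd s) of [] \<Rightarrow> False | d # _ \<Rightarrow> d)
      in (if b then c \<or> d else c \<and> d, tl (fst (snd s)), ((b = c) = d) # snd (snd s)))"

text \<open>The first summand is padded with as many zeros as the second has digits, so that the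
  second one is used up; the last carry becomes the top digit.\<close>

definition add_bits :: "bool list \<Rightarrow> bool list \<Rightarrow> bool list" where
  "add_bits xs ys =
     (let s = fold add_step (xs @ map (\<lambda>_. False) ys) (False, ys, []) in rev (fst s # snd (snd s)))"

text \<open>The invariant is the total value: digits already produced, plus carry and both
  remainders at the current place value.\<close>

lemma fold_add_step:
  "fold add_step xs (c, ys, acc) = (c', ys', acc') \<Longrightarrow>
   ys' = drop (length xs) ys \<and> length acc' = length acc + length xs \<and>
   val (rev acc') + 2 ^ length acc' * (of_bool c' + val ys') =
   val (rev acc) + 2 ^ length acc * (of_bool c + val xs + val ys)"
proof (induction xs arbitrary: c ys acc)
  case (Cons b xs)
  obtain c1 ys1 e where 1: "add_step b (c, ys, acc) = (c1, ys1, e # acc)"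
    by (simp add: add_step_def Let_def)
  have ys1: "ys1 = tl ys" using 1 by (simp add: add_step_def Let_def)
  have *: "of_bool c + (of_bool b + 2 * val xs) + val ys = of_bool e + 2 * (of_bool c1 + val xs + val ys1)"
  proof (cases ys)
    case Nil
    with 1 show ?thesis by (cases b; cases c) (auto simp: add_step_def Let_def)
  next
    case (Cons d zs)
    with 1 show ?thesis by (cases b; cases c; cases d) (auto simp: add_step_def Let_def)
  qed
  have f: "fold add_step xs (c1, ys1, e # acc) = (c', ys', acc')"
    using Cons.prems 1 by simp
  have "val (rev acc) + 2 ^ length acc * (of_bool c + val (b # xs) + val ys) =
      val (rev (e # acc)) + 2 ^ length (e # acc) * (of_bool c1 + val xs + val ys1)"
    unfolding val.simps * by (simp add: val_append distrib_left)
  with conjunct2[OF conjunct2[OF Cons.IH[OF f]]] have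
    "val (rev acc') + 2 ^ length acc' * (of_bool c' + val ys') =
     val (rev acc) + 2 ^ length acc * (of_bool c + val (b # xs) + val ys)"
    by (rule trans[OF _ sym])
  moreover have "ys' = drop (length (b # xs)) ys" "length acc' = length acc + length (b # xs)"
    using Cons.IH[OF f] ys1 by (auto simp: drop_Suc)
  ultimately show ?case by blast
qed auto

lemma val_add_bits [simp]: "val (add_bits xs ys) = val xs + val ys"
  and length_add_bits: "length (add_bits xs ys) = length xs + length ys + 1"
proof -
  obtain c ys' acc where f: "fold add_step (xs @ map (\<lambda>_. False) ys) (False, ys, []) = (c, ys', acc)"
    by (cases "fold add_step (xs @ map (\<lambda>_. False) ys) (False, ys, [])")
  have "val (map (\<lambda>_. False) zs) = 0" for zs :: "bool list" by (induction zs) auto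
  with fold_add_step[OF f] f show "val (add_bits xs ys) = val xs + val ys"
    "length (add_bits xs ys) = length xs + length ys + 1"
    by (auto simp: add_bits_def val_append algebra_simps)
qed

lemma pt_add_bits [pti]:
  assumes "pt f" "pt g"
  shows "pt (\<lambda>x. add_bits (f x) (g x))"
proof -
  let ?xs = "\<lambda>x. f x @ map (\<lambda>_. False) (g x)" and ?s = "\<lambda>x. (False, g x, [] :: bool list)"
  have "pt (\<lambda>x. fold add_step (?xs x) (?s x))"
  proof (rule pt_fold)
    show "pt (\<lambda>p. add_step (fst (snd p)) (snd (snd p)))"
      unfolding add_step_def Let_def by (intro pti)
    show "pt ?xs" "pt ?s" by (intro pti assms)+
    show "pbd (\<lambda>x. 3 + (sz (g x) + (4 * (sz (f x) + sz (g x)) + 1) + 1) + 1)" by (intro pbdi pt_sz assms)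
    fix x i
    obtain c ys acc where f: "fold add_step (take i (?xs x)) (?s x) = (c, ys, acc)"
      by (cases "fold add_step (take i (?xs x)) (?s x)")
    have c: "sz c \<le> 3" by (cases c) auto
    have "length acc \<le> sz (f x) + sz (g x)"
      using fold_add_step[OF f] length_le_sz[of "f x"] length_le_sz[of "g x"] by simp
    then have "sz acc \<le> 4 * (sz (f x) + sz (g x)) + 1" using sz_bool_list[of acc] by simp
    moreover have "sz ys \<le> sz (g x)" using fold_add_step[OF f] sz_drop by auto
    ultimately show "sz (fold add_step (take i (?xs x)) (?s x)) \<le>
        3 + (sz (g x) + (4 * (sz (f x) + sz (g x)) + 1) + 1) + 1"
      using c unfolding f by simp
  qed
  then show ?thesis unfolding add_bits_def Let_def by (intro pti; assumption)
qed

definition sum_bits :: "bool list list \<Rightarrow> bool list" where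
  "sum_bits xss = fold add_bits xss []"

lemma val_sum_bits [simp]: "val (sum_bits xss) = sum_list (map val xss)"
proof -
  have "val (fold add_bits xss ys) = sum_list (map val xss) + val ys" for ys
    by (induction xss arbitrary: ys) auto
  then show ?thesis by (simp add: sum_bits_def)
qed

lemma pt_sum_bits [pti]:
  assumes "pt f"
  shows "pt (\<lambda>x. sum_bits (f x))"
proof -
  have "pt (\<lambda>x. fold add_bits (f x) [])"
  proof (rule pt_fold)
    show "pbd (\<lambda>x. 4 * sz (f x) + 1)" by (intro pbdi pt_sz assms)
    \<comment> \<open>\<open>add_bits\<close> adds the lengths of its arguments, which is crude;
      still the sum of all lengths stays below the size of the list.\<close>
    have "length (fold add_bits xss ys) + 1 \<le> sz xss + length ys" for xss ys
    proof (induction xss arbitrary: ys)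
      case (Cons xs xss)
      have "length xs \<le> sz xs" using length_le_sz[of xs] by simp
      with Cons[of "add_bits xs ys"] show ?case by (simp add: length_add_bits)
    qed simp
    note len = this
    show "sz (fold add_bits (take i (f x)) []) \<le> 4 * sz (f x) + 1" for x i
    proof -
      have "length (fold add_bits (take i (f x)) []) + 1 \<le> sz (take i (f x))"
        using len[of "take i (f x)" "[]"] by simp
      with sz_take[of i "f x"] have "length (fold add_bits (take i (f x)) []) \<le> sz (f x)" by linarith
      with sz_bool_list[of "fold add_bits (take i (f x)) []"] show ?thesis by linarith
    qed
  qed (intro pti assms)+
  then show ?thesis by (simp only: sum_bits_def)
qed

text \<open>As the argument is in unary, its binary form may be computed as a sum of that many
  ones.\<close>

lemma pt_bits [pti]:
  assumes "pt n"
  shows "pt (\<lambda>x. bits (n x))"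
proof -
  have "pt (\<lambda>x. norm_bits (sum_bits (map (\<lambda>_. [True]) (replicate (n x) (0::nat)))))" by (intro pti assms)
  then show ?thesis by (simp add: norm_bits_eq sum_list_replicate)
qed

lemma pt_delimit [pti]: "pt f \<Longrightarrow> pt (\<lambda>x. delimit (f x))"
  unfolding delimit_def by (intro pti)

section \<open>Trees grown leaf by leaf\<close>

lemma is_tree_single: "is_tree ({r}, {})"
proof -
  have "\<not> is_cycle ({r}, {}) xs" for xs
    by (cases xs) (auto simp: is_cycle_def)
  then show ?thesis by (auto simp: is_tree_def is_graph_def connected_graph_def)
qed

text \<open>A cycle through \<open>c\<close> would contain two different neighbours of
  \<open>c\<close>, but \<open>p\<close> is the only one; a cycle avoiding \<open>c\<close> lies in
  the old tree.\<close>

lemma is_tree_leaf: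
  assumes T: "is_tree (V, E)" and p: "p \<in> V" and c: "c \<notin> V"
  shows "is_tree (insert c V, insert {c, p} E)"
proof -
  let ?T = "(insert c V, insert {c, p} E)" and ?R = "{(a, b). {a, b} \<in> insert {c, p} E}"
  have graph: "is_graph (V, E)" and conn: "connected_graph (V, E)" and cyc: "\<nexists>xs. is_cycle (V, E) xs"
    using T by (auto simp: is_tree_def)
  have E: "e \<subseteq> V" if "e \<in> E" for e using graph that by (auto simp: is_graph_def)
  have "c \<noteq> p" using p c by blast
  then have "is_graph ?T" using graph p by (auto simp: is_graph_def)
  moreover have "connected_graph ?T"
  proof -
    have mono: "{(a, b). {a, b} \<in> E}\<^sup>* \<subseteq> ?R\<^sup>*" by (intro rtrancl_mono) auto
    have sym: "sym (?R\<^sup>*)" by (intro sym_rtrancl) (auto simp: sym_def insert_commute)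
    have "(u, p) \<in> ?R\<^sup>*" if "u \<in> insert c V" for u
    proof (cases "u = c")
      case False
      with that p conn mono show ?thesis by (auto simp: connected_graph_def)
    qed auto
    then show ?thesis unfolding connected_graph_def using sym by (auto intro: rtrancl_trans symD)
  qed
  moreover have "\<not> is_cycle ?T xs" for xs
  proof
    assume xs: "is_cycle ?T xs"
    define n where "n = length xs"
    have n: "3 \<le> n" "distinct xs" and edge: "\<And>i. i < n \<Longrightarrow> {xs ! i, xs ! (Suc i mod n)} \<in> insert {c, p} E"
      using xs by (auto simp: is_cycle_def n_def)
    show False
    proof (cases "c \<in> set xs")
      case True
      then obtain i where i: "i < n" "xs ! i = c" by (auto simp: in_set_conv_nth n_def)
      \<comment> \<open>The cyclic successor and predecessor of \<open>i\<close>; they differ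
        because a cycle has length at least 3.\<close>
      define j k where "j = Suc i mod n" and "k = (if i = 0 then n - 1 else i - 1)"
      have jk: "j < n" "k < n" "j \<noteq> k" "Suc k mod n = i"
        using n i by (auto simp: j_def k_def mod_Suc)
      have "{c, xs ! j} \<in> insert {c, p} E" "{xs ! k, c} \<in> insert {c, p} E"
        using edge[of i] edge[of k] i jk by (auto simp: j_def)
      then have "{c, xs ! j} = {c, p}" "{xs ! k, c} = {c, p}" using E c by blast+
      then have "xs ! j = p" "xs ! k = p" using p c by (auto simp: doubleton_eq_iff)
      with jk n show False unfolding n_def by (metis nth_eq_iff_index_eq)
    next
      case False
      have "{xs ! i, xs ! (Suc i mod n)} \<in> E" if "i < n" for i
      proof -
        have "Suc i mod n < n" using n by simp
        then have "xs ! i \<in> set xs" "xs ! (Suc i mod n) \<in> set xs" using that by (auto simp: n_def)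
        with edge[OF that] False show ?thesis by (auto simp: doubleton_eq_iff)
      qed
      then have "is_cycle (V, E) xs" using n by (auto simp: is_cycle_def n_def)
      with cyc show False by blast
    qed
  qed
  ultimately show ?thesis by (auto simp: is_tree_def)
qed

(* A list of pairs (child, parent), the last of which is attached first to the root. *)
fun grows :: "'a set set \<Rightarrow> 'a \<Rightarrow> ('a \<times> 'a) list \<Rightarrow> bool" where
  "grows E r [] \<longleftrightarrow> True"
| "grows E r (cp # l) \<longleftrightarrow> fst cp \<notin> insert r (fst ` set l) \<and> snd cp \<in> insert r (fst ` set l) \<and>
     {fst cp, snd cp} \<in> E \<and> grows E r l"

definition grown :: "'a \<Rightarrow> ('a \<times> 'a) list \<Rightarrow> 'a graph" where
  "grown r l = (insert r (fst ` set l), (\<lambda>(c, p). {c, p}) ` set l)"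

lemma is_tree_grown: "grows E r l \<Longrightarrow> is_tree (grown r l)"
proof (induction l)
  case (Cons cp l)
  then show ?case
    using is_tree_leaf[of "insert r (fst ` set l)" "(\<lambda>(c, p). {c, p}) ` set l" "snd cp" "fst cp"]
    by (auto simp: grown_def insert_commute split_beta)
qed (simp add: grown_def is_tree_single)

lemma edges_grown: "grows E r l \<Longrightarrow> edges (grown r l) \<subseteq> E"
  by (induction l) (auto simp: grown_def split_beta)

lemma weight_grown:
  assumes "grows E r l"
  shows "weight w (grown r l) = (\<Sum>(c, p)\<leftarrow>l. w {c, p})"
  using assms
proof (induction l)
  case (Cons cp l)
  \<comment> \<open>The new edge has an end outside the tree built so far. Hence no edge is
    repeated, and the sum over the list is the sum over the set of edges.\<close>
  have "{fst cp, snd cp} \<notin> (\<lambda>(c, p). {c, p}) ` set l"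
  proof
    assume "{fst cp, snd cp} \<in> (\<lambda>(c, p). {c, p}) ` set l"
    then have "{fst cp, snd cp} \<in> edges (grown r l)" by (simp add: grown_def)
    moreover have "is_graph (grown r l)" using is_tree_grown Cons.prems by (fastforce simp: is_tree_def)
    ultimately have "fst cp \<in> verts (grown r l)" by (auto simp: is_graph_def)
    with Cons.prems show False by (auto simp: grown_def)
  qed
  with Cons show ?case by (simp add: weight_def grown_def split_beta)
qed (simp add: grown_def weight_def)

lemma verts_grown:
  assumes "is_graph (V, E)" "r \<in> V" "grows E r l"
  shows "verts (grown r l) \<subseteq> V"
  using assms(3,1,2) by (induction l) (auto simp: grown_def is_graph_def)

text \<open>While a vertex \<open>v\<close> is missing, a path from \<open>r\<close> to
  \<open>v\<close> leaves the set of vertices reached, and the edge by which it does so attaches a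
  new leaf.\<close>

lemma ex_grows:
  assumes "is_graph (V, E)" "connected_graph (V, E)" "finite V" "r \<in> V"
  shows "\<exists>l. grows E r l \<and> verts (grown r l) = V"
proof -
  note sub = verts_grown[OF assms(1,4)]
  have "\<exists>l'. grows E r l' \<and> verts (grown r l') = V" if "grows E r l" for l
    using that
  proof (induction "card (V - verts (grown r l))" arbitrary: l rule: less_induct)
    case less
    show ?case
    proof (cases "verts (grown r l) = V")
      case False
      with sub[OF less.prems] obtain v where v: "v \<in> V" "v \<notin> verts (grown r l)" by blast
      define S where "S = verts (grown r l)"
      have "(r, v) \<in> {(a, b). {a, b} \<in> E}\<^sup>*" using assms v by (auto simp: connected_graph_def)
      moreover have "r \<in> S" by (simp add: grown_def S_def)
      moreover have "v \<notin> S" using v by (simp add: S_def)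
      ultimately have "\<exists>a b. {a, b} \<in> E \<and> a \<in> S \<and> b \<notin> S"
        by (induction rule: converse_rtrancl_induct) auto
      then obtain a b where ab: "{a, b} \<in> E" "a \<in> verts (grown r l)" "b \<notin> verts (grown r l)"
        unfolding S_def by blast
      then have g: "grows E r ((b, a) # l)"
        using less.prems by (simp add: grown_def insert_commute)
      have "b \<in> V" using sub[OF g] by (simp add: grown_def)
      have "V - verts (grown r ((b, a) # l)) \<subset> V - verts (grown r l)"
        using \<open>b \<in> V\<close> ab(3) by (auto simp: grown_def)
      then have "card (V - verts (grown r ((b, a) # l))) < card (V - verts (grown r l))"
        using assms(3) by (intro psubset_card_mono) auto
      from less.hyps[OF this g] show ?thesis .
    qed (use less.prems in blast)
  qed
  from this[of "[]"] show ?thesis by simp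
qed

lemma length_grows: "grows E r l \<Longrightarrow> card (verts (grown r l)) = Suc (length l)"
proof (induction l)
  case (Cons cp l)
  have "verts (grown r (cp # l)) = insert (fst cp) (verts (grown r l))" by (auto simp: grown_def)
  moreover have "fst cp \<notin> verts (grown r l)" "finite (verts (grown r l))"
    using Cons.prems by (auto simp: grown_def)
  ultimately show ?case using Cons by simp
qed (simp add: grown_def)

text \<open>For a certificate an inequality is enough, so it is never shown that the tree grown
  inside a given tree exhausts its edges.\<close>

lemma weight_grown_le:
  assumes "grows E r l" "finite E"
  shows "weight w (grown r l) \<le> weight w (V, E)"
  using edges_grown[OF assms(1)] assms(2) unfolding weight_def by (intro sum_mono2) auto


section \<open>Spanning forests with two trees\<close>

lemma spanning_forest_2:
  "spanning_forest 2 G Ts \<longleftrightarrow> (\<exists>T U. Ts = [T, U] \<and> is_tree T \<and> is_tree U \<and> subgraph T G \<and> subgraph U G \<and>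
     verts T \<inter> verts U = {} \<and> verts G \<subseteq> verts T \<union> verts U)"
proof
  assume s: "spanning_forest 2 G Ts"
  then obtain T U where Ts: "Ts = [T, U]"
    by (auto simp: spanning_forest_def numeral_2_eq_2 length_Suc_conv)
  have "verts (Ts ! 0) \<inter> verts (Ts ! 1) = {}" using s unfolding spanning_forest_def by auto
  with s Ts show "\<exists>T U. Ts = [T, U] \<and> is_tree T \<and> is_tree U \<and> subgraph T G \<and> subgraph U G \<and>
     verts T \<inter> verts U = {} \<and> verts G \<subseteq> verts T \<union> verts U"
    unfolding spanning_forest_def by auto
next
  assume "\<exists>T U. Ts = [T, U] \<and> is_tree T \<and> is_tree U \<and> subgraph T G \<and> subgraph U G \<and>
     verts T \<inter> verts U = {} \<and> verts G \<subseteq> verts T \<union> verts U"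
  then show "spanning_forest 2 G Ts"
    unfolding spanning_forest_def by (auto simp: less_2_cases_iff Int_commute)
qed

definition forest_bounded :: "'a graph \<Rightarrow> ('a set \<Rightarrow> nat) \<Rightarrow> nat \<Rightarrow> bool" where
  "forest_bounded G w W \<longleftrightarrow> (\<exists>T U. is_tree T \<and> is_tree U \<and> subgraph T G \<and> subgraph U G \<and>
     verts T \<inter> verts U = {} \<and> verts G \<subseteq> verts T \<union> verts U \<and> weight w T \<le> W \<and> weight w U \<le> W)"

text \<open>Weights are natural numbers, so a minimum is attained as soon as there is any spanning
  forest, and it is at most \<open>W\<close> if some forest is.\<close>

lemma min_spanning_forest_2:
  "(\<exists>Ts. min_spanning_forest 2 G w Ts \<and> forest_weight w Ts \<le> W) \<longleftrightarrow> forest_bounded G w W"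
proof -
  have "(\<exists>Ts. min_spanning_forest 2 G w Ts \<and> forest_weight w Ts \<le> W) \<longleftrightarrow>
      (\<exists>Ts. spanning_forest 2 G Ts \<and> forest_weight w Ts \<le> W)"
  proof
    assume "\<exists>Ts. spanning_forest 2 G Ts \<and> forest_weight w Ts \<le> W"
    then obtain Ts where Ts: "spanning_forest 2 G Ts" "forest_weight w Ts \<le> W" by blast
    from ex_has_least_nat[of "spanning_forest 2 G", OF Ts(1)] obtain Ts'
      where "spanning_forest 2 G Ts'" "\<And>Ts. spanning_forest 2 G Ts \<Longrightarrow> forest_weight w Ts' \<le> forest_weight w Ts"
      by blast
    with Ts show "\<exists>Ts. min_spanning_forest 2 G w Ts \<and> forest_weight w Ts \<le> W"
      unfolding min_spanning_forest_def using order.trans by blast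
  qed (auto simp: min_spanning_forest_def)
  also have "\<dots> \<longleftrightarrow> forest_bounded G w W"
  proof -
    have "forest_weight w [T, U] \<le> W \<longleftrightarrow> weight w T \<le> W \<and> weight w U \<le> W" for T U
      by (simp add: forest_weight_def)
    then show ?thesis unfolding spanning_forest_2 forest_bounded_def by blast
  qed
  finally show ?thesis .
qed

section \<open>Membership in NP\<close>

lemma bits_eq_Nil [simp]: "bits n = [] \<longleftrightarrow> n = 0"
  by (subst bits.simps) auto

lemma bits_0 [simp]: "bits 0 = []"
  by simp

type_synonym bedge = "nat \<times> nat \<times> bool list"

text \<open>The strings of \<open>encode_instance\<close>, but with weights and bound given by their
  digits: as values of type \<open>nat\<close> they would be in unary and exponentially
  long.\<close>

definition instance_code :: "nat \<Rightarrow> bedge list \<Rightarrow> bool list \<Rightarrow> bool list" where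
  "instance_code n es W = map (\<lambda>_. True) (replicate n (0::nat)) @ [False] @
     concat (map (\<lambda>e. True # delimit (bits (fst e)) @ delimit (bits (fst (snd e))) @ delimit (snd (snd e))) es) @
     [False] @ delimit W"

lemma pt_instance_code [pti]:
  "pt n \<Longrightarrow> pt es \<Longrightarrow> pt W \<Longrightarrow> pt (\<lambda>x. instance_code (n x) (es x) (W x))"
  unfolding instance_code_def by (intro pti)

definition edges_ok :: "nat \<Rightarrow> bedge list \<Rightarrow> bool" where
  "edges_ok n es \<longleftrightarrow> distinct (map (\<lambda>e. (fst e, fst (snd e))) es) \<and>
     (\<forall>e\<in>set es. fst e < fst (snd e) \<and> fst (snd e) < n \<and> norm_bits (snd (snd e)) = snd (snd e))"

definition edge_graph :: "nat \<Rightarrow> bedge list \<Rightarrow> nat graph" where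
  "edge_graph n es = ({..<n}, (\<lambda>e. {fst e, fst (snd e)}) ` set es)"

definition edge_weights :: "bedge list \<Rightarrow> (nat set \<Rightarrow> nat) \<Rightarrow> bool" where
  "edge_weights es w \<longleftrightarrow> (\<forall>e\<in>set es. w {fst e, fst (snd e)} = val (snd (snd e)))"

lemma pair_edges: "{{u, v} | u v. (u, v) \<in> A} = (\<lambda>p. {fst p, snd p}) ` A"
  by force

lemma problem_iff:
  "x \<in> min_spanning_forest_problem 2 \<longleftrightarrow>
     (\<exists>n es W w. x = instance_code n es (bits W) \<and> 0 < W \<and> edges_ok n es \<and> edge_weights es w \<and>
        forest_bounded (edge_graph n es) w W)"
proof
  assume "x \<in> min_spanning_forest_problem 2"
  then obtain n es w W where x: "x = encode_instance n (map (\<lambda>(u, v). (u, v, w {u, v})) es) W"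
    and ok: "0 < W" "distinct es" "\<forall>(u, v)\<in>set es. u < v \<and> v < n"
    and f: "forest_bounded ({..<n}, {{u, v} | u v. (u, v) \<in> set es}) w W"
    unfolding min_spanning_forest_problem_def min_spanning_forest_2[symmetric] by blast
  let ?es = "map (\<lambda>(u, v). (u, v, bits (w {u, v}))) es"
  have "x = instance_code n ?es (bits W)"
    unfolding x encode_instance_def instance_code_def
    by (simp add: encode_edge_def encode_nat_def comp_def split_beta map_replicate_const)
  moreover have "edges_ok n ?es" "edge_weights ?es w"
    using ok by (auto simp: edges_ok_def edge_weights_def comp_def split_beta)
  moreover have "edge_graph n ?es = ({..<n}, {{u, v} | u v. (u, v) \<in> set es})"
    unfolding edge_graph_def pair_edges by (simp add: image_image split_beta)
  ultimately show "\<exists>n es W w. x = instance_code n es (bits W) \<and> 0 < W \<and> edges_ok n es \<and> edge_weights es w \<and>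
        forest_bounded (edge_graph n es) w W"
    using ok(1) f by (intro exI[of _ n] exI[of _ ?es] exI[of _ W] exI[of _ w]) simp
next
  assume "\<exists>n es W w. x = instance_code n es (bits W) \<and> 0 < W \<and> edges_ok n es \<and> edge_weights es w \<and>
        forest_bounded (edge_graph n es) w W"
  then obtain n es W w where x: "x = instance_code n es (bits W)" and ok: "0 < W" "edges_ok n es" "edge_weights es w"
    and f: "forest_bounded (edge_graph n es) w W" by blast
  let ?es = "map (\<lambda>e. (fst e, fst (snd e))) es"
  have c: "snd (snd e) = bits (w {fst e, fst (snd e)})" if "e \<in> set es" for e
  proof -
    have "norm_bits (snd (snd e)) = snd (snd e)" using ok(2) that by (auto simp: edges_ok_def)
    moreover have "w {fst e, fst (snd e)} = val (snd (snd e))" using ok(3) that by (auto simp: edge_weights_def)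
    ultimately show ?thesis by (simp add: norm_bits_eq)
  qed
  have "x = encode_instance n (map (\<lambda>(u, v). (u, v, w {u, v})) ?es) W"
    unfolding x encode_instance_def instance_code_def
    using c by (simp add: encode_edge_def encode_nat_def comp_def split_beta map_replicate_const cong: map_cong)
  moreover have "distinct ?es" "\<forall>(u, v)\<in>set ?es. u < v \<and> v < n"
    using ok by (auto simp: edges_ok_def)
  moreover have "edge_graph n es = ({..<n}, {{u, v} | u v. (u, v) \<in> set ?es})"
    unfolding edge_graph_def pair_edges by (simp add: image_image)
  ultimately show "x \<in> min_spanning_forest_problem 2"
    using ok(1) f unfolding min_spanning_forest_problem_def min_spanning_forest_2[symmetric]
    by (intro CollectI exI[of _ n] exI[of _ ?es] exI[of _ w] exI[of _ W]) simp
qed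

text \<open>Each edge is listed once, with its smaller end first, so the weights in the list do not
  conflict on unordered pairs.\<close>

lemma ex_edge_weights:
  assumes "edges_ok n es"
  shows "\<exists>w. edge_weights es w"
proof -
  let ?P = "\<lambda>S c. \<exists>e\<in>set es. S = {fst e, fst (snd e)} \<and> c = val (snd (snd e))"
  have inj: "e = e'" if "e \<in> set es" "e' \<in> set es" "{fst e, fst (snd e)} = {fst e', fst (snd e')}" for e e'
  proof -
    have "fst e < fst (snd e)" "fst e' < fst (snd e')" using assms that by (auto simp: edges_ok_def)
    with that(3) have "(fst e, fst (snd e)) = (fst e', fst (snd e'))" by (auto simp: doubleton_eq_iff)
    with assms that(1,2) show ?thesis by (auto simp: edges_ok_def distinct_map inj_on_def)
  qed
  have "(SOME c. ?P {fst e, fst (snd e)} c) = val (snd (snd e))" if "e \<in> set es" for e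
    using inj[OF that] that by (intro some_equality) blast+
  then have "edge_weights es (\<lambda>S. SOME c. ?P S c)" by (simp add: edge_weights_def)
  then show ?thesis by blast
qed

(* A root, the pairs (child, parent) of a grown tree with the weights of their edges, and the
   difference between the bound and the weight of the tree. *)
type_synonym tree_cert = "nat \<times> bedge list \<times> bool list"

definition cert_verts :: "tree_cert \<Rightarrow> nat list" where
  "cert_verts F = fst F # map fst (fst (snd F))"

definition tree_ok :: "nat \<times> bedge list \<times> bool list \<Rightarrow> tree_cert \<Rightarrow> bool" where
  "tree_ok G F \<longleftrightarrow> fst F < fst G \<and>
     all_suffixes (\<lambda>g l. fst g \<notin> set (cert_verts (fst F, l, [])) \<and> fst (snd g) \<in> set (cert_verts (fst F, l, [])) \<and>
       ((fst g, fst (snd g), snd (snd g)) \<in> set (fst (snd G)) \<or> (fst (snd g), fst g, snd (snd g)) \<in> set (fst (snd G))))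
       (fst (snd F)) \<and>
     norm_bits (sum_bits (snd (snd F) # map (\<lambda>g. snd (snd g)) (fst (snd F)))) = snd (snd G)"

text \<open>The certificate repeats the whole instance, so that \<open>x\<close> never has to be
  parsed: the repeated instance is encoded and the result compared with \<open>x\<close>.\<close>

definition check :: "bool list \<Rightarrow> (nat \<times> bedge list \<times> bool list) \<times> tree_cert \<times> tree_cert \<Rightarrow> bool" where
  "check x C \<longleftrightarrow> (let G = fst C; F1 = fst (snd C); F2 = snd (snd C) in
     x = instance_code (fst G) (fst (snd G)) (snd (snd G)) \<and>
     snd (snd G) \<noteq> [] \<and> norm_bits (snd (snd G)) = snd (snd G) \<and> edges_ok (fst G) (fst (snd G)) \<and>
     tree_ok G F1 \<and> tree_ok G F2 \<and> (\<forall>v\<in>set (cert_verts F1). v \<notin> set (cert_verts F2)) \<and>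
     (\<forall>v\<in>set [0..<fst G]. v \<in> set (cert_verts F1) \<or> v \<in> set (cert_verts F2)))"

lemma tree_ok_imp:
  assumes F: "tree_ok (n, es, W) F" and es: "edges_ok n es" "edge_weights es w"
  shows "\<exists>T. is_tree T \<and> subgraph T (edge_graph n es) \<and> verts T = set (cert_verts F) \<and> weight w T \<le> val W"
proof -
  obtain r gl s where [simp]: "F = (r, gl, s)" by (cases F)
  let ?E = "edges (edge_graph n es)" and ?l = "map (\<lambda>g. (fst g, fst (snd g))) gl"
  have gl: "all_suffixes (\<lambda>g l. fst g \<notin> set (cert_verts (r, l, [])) \<and> fst (snd g) \<in> set (cert_verts (r, l, [])) \<and>
       ((fst g, fst (snd g), snd (snd g)) \<in> set es \<or> (fst (snd g), fst g, snd (snd g)) \<in> set es)) gl"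
    and r: "r < n" and s: "norm_bits (sum_bits (s # map (\<lambda>g. snd (snd g)) gl)) = W"
    using F by (auto simp: tree_ok_def)
  from gl have g: "grows ?E r ?l \<and> (\<forall>g\<in>set gl. w {fst g, fst (snd g)} = val (snd (snd g)))"
  proof (induction gl)
    case (Cons g gl)
    from Cons.prems have e: "(fst g, fst (snd g), snd (snd g)) \<in> set es \<or> (fst (snd g), fst g, snd (snd g)) \<in> set es"
      by simp
    then have "\<exists>e\<in>set es. {fst g, fst (snd g)} = {fst e, fst (snd e)} \<and> snd (snd g) = snd (snd e)"
    proof
      assume "(fst g, fst (snd g), snd (snd g)) \<in> set es"
      then show ?thesis by (rule bexI[rotated]) simp
    next
      assume "(fst (snd g), fst g, snd (snd g)) \<in> set es"
      then show ?thesis by (rule bexI[rotated]) auto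
    qed
    then have "{fst g, fst (snd g)} \<in> ?E" "w {fst g, fst (snd g)} = val (snd (snd g))"
      using es(2) by (auto simp: edge_graph_def edge_weights_def)
    with Cons show ?case by (simp add: cert_verts_def image_image)
  qed simp
  have "verts (grown r ?l) = set (cert_verts F)" by (simp add: grown_def cert_verts_def image_image)
  moreover have "is_tree (grown r ?l)" by (rule is_tree_grown[OF conjunct1[OF g]])
  moreover have "edges (grown r ?l) \<subseteq> ?E" by (rule edges_grown[OF conjunct1[OF g]])
  moreover have "verts (grown r ?l) \<subseteq> verts (edge_graph n es)"
  proof -
    have "is_graph (edge_graph n es)" using es(1) by (fastforce simp: is_graph_def edge_graph_def edges_ok_def)
    then show ?thesis
      using verts_grown[of "{..<n}" ?E r ?l] r conjunct1[OF g] by (simp add: edge_graph_def)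
  qed
  moreover have "weight w (grown r ?l) \<le> val W"
  proof -
    have "weight w (grown r ?l) = sum_list (map (\<lambda>g. val (snd (snd g))) gl)"
      using g weight_grown[of ?E r ?l w] by (simp add: comp_def cong: map_cong)
    also have "\<dots> \<le> val W" unfolding s[symmetric] norm_bits_eq by (simp add: comp_def)
    finally show ?thesis .
  qed
  ultimately show ?thesis
    by (intro exI[of _ "grown r ?l"]) (simp add: is_tree_def subgraph_def)
qed

lemma check_sound:
  assumes "check x C"
  shows "x \<in> min_spanning_forest_problem 2"
proof -
  obtain n es W F1 F2 where C: "C = ((n, es, W), F1, F2)" by (metis prod.collapse)
  have c: "x = instance_code n es W" "W \<noteq> []" "norm_bits W = W" "edges_ok n es"
     "tree_ok (n, es, W) F1" "tree_ok (n, es, W) F2" "set (cert_verts F1) \<inter> set (cert_verts F2) = {}"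
     "{..<n} \<subseteq> set (cert_verts F1) \<union> set (cert_verts F2)"
    using assms unfolding C by (auto simp: check_def Let_def)
  obtain w where w: "edge_weights es w" using ex_edge_weights[OF c(4)] by blast
  obtain T where T: "is_tree T" "subgraph T (edge_graph n es)" "verts T = set (cert_verts F1)" "weight w T \<le> val W"
    using tree_ok_imp[OF c(5,4) w] by blast
  obtain U where U: "is_tree U" "subgraph U (edge_graph n es)" "verts U = set (cert_verts F2)" "weight w U \<le> val W"
    using tree_ok_imp[OF c(6,4) w] by blast
  have "verts (edge_graph n es) = {..<n}" by (simp add: edge_graph_def)
  then have "forest_bounded (edge_graph n es) w (val W)"
    unfolding forest_bounded_def using T U c(7,8) by (intro exI[of _ T] exI[of _ U]) simp
  moreover have W: "W = bits (val W)" using c(3) by (simp add: norm_bits_eq)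
  moreover have "0 < val W" using c(2) W by (metis bits_eq_Nil gr0I)
  ultimately show ?thesis unfolding problem_iff using c(1,4) w
    by (intro exI[of _ n] exI[of _ es] exI[of _ "val W"] exI[of _ w]) simp
qed


lemma length_bits_mono: "m \<le> n \<Longrightarrow> length (bits m) \<le> length (bits n)"
proof (induction m arbitrary: n rule: bits.induct)
  case (1 m)
  show ?case
  proof (cases "m = 0")
    case False
    then have "length (bits (m div 2)) \<le> length (bits (n div 2))"
      using 1 by (simp add: div_le_mono)
    then show ?thesis using False 1(2) by (subst (1 2) bits.simps) auto
  qed simp
qed

lemma ex_tree_ok:
  assumes es: "edges_ok n es" "edge_weights es w"
    and T: "is_tree T" "subgraph T (edge_graph n es)" "weight w T \<le> W"
  shows "\<exists>F. tree_ok (n, es, bits W) F \<and> set (cert_verts F) = verts T \<and> length (fst (snd F)) \<le> n \<and>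
    (\<forall>g\<in>set (fst (snd F)). (fst g, fst (snd g), snd (snd g)) \<in> set es \<or> (fst (snd g), fst g, snd (snd g)) \<in> set es) \<and>
    length (snd (snd F)) \<le> length (bits W)"
proof -
  obtain V E where VE [simp]: "T = (V, E)" by (cases T)
  have sub: "V \<subseteq> {..<n}" "E \<subseteq> edges (edge_graph n es)"
    using T(2) by (auto simp: subgraph_def edge_graph_def)
  from T(1) obtain r where r: "r \<in> V" by (auto simp: is_tree_def)
  have fin: "finite V" "finite E"
    using sub finite_subset by (auto simp: edge_graph_def intro: finite_subset)
  from ex_grows[of V E r] T(1) r fin obtain l where l: "grows E r l" "verts (grown r l) = V"
    by (auto simp: is_tree_def)
  let ?g = "\<lambda>(c, p). (c, p, bits (w {c, p}))"
  let ?gl = "map ?g l"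
  have W: "(\<Sum>(c, p)\<leftarrow>l. w {c, p}) \<le> W"
    using weight_grown_le[OF l(1) fin(2), of w V] weight_grown[OF l(1), of w] T(3) by simp
  define s where "s = W - (\<Sum>(c, p)\<leftarrow>l. w {c, p})"
  have edge: "(c, p, bits (w {c, p})) \<in> set es \<or> (p, c, bits (w {c, p})) \<in> set es" if "{c, p} \<in> E" for c p
  proof -
    from that sub(2) obtain e where e: "e \<in> set es" "{c, p} = {fst e, fst (snd e)}"
      by (auto simp: edge_graph_def)
    then have "snd (snd e) = bits (w {c, p})"
      using es norm_bits_eq[of "snd (snd e)"] by (simp add: edges_ok_def edge_weights_def)
    then have e': "e = (fst e, fst (snd e), bits (w {c, p}))" by (metis prod.collapse)
    from e(2) have "c = fst e \<and> p = fst (snd e) \<or> c = fst (snd e) \<and> p = fst e"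
      by (auto simp: doubleton_eq_iff)
    with e' e(1) show ?thesis by metis
  qed
  from l(1) have gl: "all_suffixes (\<lambda>g l. fst g \<notin> set (cert_verts (r, l, [])) \<and> fst (snd g) \<in> set (cert_verts (r, l, [])) \<and>
       ((fst g, fst (snd g), snd (snd g)) \<in> set es \<or> (fst (snd g), fst g, snd (snd g)) \<in> set es)) ?gl \<and>
     (\<forall>g\<in>set ?gl. (fst g, fst (snd g), snd (snd g)) \<in> set es \<or> (fst (snd g), fst g, snd (snd g)) \<in> set es)"
  proof (induction l)
    case (Cons cp l)
    then show ?case using edge[of "fst cp" "snd cp"] by (simp add: cert_verts_def image_image split_beta)
  qed simp
  have "sum_list (map (\<lambda>g. val (snd (snd g))) ?gl) = (\<Sum>(c, p)\<leftarrow>l. w {c, p})"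
    by (simp add: comp_def split_def)
  then have "norm_bits (sum_bits (bits s # map (\<lambda>g. snd (snd g)) ?gl)) = bits W"
    using W by (simp add: norm_bits_eq comp_def s_def)
  then have "tree_ok (n, es, bits W) (r, ?gl, bits s)"
    using gl r sub(1) by (auto simp: tree_ok_def)
  moreover have "set (cert_verts (r, ?gl, bits s)) = verts T"
    using l(2) by (simp add: cert_verts_def grown_def image_image split_beta)
  moreover have "length l \<le> n"
    using length_grows[OF l(1)] card_mono[OF _ sub(1)] l(2) by simp
  moreover have "length (bits s) \<le> length (bits W)"
    by (rule length_bits_mono) (simp add: s_def)
  ultimately show ?thesis using gl by (intro exI[of _ "(r, ?gl, bits s)"]) simp
qed

lemma sz_list_le:
  assumes "\<And>y. y \<in> set l \<Longrightarrow> sz y \<le> K" "length l \<le> N"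
  shows "sz l \<le> N * (K + 1) + 1"
proof -
  have "sz l \<le> length l * (K + 1) + 1"
    using assms(1) by (induction l) fastforce+
  also have "\<dots> \<le> N * (K + 1) + 1" using assms(2) by (intro add_mono mult_mono) auto
  finally show ?thesis .
qed

lemma length_concat_ge: "(\<And>e. e \<in> set es \<Longrightarrow> f e \<noteq> []) \<Longrightarrow> length es \<le> length (concat (map f es))"
proof (induction es)
  case (Cons a es)
  obtain y ys where "f a = y # ys" using Cons.prems[of a] by (auto simp: neq_Nil_conv)
  moreover have "length es \<le> length (concat (map f es))" using Cons by simp
  ultimately show ?case by simp
qed simp

lemma length_mem_concat: "e \<in> set es \<Longrightarrow> length (f e) \<le> length (concat (map f es))"
  by (induction es) auto

lemma length_delimit [simp]: "length (delimit xs) = 2 * length xs + 1"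
  by (induction xs) auto

text \<open>The number of vertices is in unary in \<open>x\<close>, which pays for unary vertices in
  the certificate. Three lists of at most \<open>length x\<close> edges, each edge of size at most
  \<open>8 * length x + 5\<close>, cause the quadratic term; the coefficients 100 are
  generous.\<close>

lemma check_complete:
  assumes "x \<in> min_spanning_forest_problem 2"
  shows "\<exists>C. check x C \<and> sz C \<le> poly [:100, 100, 100:] (length x)"
proof -
  from assms[unfolded problem_iff] obtain n es W w T U
    where x: "x = instance_code n es (bits W)" and W: "0 < W" and es: "edges_ok n es" "edge_weights es w"
      and T: "is_tree T" "subgraph T (edge_graph n es)" "weight w T \<le> W"
      and U: "is_tree U" "subgraph U (edge_graph n es)" "weight w U \<le> W"
      and TU: "verts T \<inter> verts U = {}" "verts (edge_graph n es) \<subseteq> verts T \<union> verts U"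
    unfolding forest_bounded_def by blast
  let ?N = "length x"
  let ?f = "\<lambda>e. True # delimit (bits (fst e)) @ delimit (bits (fst (snd e))) @ delimit (snd (snd e))"
  have N: "?N = n + 1 + length (concat (map ?f es)) + 1 + (2 * length (bits W) + 1)"
    unfolding x instance_code_def by simp
  have n: "n \<le> ?N" and len: "length es \<le> ?N" and WN: "length (bits W) \<le> ?N"
    using N length_concat_ge[of es ?f] by simp_all
  have sz_edge: "sz (u, v, c) \<le> 8 * ?N + 5"
    if "(u, v, c) \<in> set es \<or> (v, u, c) \<in> set es" for u v c
  proof -
    have "u \<le> n" "v \<le> n" using es(1) that by (auto simp: edges_ok_def)
    moreover have "length c \<le> ?N"
      using that length_mem_concat[of _ es ?f] unfolding N by fastforce
    ultimately show ?thesis using n sz_bool_list[of c] by (simp add: sz_nat)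
  qed
  obtain F where F: "tree_ok (n, es, bits W) F" "set (cert_verts F) = verts T" "length (fst (snd F)) \<le> n"
    "\<forall>g\<in>set (fst (snd F)). (fst g, fst (snd g), snd (snd g)) \<in> set es \<or> (fst (snd g), fst g, snd (snd g)) \<in> set es"
    "length (snd (snd F)) \<le> length (bits W)"
    using ex_tree_ok[OF es T] by blast
  obtain H where H: "tree_ok (n, es, bits W) H" "set (cert_verts H) = verts U" "length (fst (snd H)) \<le> n"
    "\<forall>g\<in>set (fst (snd H)). (fst g, fst (snd g), snd (snd g)) \<in> set es \<or> (fst (snd g), fst g, snd (snd g)) \<in> set es"
    "length (snd (snd H)) \<le> length (bits W)"
    using ex_tree_ok[OF es U] by blast
  have sz_tree: "sz F \<le> (2 * ?N + 1) + ((?N * ((8 * ?N + 5) + 1) + 1) + (4 * ?N + 1) + 1) + 1"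
    if F: "tree_ok (n, es, bits W) F" "length (fst (snd F)) \<le> n"
    "\<forall>g\<in>set (fst (snd F)). (fst g, fst (snd g), snd (snd g)) \<in> set es \<or> (fst (snd g), fst g, snd (snd g)) \<in> set es"
    "length (snd (snd F)) \<le> length (bits W)" for F
  proof -
    obtain r gl s where [simp]: "F = (r, gl, s)" by (cases F)
    have "sz r \<le> 2 * ?N + 1" using F(1) n by (simp add: tree_ok_def sz_nat)
    moreover have "sz gl \<le> ?N * ((8 * ?N + 5) + 1) + 1"
      by (rule sz_list_le) (use F(2,3) n sz_edge in \<open>auto simp del: sz_simps\<close>)
    moreover have "sz s \<le> 4 * ?N + 1" using F(4) WN sz_bool_list[of s] by simp
    ultimately show ?thesis by simp
  qed
  have "check x ((n, es, bits W), F, H)"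
    using x W es(1) F(1,2) H(1,2) TU by (auto simp: check_def Let_def edge_graph_def)
  moreover have "sz es \<le> ?N * ((8 * ?N + 5) + 1) + 1"
    by (rule sz_list_le) (use len sz_edge in \<open>auto simp del: sz_simps\<close>)
  moreover have "sz (bits W) \<le> 4 * ?N + 1" using WN sz_bool_list[of "bits W"] by simp
  ultimately show ?thesis
    using sz_tree[OF F(1,3,4,5)] sz_tree[OF H(1,3,4,5)] n
    by (intro exI[of _ "((n, es, bits W), F, H)"]) (simp add: sz_nat algebra_simps)
qed


lemma pt_check: "pt (\<lambda>p. check (fst p) (snd p))"
  unfolding check_def Let_def tree_ok_def edges_ok_def cert_verts_def fst_conv snd_conv by (intro pti)


subsection \<open>Decoding of certificates\<close>

text \<open>An automaton with three modes: 0 expects a continuation bit of \<open>delimit\<close>, 1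
  a bit of the first component, and 2 copies the second component.\<close>

definition unpair_step :: "bool \<Rightarrow> nat \<times> bool list \<times> bool list \<Rightarrow> nat \<times> bool list \<times> bool list" where
  "unpair_step b s = (if fst s = 0 then (if b then 1 else 2, snd s)
     else if fst s = 1 then (0, b # fst (snd s), snd (snd s)) else (2, fst (snd s), b # snd (snd s)))"

definition unpair :: "bool list \<Rightarrow> bool list \<times> bool list" where
  "unpair z = (let s = fold unpair_step z (0, [], []) in (rev (fst (snd s)), rev (snd (snd s))))"

lemma unpair_encode_pair [simp]: "unpair (encode_pair x y) = (x, y)"
proof -
  have "fold unpair_step y (2, xs, ys) = (2, xs, rev y @ ys)" for xs ys
    by (induction y arbitrary: ys) (auto simp: unpair_step_def)
  then have "fold unpair_step (delimit x @ y) (0, xs, []) = (2, rev x @ xs, rev y)" for xs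
    by (induction x arbitrary: xs) (auto simp: unpair_step_def)
  then show ?thesis by (simp add: unpair_def encode_pair_def)
qed

lemma pt_unpair [pti]:
  assumes "pt f"
  shows "pt (\<lambda>x. unpair (f x))"
proof -
  have len: "fst (fold unpair_step z s) \<le> max 2 (fst s) \<and>
     length (fst (snd (fold unpair_step z s))) + length (snd (snd (fold unpair_step z s))) \<le>
     length z + length (fst (snd s)) + length (snd (snd s))" for z s
  proof (induction z arbitrary: s)
    case (Cons b z)
    have "fst (unpair_step b s) \<le> max 2 (fst s)" "length (fst (snd (unpair_step b s))) +
        length (snd (snd (unpair_step b s))) \<le> 1 + length (fst (snd s)) + length (snd (snd s))"
      by (auto simp: unpair_step_def)
    then show ?case using Cons[of "unpair_step b s"] by auto
  qed simp
  have sz: "sz (fold unpair_step z (0, [], [])) \<le> 8 * length z + 10" for z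
  proof -
    obtain m xs ys where f: "fold unpair_step z (0, [], []) = (m, xs, ys)" by (cases "fold unpair_step z (0, [], [])")
    with len[of z "(0, [], [])"] have "m \<le> 2" "length xs + length ys \<le> length z" by auto
    with sz_bool_list[of xs] sz_bool_list[of ys] show ?thesis unfolding f by (simp add: sz_nat)
  qed
  have "pt (\<lambda>x. fold unpair_step (f x) (0, [], []))"
  proof (rule pt_fold)
    show "pt (\<lambda>p. unpair_step (fst (snd p)) (snd (snd p)))" unfolding unpair_step_def by (intro pti)
    show "pbd (\<lambda>x. 8 * sz (f x) + 10)" by (intro pbdi pt_sz assms)
    show "sz (fold unpair_step (take i (f x)) (0, [], [])) \<le> 8 * sz (f x) + 10" for x i
      using sz[of "take i (f x)"] length_le_sz[of "f x"] by simp
  qed (intro pti assms)+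
  then show ?thesis unfolding unpair_def Let_def by (intro pti; assumption)
qed

text \<open>A prefix code read from right to left is a postfix expression, which is evaluated on a
  stack of trees. Malformed strings give some default.\<close>

definition parse_step :: "bool \<Rightarrow> tree list \<Rightarrow> tree list" where
  "parse_step b ts = (if b then (case ts of [] \<Rightarrow> [] | l # us \<Rightarrow> (case us of [] \<Rightarrow> [] | r # vs \<Rightarrow> Node l r # vs))
     else Leaf # ts)"

definition parse :: "bool list \<Rightarrow> tree" where
  "parse y = (case fold parse_step (rev y) [] of [] \<Rightarrow> Leaf | t # _ \<Rightarrow> t)"

lemma parse_code [simp]: "parse (map (\<lambda>a. a = 3) (code t)) = t"
proof -
  have "fold parse_step (rev (map (\<lambda>a. a = 3) (code t))) ts = t # ts" for ts
    by (induction t arbitrary: ts) (auto simp: parse_step_def)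
  then show ?thesis by (simp add: parse_def)
qed

lemma pt_Node [pti]: "pt f \<Longrightarrow> pt g \<Longrightarrow> pt (\<lambda>x. Node (f x) (g x))"
  by (rule pt_cast[OF pt_Pair[of f g]]) (auto simp: tr_simps)

lemma pt_parse [pti]:
  assumes "pt f"
  shows "pt (\<lambda>x. parse (f x))"
proof -
  have len: "sz (fold parse_step z ts) \<le> 2 * length z + sz ts" for z ts
  proof (induction z arbitrary: ts)
    case (Cons b z)
    have "sz (parse_step b ts) \<le> sz ts + 2" by (auto simp: parse_step_def split: list.splits)
    then show ?case using Cons[of "parse_step b ts"] by simp
  qed simp
  have "pt (\<lambda>x. fold parse_step (rev (f x)) [])"
  proof (rule pt_fold)
    show "pt (\<lambda>p. parse_step (fst (snd p)) (snd (snd p)))" unfolding parse_step_def by (intro pti)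
    show "pbd (\<lambda>x. 2 * sz (f x) + 1)" by (intro pbdi pt_sz assms)
    show "sz (fold parse_step (take i (rev (f x))) []) \<le> 2 * sz (f x) + 1" for x i
      using len[of "take i (rev (f x))" "[]"] length_le_sz[of "f x"] by simp
  qed (intro pti assms)+
  then show ?thesis unfolding parse_def by (intro pti; assumption)
qed

lemma pt_left_comp [pti]: "pt f \<Longrightarrow> pt (\<lambda>x. left (f x))"
  by (rule pt_comp[OF pt_left])

lemma pt_right_comp [pti]: "pt f \<Longrightarrow> pt (\<lambda>x. right (f x))"
  by (rule pt_comp[OF pt_right])

text \<open>Every tree is the code of the list of left subtrees along its right spine, so this is a
  change of type without any computation.\<close>

fun dec_list :: "tree \<Rightarrow> tree list" where
  "dec_list Leaf = []"
| "dec_list (Node a b) = a # dec_list b"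

lemma tr_dec_list: "tr (dec_list t) = t"
  by (induction t) (auto simp: tr_tree_def)

lemma dec_list_tr [simp]: "dec_list (tr xs) = map tr xs"
  by (induction xs) auto

lemma pt_dec_list [pti]: "pt f \<Longrightarrow> pt (\<lambda>x. dec_list (f x))"
  by (rule pt_cast[of f]) (auto simp: tr_dec_list tr_tree_def)

text \<open>The decoders are total. A string that is no proper code is read as some other
  certificate, which is harmless because \<open>check_sound\<close> holds for all
  certificates.\<close>

definition dec_nat :: "tree \<Rightarrow> nat" where
  "dec_nat t = length (dec_list t)"

definition dec_bits :: "tree \<Rightarrow> bool list" where
  "dec_bits t = map (\<lambda>s. s \<noteq> Leaf) (dec_list t)"

definition dec_edges :: "tree \<Rightarrow> bedge list" where
  "dec_edges t = map (\<lambda>s. (dec_nat (left s), dec_nat (left (right s)), dec_bits (right (right s)))) (dec_list t)"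

definition dec_triple :: "tree \<Rightarrow> nat \<times> bedge list \<times> bool list" where
  "dec_triple t = (dec_nat (left t), dec_edges (left (right t)), dec_bits (right (right t)))"

lemma dec_nat_tr [simp]: "dec_nat (tr n) = n"
  unfolding dec_nat_def by (induction n) auto

lemma dec_bits_tr [simp]: "dec_bits (tr bs) = bs"
  unfolding dec_bits_def by (simp add: comp_def tr_bool_def)

lemma tr_Pair: "tr (a, b) = Node (tr a) (tr b)"
  by (simp add: tr_prod_def)

lemma dec_triple_tr [simp]: "dec_triple (tr F) = F"
  by (cases F) (simp add: dec_triple_def dec_edges_def tr_prod_def comp_def)

theorem problem_in_NP: "in_NP (min_spanning_forest_problem 2)"
proof -
  define f where "f z = (let x = fst (unpair z); t = parse (snd (unpair z)) in
    [check x (dec_triple (left t), dec_triple (left (right t)), dec_triple (right (right t)))])" for z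
  have "pt f"
    unfolding f_def Let_def dec_triple_def dec_edges_def dec_nat_def dec_bits_def
    by (intro pti pt_comp2[OF pt_check])
  moreover have "x \<in> min_spanning_forest_problem 2 \<longleftrightarrow>
      (\<exists>y. length y \<le> poly [:100, 100, 100:] (length x) \<and> f (encode_pair x y) = [True])" for x
  proof
    assume "x \<in> min_spanning_forest_problem 2"
    then obtain C where C: "check x C" "sz C \<le> poly [:100, 100, 100:] (length x)" using check_complete by blast
    let ?y = "map (\<lambda>a. a = 3) (code (tr C))"
    have "f (encode_pair x ?y) =
        [check x (dec_triple (left (tr C)), dec_triple (left (right (tr C))), dec_triple (right (right (tr C))))]"
      by (simp add: f_def Let_def)
    also have "(dec_triple (left (tr C)), dec_triple (left (right (tr C))), dec_triple (right (right (tr C)))) = C"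
      by (cases C rule: prod_cases3) (simp add: tr_Pair)
    finally have "f (encode_pair x ?y) = [True]"
      using C(1) by simp
    with C(2) show "\<exists>y. length y \<le> poly [:100, 100, 100:] (length x) \<and> f (encode_pair x y) = [True]"
      by (intro exI[of _ ?y]) (simp add: sz_def)
  next
    assume "\<exists>y. length y \<le> poly [:100, 100, 100:] (length x) \<and> f (encode_pair x y) = [True]"
    then obtain y where "f (encode_pair x y) = [True]" by blast
    then show "x \<in> min_spanning_forest_problem 2"
      by (simp only: f_def Let_def unpair_encode_pair fst_conv snd_conv list.inject simp_thms check_sound)
  qed
  ultimately show ?thesis unfolding in_NP_def using polytime_if_pt by blast
qed

section \<open>From subset sum to spanning forests\<close>

(* The vertices below m stand for the summands; m and m + 1 are the hubs, and the others are leaves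
   private to one hub.  All edges at a vertex v other than the hubs have the same weight \<omega> v, and
   these weights sum up to 2 * W. *)
locale subset_sum_graph =
  fixes m :: nat and s :: "nat \<Rightarrow> nat" and t :: nat and w :: "nat set \<Rightarrow> nat"
  fixes E :: "nat set set" and \<omega> :: "nat \<Rightarrow> nat" and S W :: nat
  assumes t: "0 < t"
  defines "S \<equiv> \<Sum>i<m. s i" and "W \<equiv> S + 2 * t"
    and "E \<equiv> (\<lambda>i. {i, m}) ` {..<m} \<union> (\<lambda>i. {i, m + 1}) ` {..<m} \<union>
       {{m, m + 2}, {m + 1, m + 3}, {m + 1, m + 4}, {m + 1, m + 5}}"
    and "\<omega> \<equiv> \<lambda>v. if v < m then s v else if v = m + 2 then S + t else t"
  assumes w: "\<And>v h. v \<notin> {m, m + 1} \<Longrightarrow> {v, h} \<in> E \<Longrightarrow> w {v, h} = \<omega> v"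
begin

definition G :: "nat graph" where
  "G = ({..<m + 6}, E)"

text \<open>The summands are included although they have degree two in the graph: in a tree with
  only one of the hubs they are leaves.\<close>

definition leaves :: "nat set" where
  "leaves = {..<m + 6} - {m, m + 1}"

lemma leaves_eq: "leaves = {..<m} \<union> {m + 2, m + 3, m + 4, m + 5}"
  by (auto simp: leaves_def)

lemma finite_E: "finite E"
  by (simp add: E_def)

lemma edge_cases:
  assumes "e \<in> E"
  obtains v h where "e = {v, h}" "v \<in> leaves" "h = m \<or> h = m + 1"
proof -
  from assms consider i where "i < m" "e = {i, m}" | i where "i < m" "e = {i, m + 1}"
    | "e = {m + 2, m}" | "e = {m + 3, m + 1}" | "e = {m + 4, m + 1}" | "e = {m + 5, m + 1}"
    unfolding E_def by blast
  then show thesis by cases (rule that, assumption, simp_all add: leaves_def)+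
qed

lemma edge_unique:
  assumes "{v, h} \<in> E" "u \<in> {v, h}" "v \<in> leaves" "u \<in> leaves"
  shows "u = v"
proof -
  obtain v' h' where "{v, h} = {v', h'}" "v' \<in> leaves" "h' = m \<or> h' = m + 1" using edge_cases[OF assms(1)] .
  then show ?thesis using assms(2-4) by (auto simp: doubleton_eq_iff leaves_def)
qed

lemma private_edge:
  "{m + 2, z} \<in> E \<Longrightarrow> z = m"
  "{j, z} \<in> E \<Longrightarrow> j \<in> {m + 3, m + 4, m + 5} \<Longrightarrow> z = m + 1"
  unfolding E_def by (elim UnE imageE insertE emptyE; simp only: doubleton_eq_iff lessThan_iff; linarith)+

text \<open>\<open>S + (S + t) + 3 * t\<close>, from the summands, the leaf at \<open>m\<close> and
  the three leaves at \<open>m + 1\<close>.\<close>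

lemma sum_omega: "(\<Sum>v\<in>leaves. \<omega> v) = 2 * W"
  unfolding leaves_eq by (subst sum.union_disjoint) (auto simp: \<omega>_def W_def S_def)

text \<open>This is why \<open>m + 1\<close> has three leaves of weight \<open>t\<close>: a single
  one of weight \<open>3 * t\<close> could reach \<open>W = S + 2 * t\<close>.\<close>

lemma omega_less: "v \<in> leaves \<Longrightarrow> \<omega> v < W"
  using t member_le_sum[of v "{..<m}" s] by (auto simp: \<omega>_def W_def S_def)

lemma ex_edge:
  assumes "is_tree T" "u \<in> verts T" "v \<in> verts T" "u \<noteq> v"
  shows "\<exists>z. {v, z} \<in> edges T"
proof -
  have "(v, u) \<in> {(a, b). {a, b} \<in> edges T}\<^sup>*"
    using assms by (auto simp: is_tree_def connected_graph_def)
  then show ?thesis using assms(4) by (cases rule: converse_rtranclE) auto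
qed

text \<open>The graph is bipartite with the hubs on one side, so edges chosen at different vertices
  of \<open>N\<close> are different, and each has the weight of its vertex.\<close>

lemma weight_ge:
  assumes "edges T \<subseteq> E" "N \<subseteq> leaves" "\<And>v. v \<in> N \<Longrightarrow> \<exists>z. {v, z} \<in> edges T"
  shows "(\<Sum>v\<in>N. \<omega> v) \<le> weight w T"
proof -
  from assms(3) obtain z where z: "\<And>v. v \<in> N \<Longrightarrow> {v, z v} \<in> edges T" by metis
  have "inj_on (\<lambda>v. {v, z v}) N"
  proof (rule inj_onI)
    fix u v assume uv: "u \<in> N" "v \<in> N" "{u, z u} = {v, z v}"
    then show "u = v" using edge_unique[of v "z v" u] z[of v] assms(1,2) by auto
  qed
  moreover have "w {v, z v} = \<omega> v" if "v \<in> N" for v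
    using w[of v "z v"] z[OF that] that assms(1,2) by (auto simp: leaves_def)
  ultimately have "(\<Sum>v\<in>N. \<omega> v) = (\<Sum>e\<in>(\<lambda>v. {v, z v}) ` N. w e)"
    by (simp add: sum.reindex)
  also have "\<dots> \<le> weight w T"
    unfolding weight_def using z assms(1) finite_E by (intro sum_mono2) (auto intro: finite_subset)
  finally show ?thesis .
qed

text \<open>Every edge meets a hub, so the other tree would be a single vertex \<open>v\<close>, and
  \<open>T\<close> would weigh at least \<open>2 * W - \<omega> v\<close>, which exceeds
  \<open>W\<close>.\<close>

lemma hubs_separated:
  assumes T: "is_tree T" "subgraph T G" "weight w T \<le> W" and U: "is_tree U" "subgraph U G"
    and TU: "verts T \<inter> verts U = {}" "verts G \<subseteq> verts T \<union> verts U"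
    and hubs: "m \<in> verts T" "m + 1 \<in> verts T"
  shows False
proof -
  have noE: "edges U = {}"
  proof (rule ccontr)
    assume "edges U \<noteq> {}"
    then obtain e where e: "e \<in> edges U" by blast
    then have "e \<in> E" "e \<subseteq> verts U" using U(2) by (auto simp: subgraph_def G_def is_graph_def)
    with TU(1) hubs show False by (elim edge_cases) auto
  qed
  obtain v where v: "v \<in> verts U" using U(1) by (auto simp: is_tree_def)
  with ex_edge[OF U(1), of _ v] noE have "verts U = {v}" by blast
  have vl: "v \<in> leaves" using v U(2) TU(1) hubs by (auto simp: leaves_def subgraph_def G_def)
  have "\<exists>z. {u, z} \<in> edges T" if "u \<in> leaves - {v}" for u
    using that TU(2) \<open>verts U = {v}\<close> hubs by (intro ex_edge[OF T(1), of m]) (auto simp: leaves_def G_def)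
  then have "(\<Sum>u\<in>leaves - {v}. \<omega> u) \<le> weight w T"
    using T(2) by (intro weight_ge) (auto simp: subgraph_def G_def)
  moreover have "(\<Sum>u\<in>leaves - {v}. \<omega> u) = 2 * W - \<omega> v"
    using vl sum_diff1_nat[of \<omega> leaves v] sum_omega by simp
  ultimately have "2 * W - \<omega> v \<le> W" using T(3) by simp
  with omega_less[OF vl] show False by simp
qed

text \<open>A private leaf lies in the tree of its hub, so \<open>T\<close> consists of
  \<open>m\<close>, \<open>m + 2\<close> and some summands. Its weight \<open>S + 2 * t\<close> then
  leaves \<open>t\<close> for the summands.\<close>

lemma ex_subset_sum:
  assumes T: "is_tree T" "subgraph T G" "weight w T \<le> W" and U: "is_tree U" "subgraph U G" "weight w U \<le> W"
    and TU: "verts T \<inter> verts U = {}" "verts G \<subseteq> verts T \<union> verts U"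
    and hubs: "m \<in> verts T" "m + 1 \<in> verts U"
  shows "\<exists>A\<subseteq>{..<m}. (\<Sum>i\<in>A. s i) = t"
proof -
  let ?T = "verts T - {m}" and ?U = "verts U - {m + 1}"
  have E: "edges T \<subseteq> E" "edges U \<subseteq> E" using T U by (auto simp: subgraph_def G_def)
  have V: "verts T \<union> verts U = {..<m + 6}" using T U TU by (auto simp: subgraph_def G_def)
  have part: "?T \<union> ?U = leaves" "?T \<inter> ?U = {}" using V TU hubs by (auto simp: leaves_def)
  have eT: "\<exists>z. {v, z} \<in> edges T" if "v \<in> ?T" for v using ex_edge[OF T(1) hubs(1)] that by blast
  have eU: "\<exists>z. {v, z} \<in> edges U" if "v \<in> ?U" for v using ex_edge[OF U(1) hubs(2)] that by blast
  have sub: "?T \<subseteq> leaves" "?U \<subseteq> leaves" using part(1) by blast+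
  have "(\<Sum>v\<in>?T. \<omega> v) \<le> W" using weight_ge[OF E(1) sub(1) eT] T(3) by (rule order.trans)
  moreover have "(\<Sum>v\<in>?U. \<omega> v) \<le> W" using weight_ge[OF E(2) sub(2) eU] U(3) by (rule order.trans)
  moreover have "finite leaves" by (simp add: leaves_def)
  with sub have fin: "finite ?T" "finite ?U" by (meson finite_subset)+
  have "(\<Sum>v\<in>?T. \<omega> v) + (\<Sum>v\<in>?U. \<omega> v) = 2 * W"
    using sum.union_disjoint[OF fin part(2), of \<omega>] unfolding part(1) sum_omega by (rule sym)
  \<comment> \<open>Two numbers that are at most \<open>W\<close> and add up to \<open>2 * W\<close>
    are both equal to \<open>W\<close>.\<close>
  ultimately have W: "(\<Sum>v\<in>?T. \<omega> v) = W" by linarith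
  have nohub: "h \<in> verts X" if "{v, h} \<in> edges X" "subgraph X G" for v h X
    using that by (auto simp: subgraph_def is_graph_def)
  have in_T: "m + 2 \<in> ?T"
  proof (rule ccontr)
    assume "m + 2 \<notin> ?T"
    moreover have "m + 2 \<in> ?T \<union> ?U" unfolding part(1) by (simp add: leaves_def)
    ultimately have "m + 2 \<in> ?U" by blast
    then obtain z where z: "{m + 2, z} \<in> edges U" using eU by blast
    then have "z = m" using E(2) private_edge(1) by blast
    with nohub[OF z U(2)] hubs TU show False by blast
  qed
  have notin_T: "j \<notin> ?T" if "j \<in> {m + 3, m + 4, m + 5}" for j
  proof
    assume "j \<in> ?T"
    then obtain z where z: "{j, z} \<in> edges T" using eT by blast
    then have "z = m + 1" using E(1) that private_edge(2) by blast
    with nohub[OF z T(2)] hubs TU show False by blast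
  qed
  have "x = m + 2 \<or> x < m" if "x \<in> ?T" for x
  proof -
    have "x \<in> leaves" using sub(1) that by blast
    then show ?thesis using notin_T[of x] that unfolding leaves_eq by blast
  qed
  with in_T have T_eq: "?T = insert (m + 2) (?T \<inter> {..<m})"
    by (intro set_eqI) (metis Int_iff insert_iff lessThan_iff)
  have "W = (\<Sum>v\<in>insert (m + 2) (?T \<inter> {..<m}). \<omega> v)" unfolding T_eq[symmetric] by (rule W[symmetric])
  also have "\<dots> = \<omega> (m + 2) + (\<Sum>v\<in>?T \<inter> {..<m}. \<omega> v)" by (subst sum.insert) auto
  also have "(\<Sum>v\<in>?T \<inter> {..<m}. \<omega> v) = (\<Sum>v\<in>?T \<inter> {..<m}. s v)"
    by (intro sum.cong) (auto simp: \<omega>_def)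
  finally have "(\<Sum>v\<in>?T \<inter> {..<m}. s v) = t" by (simp add: W_def \<omega>_def)
  then show ?thesis by (intro exI[of _ "?T \<inter> {..<m}"]) simp
qed

lemma star:
  assumes "h = m \<or> h = m + 1" "N \<subseteq> leaves" "\<And>v. v \<in> N \<Longrightarrow> {v, h} \<in> E"
  shows "\<exists>T. is_tree T \<and> subgraph T G \<and> verts T = insert h N \<and> weight w T = (\<Sum>v\<in>N. \<omega> v)"
proof -
  have "finite N" using assms(2) by (rule finite_subset) (simp add: leaves_def)
  then obtain vs where vs: "set vs = N" "distinct vs" using finite_distinct_list by blast
  let ?l = "map (\<lambda>v. (v, h)) vs"
  have "h \<notin> N" using assms(1,2) by (auto simp: leaves_def)
  moreover have "\<forall>v\<in>set vs. {v, h} \<in> E" using assms(3) vs(1) by blast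
  ultimately have g: "grows E h ?l" using vs(2) unfolding vs(1)[symmetric]
    by (induction vs) (auto simp: image_image)
  have "weight w (grown h ?l) = (\<Sum>v\<leftarrow>vs. w {v, h})"
    using weight_grown[OF g, of w] by (simp add: comp_def)
  moreover have "(\<Sum>v\<leftarrow>vs. w {v, h}) = (\<Sum>v\<in>N. w {v, h})"
    using vs by (simp add: sum_list_distinct_conv_sum_set)
  moreover have "(\<Sum>v\<in>N. w {v, h}) = (\<Sum>v\<in>N. \<omega> v)"
  proof (rule sum.cong)
    fix v assume "v \<in> N"
    then have "v \<notin> {m, m + 1}" "{v, h} \<in> E" using assms(2,3) by (auto simp: leaves_def)
    then show "w {v, h} = \<omega> v" by (rule w)
  qed simp
  moreover have "verts (grown h ?l) = insert h N" using vs(1) by (simp add: grown_def image_image)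
  moreover have "insert h N \<subseteq> {..<m + 6}" using assms(1,2) by (auto simp: leaves_def)
  moreover have "is_graph (grown h ?l)" using is_tree_grown[OF g] by (simp add: is_tree_def)
  ultimately show ?thesis using is_tree_grown[OF g] edges_grown[OF g]
    by (intro exI[of _ "grown h ?l"]) (simp add: subgraph_def G_def)
qed

theorem forest_iff: "forest_bounded G w W \<longleftrightarrow> (\<exists>A\<subseteq>{..<m}. (\<Sum>i\<in>A. s i) = t)"
proof
  assume "forest_bounded G w W"
  then obtain T U where T: "is_tree T" "subgraph T G" "weight w T \<le> W" and U: "is_tree U" "subgraph U G" "weight w U \<le> W"
    and TU: "verts T \<inter> verts U = {}" "verts G \<subseteq> verts T \<union> verts U"
    unfolding forest_bounded_def by blast
  have TU': "verts U \<inter> verts T = {}" "verts G \<subseteq> verts U \<union> verts T" using TU by auto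
  have "m \<in> verts G" "m + 1 \<in> verts G" by (simp_all add: G_def)
  with TU(2) have "m \<in> verts T \<union> verts U" "m + 1 \<in> verts T \<union> verts U" by blast+
  then show "\<exists>A\<subseteq>{..<m}. (\<Sum>i\<in>A. s i) = t"
    using hubs_separated[OF T U(1,2) TU] hubs_separated[OF U T(1,2) TU']
      ex_subset_sum[OF T U TU] ex_subset_sum[OF U T TU'] by blast
next
  assume "\<exists>A\<subseteq>{..<m}. (\<Sum>i\<in>A. s i) = t"
  then obtain A where A: "A \<subseteq> {..<m}" "(\<Sum>i\<in>A. s i) = t" by blast
  have finA: "finite A" using A(1) finite_subset by blast
  let ?B = "{..<m} - A"
  have B: "(\<Sum>i\<in>?B. s i) = S - t" "t \<le> S"
    using A sum_diff_nat[OF finA A(1), of s] sum_mono2[of "{..<m}" A s] by (auto simp: S_def)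
  obtain T where T: "is_tree T" "subgraph T G" "verts T = insert m (insert (m + 2) A)"
    "weight w T = (\<Sum>v\<in>insert (m + 2) A. \<omega> v)"
  proof -
    have "insert (m + 2) A \<subseteq> leaves" using A(1) by (auto simp: leaves_def)
    moreover have "{v, m} \<in> E" if "v \<in> insert (m + 2) A" for v
      using that A(1) by (auto simp: E_def insert_commute)
    ultimately show ?thesis using star[of m "insert (m + 2) A"] that by blast
  qed
  obtain U where U: "is_tree U" "subgraph U G" "verts U = insert (m + 1) ({m + 3, m + 4, m + 5} \<union> ?B)"
    "weight w U = (\<Sum>v\<in>{m + 3, m + 4, m + 5} \<union> ?B. \<omega> v)"
  proof -
    have "{m + 3, m + 4, m + 5} \<union> ?B \<subseteq> leaves" by (auto simp: leaves_def)
    moreover have "{v, m + 1} \<in> E" if "v \<in> {m + 3, m + 4, m + 5} \<union> ?B" for v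
      using that by (auto simp: E_def insert_commute)
    ultimately show ?thesis using star[of "m + 1" "{m + 3, m + 4, m + 5} \<union> ?B"] that by blast
  qed
  have "weight w T = \<omega> (m + 2) + (\<Sum>v\<in>A. \<omega> v)"
    unfolding T(4) using A(1) finA by (subst sum.insert) auto
  also have "(\<Sum>v\<in>A. \<omega> v) = (\<Sum>v\<in>A. s v)" using A(1) by (intro sum.cong) (auto simp: \<omega>_def)
  finally have wT: "weight w T = W" using A by (simp add: \<omega>_def W_def)
  \<comment> \<open>The result is \<open>3 * t + (S - t) = W\<close>; the truncated difference is
    exact because \<open>t\<close>, as a partial sum, is at most \<open>S\<close>.\<close>
  have "weight w U = (\<Sum>v\<in>{m + 3, m + 4, m + 5}. \<omega> v) + (\<Sum>v\<in>?B. \<omega> v)"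
    unfolding U(4) by (subst sum.union_disjoint) auto
  also have "(\<Sum>v\<in>?B. \<omega> v) = (\<Sum>v\<in>?B. s v)" by (intro sum.cong) (auto simp: \<omega>_def)
  finally have wU: "weight w U = W" using B by (simp add: \<omega>_def W_def)
  have "x \<in> verts T \<union> verts U" if "x < m + 6" for x
    using that unfolding T(3) U(3) by auto
  moreover have "verts T \<inter> verts U = {}" unfolding T(3) U(3) using A(1) by auto
  ultimately show "forest_bounded G w W"
    unfolding forest_bounded_def using T(1,2) U(1,2) wT wU
    by (intro exI[of _ T] exI[of _ U]) (auto simp: G_def)
qed

end

(* The empty list for indices out of range. *)
definition sel :: "'a list list \<Rightarrow> nat \<Rightarrow> 'a list" where
  "sel l i = (case drop i l of [] \<Rightarrow> [] | y # _ \<Rightarrow> y)"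

lemma sel_nth [simp]: "i < length l \<Longrightarrow> sel l i = l ! i"
  by (simp add: sel_def Cons_nth_drop_Suc[symmetric])

lemma pt_sel [pti]: "pt l \<Longrightarrow> pt i \<Longrightarrow> pt (\<lambda>x. sel (l x) (i x))"
  unfolding sel_def by (intro pti)

definition sum_edges :: "bool list list \<Rightarrow> bool list \<Rightarrow> bedge list" where
  "sum_edges ss t = (let m = length ss; b = norm_bits t in
     concat (map (\<lambda>i. [(i, m, norm_bits (sel ss i)), (i, m + 1, norm_bits (sel ss i))]) [0..<m]) @
     [(m, m + 2, norm_bits (add_bits (sum_bits ss) t)), (m + 1, m + 3, b), (m + 1, m + 4, b), (m + 1, m + 5, b)])"

definition sum_instance :: "bool list list \<Rightarrow> bool list \<Rightarrow> bool list" where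
  "sum_instance ss t = instance_code (length ss + 6) (sum_edges ss t)
     (norm_bits (add_bits (sum_bits ss) (add_bits t t)))"

lemma pt_sum_instance: "pt (\<lambda>p. sum_instance (fst p) (snd p))"
  unfolding sum_instance_def sum_edges_def Let_def by (intro pti)

lemma instance_code_encode:
  assumes "\<And>e. e \<in> set es \<Longrightarrow> norm_bits (snd (snd e)) = snd (snd e)"
  shows "instance_code n es (bits W) = encode_instance n (map (\<lambda>e. (fst e, fst (snd e), val (snd (snd e)))) es) W"
  unfolding encode_instance_def instance_code_def
  using assms by (simp add: norm_bits_eq encode_edge_def encode_nat_def comp_def map_replicate_const cong: map_cong)

text \<open>Membership in the problem only states that a string is the code of some suitable
  instance; injectivity identifies that instance with the constructed one.\<close>

lemma instance_code_inject:
  assumes "edges_ok n es" "edges_ok n' es'" "instance_code n es (bits W) = instance_code n' es' (bits W')"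
  shows "n = n' \<and> es = es' \<and> W = W'"
proof -
  let ?f = "\<lambda>e :: bedge. (fst e, fst (snd e), val (snd (snd e)))"
  let ?g = "\<lambda>e :: nat \<times> nat \<times> nat. (fst e, fst (snd e), bits (snd (snd e)))"
  have *: "map ?g (map ?f es) = es" if "edges_ok n es" for n es
    using that by (auto simp: edges_ok_def norm_bits_eq comp_def intro!: map_idI)
  have "n = n' \<and> map ?f es = map ?f es' \<and> W = W'"
    using assms encode_instance_inject[of n "map ?f es" W n' "map ?f es'" W']
    by (simp add: instance_code_encode edges_ok_def)
  then show ?thesis using *[OF assms(1)] *[OF assms(2)] by metis
qed

theorem sum_instance_iff:
  assumes t: "0 < val t"
  shows "sum_instance ss t \<in> min_spanning_forest_problem 2 \<longleftrightarrow>
    (\<exists>A\<subseteq>{..<length ss}. (\<Sum>i\<in>A. val (ss ! i)) = val t)"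
proof -
  let ?m = "length ss" and ?s = "\<lambda>i. val (ss ! i)"
  let ?es = "sum_edges ss t" and ?W = "(\<Sum>i<?m. ?s i) + 2 * val t"
  let ?E = "(\<lambda>i. {i, ?m}) ` {..<?m} \<union> (\<lambda>i. {i, ?m + 1}) ` {..<?m} \<union>
       {{?m, ?m + 2}, {?m + 1, ?m + 3}, {?m + 1, ?m + 4}, {?m + 1, ?m + 5}}"
  have sum: "sum_list (map val ss) = (\<Sum>i<?m. ?s i)"
    by (simp add: sum_list_sum_nth atLeast0LessThan)
  have set_es: "set ?es = (\<Union>i<?m. {(i, ?m, bits (?s i)), (i, ?m + 1, bits (?s i))}) \<union>
    {(?m, ?m + 2, bits ((\<Sum>i<?m. ?s i) + val t)), (?m + 1, ?m + 3, bits (val t)),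
     (?m + 1, ?m + 4, bits (val t)), (?m + 1, ?m + 5, bits (val t))}"
    by (auto simp: sum_edges_def Let_def norm_bits_eq sum atLeast0LessThan)
  have "distinct (map (\<lambda>e. (fst e, fst (snd e))) ?es)"
  proof -
    let ?l = "\<lambda>k. concat (map (\<lambda>i. [(i, ?m), (i, ?m + 1)]) [0..<k])"
    have "map (\<lambda>e. (fst e, fst (snd e))) ?es = ?l ?m @ [(?m, ?m + 2), (?m + 1, ?m + 3), (?m + 1, ?m + 4), (?m + 1, ?m + 5)]"
      by (simp add: sum_edges_def Let_def map_concat comp_def)
    moreover have "distinct (?l k)" for k by (induction k) auto
    ultimately show ?thesis by auto
  qed
  then have ok: "edges_ok (?m + 6) ?es" unfolding edges_ok_def set_es by auto
  have graph: "edge_graph (?m + 6) ?es = ({..<?m + 6}, ?E)"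
    unfolding edge_graph_def set_es by (simp add: image_Un image_UN) (auto simp: image_def)
  have W: "norm_bits (add_bits (sum_bits ss) (add_bits t t)) = bits ?W"
    by (simp add: norm_bits_eq sum mult_2)
  have main: "forest_bounded (edge_graph (?m + 6) ?es) w ?W \<longleftrightarrow>
      (\<exists>A\<subseteq>{..<length ss}. (\<Sum>i\<in>A. val (ss ! i)) = val t)" if w: "edge_weights ?es w" for w
  proof -
    let ?om = "\<lambda>v. if v < ?m then ?s v else if v = ?m + 2 then (\<Sum>i<?m. ?s i) + val t else val t"
    have weights: "w {i, ?m} = ?s i" "w {i, ?m + 1} = ?s i" if "i < ?m" for i
      using w that unfolding edge_weights_def set_es by auto
    have weights': "w {?m, ?m + 2} = (\<Sum>i<?m. ?s i) + val t" "w {?m + 1, ?m + 3} = val t"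
      "w {?m + 1, ?m + 4} = val t" "w {?m + 1, ?m + 5} = val t"
      using w unfolding edge_weights_def set_es by auto
    interpret subset_sum_graph ?m ?s "val t" w ?E ?om "\<Sum>i<?m. ?s i" ?W
    proof unfold_locales
      fix v h assume vh: "v \<notin> {?m, ?m + 1}" "{v, h} \<in> ?E"
      from vh(2) consider i where "i < ?m" "{v, h} = {i, ?m}" | i where "i < ?m" "{v, h} = {i, ?m + 1}"
        | j where "j = ?m + 2" "{v, h} = {?m, j}" | j where "j \<in> {?m + 3, ?m + 4, ?m + 5}" "{v, h} = {?m + 1, j}"
        by blast
      then show "w {v, h} = ?om v"
      proof cases
        case 1
        with vh(1) have "v = i" by (auto simp: doubleton_eq_iff)
        with 1 weights show ?thesis by simp
      next
        case 2
        with vh(1) have "v = i" by (auto simp: doubleton_eq_iff)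
        with 2 weights show ?thesis by simp
      next
        case 3
        with vh(1) have "v = ?m + 2" by (auto simp: doubleton_eq_iff)
        with 3 weights' show ?thesis by simp
      next
        case 4
        with vh(1) have "v = j" by (auto simp: doubleton_eq_iff)
        with 4 weights' show ?thesis by auto
      qed
    qed (use t in auto)
    show ?thesis using forest_iff unfolding G_def graph by blast
  qed
  have "sum_instance ss t = instance_code (?m + 6) ?es (bits ?W)" unfolding sum_instance_def W ..
  moreover have "0 < ?W" using t by simp
  ultimately have "sum_instance ss t \<in> min_spanning_forest_problem 2 \<longleftrightarrow>
      (\<exists>w. edge_weights ?es w \<and> forest_bounded (edge_graph (?m + 6) ?es) w ?W)"
    unfolding problem_iff using ok instance_code_inject[OF ok] by metis
  with main ex_edge_weights[OF ok] show ?thesis by blast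
qed


section \<open>From exact cover to subset sum\<close>

type_synonym label = "nat list"

text \<open>Sets are chosen by position, since two entries of the list may coincide. Labels outside
  \<open>U\<close> are ignored, which lets tiles at the border of the diagram mention values beyond
  it.\<close>

definition exact_cover :: "label list \<Rightarrow> label list list \<Rightarrow> bool" where
  "exact_cover U Is \<longleftrightarrow> (\<exists>A\<subseteq>{..<length Is}. \<forall>u\<in>set U. \<exists>!i. i \<in> A \<and> u \<in> set (Is ! i))"

(* A label corresponds to a block of digits that is wide enough to avoid carries. *)
definition digits :: "nat \<Rightarrow> label list \<Rightarrow> label list \<Rightarrow> bool list" where
  "digits k U I = concat (map (\<lambda>u. (u \<in> set I) # map (\<lambda>_. False) (replicate k (0::nat))) U)"

definition cover_instance :: "label list \<Rightarrow> label list list \<Rightarrow> bool list" where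
  "cover_instance U Is = sum_instance (map (digits (length Is) U) Is) (digits (length Is) U U)"

lemma pt_cover_instance: "pt (\<lambda>p. cover_instance (fst p) (snd p))"
  unfolding cover_instance_def digits_def by (intro pt_comp2[OF pt_sum_instance] pti)

lemma val_digits:
  "val (digits k [] I) = 0"
  "val (digits k (u # U) I) = of_bool (u \<in> set I) + 2 ^ Suc k * val (digits k U I)"
proof -
  have "val (replicate k False) = 0" for k by (induction k) auto
  then show "val (digits k (u # U) I) = of_bool (u \<in> set I) + 2 ^ Suc k * val (digits k U I)"
    by (simp add: digits_def val_append map_replicate_const)
qed (simp add: digits_def)

text \<open>A label occurs at most \<open>k\<close> times and its block counts up to
  \<open>2 ^ Suc k - 1\<close>, so reduction modulo \<open>2 ^ Suc k\<close> isolates the first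
  label. The target list \<open>V\<close> stays fixed while \<open>U\<close> shrinks in the
  induction.\<close>

lemma sum_digits:
  assumes "finite A" "card A \<le> k" "set U \<subseteq> set V"
  shows "(\<Sum>i\<in>A. val (digits k U (I i))) = val (digits k U V) \<longleftrightarrow> (\<forall>u\<in>set U. card {i \<in> A. u \<in> set (I i)} = 1)"
  using assms(3)
proof (induction U)
  case (Cons u U)
  let ?B = "2 ^ Suc k :: nat" and ?c = "card {i \<in> A. u \<in> set (I i)}"
  have "(\<Sum>i\<in>A. val (digits k (u # U) (I i))) = ?c + ?B * (\<Sum>i\<in>A. val (digits k U (I i)))"
    using assms(1) by (simp add: val_digits sum.distrib sum_distrib_left Int_def)
  moreover have "val (digits k (u # U) V) = 1 + ?B * val (digits k U V)"
    using Cons.prems by (simp add: val_digits)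
  moreover have "?c + ?B * X = 1 + ?B * Y \<longleftrightarrow> ?c = 1 \<and> X = Y" for X Y
  proof
    assume eq: "?c + ?B * X = 1 + ?B * Y"
    have "?c \<le> k" using card_mono[OF assms(1), of "{i \<in> A. u \<in> set (I i)}"] assms(2) by simp
    also have "k < 2 ^ k" by (rule less_exp)
    also have "(2::nat) ^ k < ?B" by simp
    finally have "?c < ?B" .
    moreover have "1 < ?B" by (rule one_less_power) simp_all
    ultimately have "(?c + ?B * X) mod ?B = ?c" "(1 + ?B * Y) mod ?B = 1"
      by (simp_all only: mod_mult_self2 mod_less)
    then have "?c = 1" unfolding eq by (rule trans[OF sym])
    with eq show "?c = 1 \<and> X = Y" by simp
  qed simp
  ultimately show ?case using Cons by simp
qed (simp add: val_digits)

theorem cover_instance_iff: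
  assumes "U \<noteq> []"
  shows "cover_instance U Is \<in> min_spanning_forest_problem 2 \<longleftrightarrow> exact_cover U Is"
proof -
  let ?k = "length Is"
  obtain u U' where "U = u # U'" using assms by (cases U) auto
  \<comment> \<open>The target has to be positive for the graph; the digit of the first label
    ensures this.\<close>
  then have "0 < val (digits ?k U U)" by (simp add: val_digits)
  then have "cover_instance U Is \<in> min_spanning_forest_problem 2 \<longleftrightarrow>
      (\<exists>A\<subseteq>{..<?k}. (\<Sum>i\<in>A. val (map (digits ?k U) Is ! i)) = val (digits ?k U U))"
    unfolding cover_instance_def by (simp add: sum_instance_iff)
  also have "\<dots> \<longleftrightarrow> (\<exists>A\<subseteq>{..<?k}. \<forall>u\<in>set U. card {i \<in> A. u \<in> set (Is ! i)} = 1)"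
  proof (intro ex_cong1 conj_cong refl)
    fix A assume A: "A \<subseteq> {..<?k}"
    then have fin: "finite A" "card A \<le> ?k"
      using finite_subset[OF A] card_mono[OF _ A] by auto
    have "(\<Sum>i\<in>A. val (map (digits ?k U) Is ! i)) = (\<Sum>i\<in>A. val (digits ?k U (Is ! i)))"
      using A by (intro sum.cong) auto
    then show "(\<Sum>i\<in>A. val (map (digits ?k U) Is ! i)) = val (digits ?k U U) \<longleftrightarrow>
      (\<forall>u\<in>set U. card {i \<in> A. u \<in> set (Is ! i)} = 1)"
      using sum_digits[OF fin order.refl, of U "(!) Is"] by simp
  qed
  also have "\<dots> \<longleftrightarrow> exact_cover U Is"
    unfolding exact_cover_def by (simp add: card_1_singleton_iff set_eq_iff Ex1_def) metis
  finally show ?thesis .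
qed

section \<open>From computations to exact covers\<close>

text \<open>A choice of tiles describes a run: the length of the certificate, its symbols, the
  transition of step \<open>t\<close> as old state, new state and one action per tape, and for each
  cell of a tape whether it keeps its symbol or is scanned. An action consists of the symbols read
  and written and the direction.\<close>

datatype tile =
    Len nat
  | Guess nat nat
  | Act nat "nat \<times> nat \<times> (nat \<times> nat \<times> nat \<times> nat) list"
  | Idle nat nat nat nat
  | Head nat nat nat "nat \<times> nat \<times> nat"

fun dir_code :: "direction \<Rightarrow> nat" where
  "dir_code Go_Left = 0"
| "dir_code Stay = 1"
| "dir_code Go_Right = 2"

definition move_head :: "nat \<Rightarrow> nat \<Rightarrow> nat" where
  "move_head d i = (if d = 0 then i - 1 else if d = 1 then i else Suc i)"

definition others :: "('a \<Rightarrow> 'b) \<Rightarrow> 'a \<Rightarrow> 'a list \<Rightarrow> 'b list" where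
  "others f v vs = map f (filter (\<lambda>v'. v' \<noteq> v) vs)"

lemma set_others [simp]: "set (others f v vs) = f ` (set vs - {v})"
  by (auto simp: others_def)

lemma bex_tuple:
  "(\<exists>x\<in>A. a = fst x \<and> b = fst (snd x) \<and> c = snd (snd x)) \<longleftrightarrow> (a, b, c) \<in> A"
  "(\<exists>x\<in>B. a = fst x \<and> b = fst (snd x) \<and> c = fst (snd (snd x)) \<and> d = snd (snd (snd x))) \<longleftrightarrow> (a, b, c, d) \<in> B"
  by force+

(* T is the number of steps, x the input, and L a bound on the length of the certificate. *)
locale tableau_defs =
  fixes M :: tm and x :: "bool list" and L T :: nat
begin

definition "K = num_tapes M"
definition "states = [0..<Suc (num_states M)]"
definition "syms = [0..<num_symbols M]"

text \<open>The first cell of the certificate: \<open>delimit x\<close> occupies the cells from 1 to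
  \<open>2 * length x + 1\<close>.\<close>

definition D :: nat where
  "D = 2 * length x + 2"

text \<open>Beyond all cells that heads reach in \<open>T\<close> steps, the cells of the
  certificate, and the cells 1 and 2 that show the output.\<close>

definition P :: nat where
  "P = T + D + L + 3"

text \<open>In the halting state the configuration repeats itself, so that every run can be tiled
  for exactly \<open>T\<close> steps.\<close>

definition trans' :: "nat \<Rightarrow> nat list \<Rightarrow> nat \<times> (nat \<times> direction) list" where
  "trans' q rs = (if q < num_states M then trans M q rs else (q, keep rs))"

definition entry :: "nat \<Rightarrow> nat list \<Rightarrow> nat \<times> nat \<times> (nat \<times> nat \<times> nat \<times> nat) list" where
  "entry q rs = (q, fst (trans' q rs),
     zip [0..<K] (map2 (\<lambda>s a. (s, fst a, dir_code (snd a))) rs (snd (trans' q rs))))"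

text \<open>The table depends on the machine only. It is a constant of the reduction, and no time is
  spent on evaluating \<open>trans\<close>.\<close>

definition "tab = concat (map (\<lambda>q. map (entry q) (List.n_lists K syms)) states)"

definition "actions = concat (map (\<lambda>e. map snd (snd (snd e))) tab)"

text \<open>The content is a list with one entry, ready to be appended to a label and obtainable by
  \<open>sel\<close>. Cells of the certificate count as blank here; \<open>Len l\<close> leaves out
  the first \<open>l\<close> of them.\<close>

definition initial :: "nat \<Rightarrow> nat \<Rightarrow> nat list" where
  "initial j i = (if i = 0 then [1]
     else if j = 0 \<and> i < D then sel (map (\<lambda>b. [if b then 3 else 2]) (delimit x)) (i - 1) else [0])"

(* The labels [6], [7, i], [0, t] and [3, t, j, i] stand for the places of the tiles, so that each
   place gets one tile.  A tile that provides the value of a state [1, ...], an action [2, ...] or a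
   cell [4, ...] covers the label of that value, and a tile that consumes it covers the labels of all
   other values: both together cover all these labels once if and only if the values agree.  The
   label [5, t, j, i] is covered by the tile that moves head j to cell i, or by the tile that asserts
   the absence of this head. *)
fun lab :: "tile \<Rightarrow> label list" where
  "lab (Len l) = [[6], [1, 0, 0]] @ others (\<lambda>q. [1, T, q]) (num_states M) states @
     others (\<lambda>s. [4, T, 0, 1, s]) 3 syms @ others (\<lambda>s. [4, T, 0, 2, s]) 0 syms @
     map (\<lambda>i. [7, i]) [l..<L] @ map (\<lambda>j. [5, 0, j, 0]) [0..<K] @
     concat (map (\<lambda>j. concat (map (\<lambda>i. if j = 0 \<and> D \<le> i \<and> i < D + l then [] else [[4, 0, j, i] @ initial j i]) [0..<P])) [0..<K])"
| "lab (Guess i s) = [[7, i], [4, 0, 0, D + i, s]]"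
| "lab (Act t e) = [[0, t], [1, Suc t, fst (snd e)]] @ others (\<lambda>q. [1, t, q]) (fst e) states @
     map (\<lambda>a. [2, t, fst a, fst (snd a), fst (snd (snd a)), snd (snd (snd a))]) (snd (snd e))"
| "lab (Idle t j i s) = [[3, t, j, i], [5, t, j, i], [4, Suc t, j, i, s]] @ others (\<lambda>s'. [4, t, j, i, s']) s syms"
| "lab (Head t j i a) = [[3, t, j, i], [5, Suc t, j, move_head (snd (snd a)) i], [4, Suc t, j, i, fst (snd a)]] @
     others (\<lambda>s'. [4, t, j, i, s']) (fst a) syms @
     others (\<lambda>b. [2, t, j, fst b, fst (snd b), snd (snd b)]) a actions"

definition tiles :: "tile list" where
  "tiles = map Len [0..<Suc L] @ concat (map (\<lambda>i. [Guess i 2, Guess i 3]) [0..<L]) @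
     concat (map (\<lambda>t. map (Act t) tab @ concat (map (\<lambda>j. concat (map (\<lambda>i.
       map (Idle t j i) syms @ map (Head t j i) actions) [0..<P])) [0..<K])) [0..<T])"

definition labels :: "label list" where
  "labels = [[6]] @ map (\<lambda>i. [7, i]) [0..<L] @
     concat (map (\<lambda>t. [0, t] # concat (map (\<lambda>j. map (\<lambda>a. [2, t, j, fst a, fst (snd a), snd (snd a)]) actions @
       concat (map (\<lambda>i. [[3, t, j, i], [5, t, j, i]] @ map (\<lambda>s. [4, t, j, i, s]) syms) [0..<P])) [0..<K])) [0..<T]) @
     concat (map (\<lambda>t. map (\<lambda>q. [1, t, q]) states) [0..<Suc T]) @
     map (\<lambda>s. [4, T, 0, 1, s]) syms @ map (\<lambda>s. [4, T, 0, 2, s]) syms"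

lemma set_syms: "set syms = {..<num_symbols M}" and set_states: "set states = {..num_states M}"
  by (auto simp: syms_def states_def)

lemma set_labels:
  "[6] \<in> set labels"
  "[7, i] \<in> set labels \<longleftrightarrow> i < L"
  "[0, t] \<in> set labels \<longleftrightarrow> t < T"
  "[1, t, q] \<in> set labels \<longleftrightarrow> t \<le> T \<and> q \<le> num_states M"
  "[2, t, j, s, s', d] \<in> set labels \<longleftrightarrow> t < T \<and> j < K \<and> (s, s', d) \<in> set actions"
  "[3, t, j, i] \<in> set labels \<longleftrightarrow> t < T \<and> j < K \<and> i < P"
  "[5, t, j, i] \<in> set labels \<longleftrightarrow> t < T \<and> j < K \<and> i < P"
  "[4, t, j, i, s] \<in> set labels \<longleftrightarrow> s < num_symbols M \<and>
     (t < T \<and> j < K \<and> i < P \<or> t = T \<and> j = 0 \<and> (i = 1 \<or> i = 2))"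
  by (auto simp: labels_def set_syms set_states image_iff bex_tuple)

lemma labels_cases:
  assumes "u \<in> set labels"
  obtains "u = [6]" | i where "u = [7, i]" | t where "u = [0, t]" | t q where "u = [1, t, q]"
    | t j s s' d where "u = [2, t, j, s, s', d]" | t j i where "u = [3, t, j, i]"
    | t j i s where "u = [4, t, j, i, s]" | t j i where "u = [5, t, j, i]"
  using assms by (auto simp: labels_def)

lemma lab_6: "[6] \<in> set (lab \<tau>) \<longleftrightarrow> (\<exists>l. \<tau> = Len l)"
  by (cases \<tau>) auto

lemma lab_7: "[7, i] \<in> set (lab \<tau>) \<longleftrightarrow> (\<exists>l. \<tau> = Len l \<and> l \<le> i \<and> i < L) \<or> (\<exists>s. \<tau> = Guess i s)"
  by (cases \<tau>) auto

lemma lab_0: "[0, t] \<in> set (lab \<tau>) \<longleftrightarrow> (\<exists>e. \<tau> = Act t e)"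
  by (cases \<tau>) auto

lemma lab_1: "[1, t, q] \<in> set (lab \<tau>) \<longleftrightarrow>
   (\<exists>l. \<tau> = Len l \<and> (t = 0 \<and> q = 0 \<or> t = T \<and> q \<noteq> num_states M \<and> q \<le> num_states M)) \<or>
   (\<exists>t' e. \<tau> = Act t' e \<and> (t = t' \<and> q \<noteq> fst e \<and> q \<le> num_states M \<or> t = Suc t' \<and> q = fst (snd e)))"
  by (cases \<tau>) (auto simp: set_states image_iff)

lemma lab_2: "[2, t, j, s, s', d] \<in> set (lab \<tau>) \<longleftrightarrow>
   (\<exists>e. \<tau> = Act t e \<and> (j, s, s', d) \<in> set (snd (snd e))) \<or>
   (\<exists>i a. \<tau> = Head t j i a \<and> (s, s', d) \<noteq> a \<and> (s, s', d) \<in> set actions)"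
proof (cases \<tau>)
  case (Head t' j' i a)
  then show ?thesis using bex_tuple(1)[of "set actions - {a}" s s' d] by (auto simp: image_iff)
qed (auto simp: image_iff bex_tuple)

lemma lab_3: "[3, t, j, i] \<in> set (lab \<tau>) \<longleftrightarrow> (\<exists>s. \<tau> = Idle t j i s) \<or> (\<exists>a. \<tau> = Head t j i a)"
  by (cases \<tau>) auto

lemma lab_4: "[4, t, j, i, s] \<in> set (lab \<tau>) \<longleftrightarrow>
   (\<exists>l. \<tau> = Len l \<and> (t = T \<and> j = 0 \<and> (i = 1 \<and> s \<noteq> 3 \<or> i = 2 \<and> s \<noteq> 0) \<and> s < num_symbols M \<or>
      t = 0 \<and> j < K \<and> i < P \<and> \<not> (j = 0 \<and> D \<le> i \<and> i < D + l) \<and> initial j i = [s])) \<or>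
   (\<exists>i'. \<tau> = Guess i' s \<and> t = 0 \<and> j = 0 \<and> i = D + i') \<or>
   (\<exists>t' s'. \<tau> = Idle t' j i s' \<and> (t = Suc t' \<and> s = s' \<or> t = t' \<and> s \<noteq> s' \<and> s < num_symbols M)) \<or>
   (\<exists>t' a. \<tau> = Head t' j i a \<and> (t = Suc t' \<and> s = fst (snd a) \<or> t = t' \<and> s \<noteq> fst a \<and> s < num_symbols M))"
  by (cases \<tau>) (auto simp: set_syms image_iff)

lemma lab_5: "[5, t, j, i] \<in> set (lab \<tau>) \<longleftrightarrow>
   (\<exists>l. \<tau> = Len l \<and> t = 0 \<and> i = 0 \<and> j < K) \<or> (\<exists>s. \<tau> = Idle t j i s) \<or>
   (\<exists>t' i' a. \<tau> = Head t' j i' a \<and> t = Suc t' \<and> i = move_head (snd (snd a)) i')"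
  by (cases \<tau>) auto

lemma set_tiles:
  "Len l \<in> set tiles \<longleftrightarrow> l \<le> L"
  "Guess i s \<in> set tiles \<longleftrightarrow> i < L \<and> (s = 2 \<or> s = 3)"
  "Act t e \<in> set tiles \<longleftrightarrow> t < T \<and> e \<in> set tab"
  "Idle t j i s \<in> set tiles \<longleftrightarrow> t < T \<and> j < K \<and> i < P \<and> s < num_symbols M"
  "Head t j i a \<in> set tiles \<longleftrightarrow> t < T \<and> j < K \<and> i < P \<and> a \<in> set actions"
  by (auto simp: tiles_def set_syms image_iff)

end

section \<open>The run of the machine on a given certificate\<close>

locale tableau_run = tableau_defs +
  fixes y :: "bool list"
  assumes wf: "wf_tm M" and y: "length y \<le> L" and T: "0 < T"
begin

definition "cfg t = (step M ^^ t) (init_config M (encode_pair x y))"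
definition "st t = fst (cfg t)"
definition "cell t j = fst (snd (cfg t) ! j)"
definition "pos t j = snd (snd (cfg t) ! j)"
definition "rd t = map read_tape (snd (cfg t))"
definition "ent t = entry (st t) (rd t)"
definition "act t j = (let a = snd (trans' (st t) (rd t)) ! j in (rd t ! j, fst a, dir_code (snd a)))"

lemma trans'_wf:
  assumes "q \<le> num_states M" "length rs = K" "\<forall>s\<in>set rs. s < num_symbols M"
  shows "fst (trans' q rs) \<le> num_states M" "length (snd (trans' q rs)) = K"
    "\<And>a. a \<in> set (snd (trans' q rs)) \<Longrightarrow> fst a < num_symbols M"
proof -
  obtain q' as where tr: "trans' q rs = (q', as)" by (cases "trans' q rs")
  have "q' \<le> num_states M \<and> length as = K \<and> (\<forall>(s, d)\<in>set as. s < num_symbols M)"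
  proof (cases "q < num_states M")
    case True
    then have "trans M q rs = (q', as)" using tr by (simp add: trans'_def)
    moreover have "case trans M q rs of (q', as) \<Rightarrow> q' \<le> num_states M \<and> length as = num_tapes M \<and>
        (\<forall>(s, d)\<in>set as. s < num_symbols M)"
    proof -
      have "\<forall>q<num_states M. \<forall>rs. length rs = num_tapes M \<and> (\<forall>s\<in>set rs. s < num_symbols M) \<longrightarrow>
        (case trans M q rs of (q', as) \<Rightarrow> q' \<le> num_states M \<and> length as = num_tapes M \<and>
        (\<forall>(s, d)\<in>set as. s < num_symbols M))"
        by (rule wf[unfolded wf_tm_def, THEN conjunct2, THEN conjunct2])
      from this[rule_format, OF True conjI] show ?thesis using assms(2,3) unfolding K_def by simp
    qed
    ultimately show ?thesis by (simp add: K_def)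
  next
    case False
    then show ?thesis using tr assms by (auto simp: trans'_def keep_def)
  qed
  then show "fst (trans' q rs) \<le> num_states M" "length (snd (trans' q rs)) = K"
    "\<And>a. a \<in> set (snd (trans' q rs)) \<Longrightarrow> fst a < num_symbols M"
    unfolding tr by auto
qed

lemma cfg_Suc:
  "cfg (Suc t) = (fst (trans' (st t) (rd t)), map2 act_tape (snd (trans' (st t) (rd t))) (snd (cfg t)))"
proof -
  have "cfg (Suc t) = step M (cfg t)" by (simp add: cfg_def)
  then show ?thesis
    by (cases "cfg t") (simp add: step_def trans'_def st_def rd_def split: prod.splits)
qed

lemma tape_bounds:
  "length (snd (cfg t)) = K \<and> st t \<le> num_states M \<and> (\<forall>j<K. pos t j \<le> t \<and> (\<forall>i. cell t j i < num_symbols M))"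
proof (induction t)
  case 0
  have "4 \<le> num_symbols M" "1 \<le> K" using wf by (auto simp: wf_tm_def K_def)
  then show ?case
    by (auto simp: cfg_def st_def pos_def cell_def init_config_def K_def nth_Cons' tape_of_def bit_symbol_def)
next
  case (Suc t)
  let ?as = "snd (trans' (st t) (rd t))"
  have IH: "length (snd (cfg t)) = K" "st t \<le> num_states M" "\<And>j. j < K \<Longrightarrow> pos t j \<le> t"
    "\<And>j i. j < K \<Longrightarrow> cell t j i < num_symbols M"
    using Suc by blast+
  have rd: "length (rd t) = K" "\<forall>s\<in>set (rd t). s < num_symbols M"
  proof -
    show "length (rd t) = K" using IH(1) by (simp add: rd_def)
    have "rd t ! j < num_symbols M" if "j < K" for j
      using IH(1) IH(4)[OF that] that by (cases "snd (cfg t) ! j") (simp add: rd_def cell_def)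
    then show "\<forall>s\<in>set (rd t). s < num_symbols M"
      using \<open>length (rd t) = K\<close> by (metis in_set_conv_nth)
  qed
  note tr = trans'_wf[OF _ rd, of "st t"]
  have len: "length ?as = K" using tr(2) IH(2) by simp
  have "pos (Suc t) j \<le> Suc t \<and> cell (Suc t) j i < num_symbols M" if "j < K" for j i
  proof -
    obtain s d where a: "?as ! j = (s, d)" by (cases "?as ! j")
    obtain c p where c: "snd (cfg t) ! j = (c, p)" by (cases "snd (cfg t) ! j")
    have "s < num_symbols M" using tr(3)[OF IH(2), of "?as ! j"] len that a nth_mem[of j ?as] by simp
    moreover have "p \<le> t" "c i < num_symbols M"
      using IH(3)[OF that] IH(4)[OF that, of i] c by (simp_all add: pos_def cell_def)
    ultimately show ?thesis
      using that IH(1) len a c unfolding pos_def cell_def cfg_Suc by (auto split: direction.splits)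
  qed
  moreover have "st (Suc t) \<le> num_states M" using tr(1)[OF IH(2)] by (simp add: st_def[of "Suc t"] cfg_Suc)
  ultimately show ?case using IH(1) len by (simp add: cfg_Suc)
qed

lemma length_rd: "length (rd t) = K"
  using tape_bounds by (simp add: rd_def)

lemma rd_nth: "j < K \<Longrightarrow> rd t ! j = cell t j (pos t j)"
  using tape_bounds[of t] by (cases "snd (cfg t) ! j") (simp add: rd_def cell_def pos_def)

lemma rd_less: "\<forall>s\<in>set (rd t). s < num_symbols M"
  using tape_bounds[of t] rd_nth length_rd by (metis in_set_conv_nth)

lemma length_actions: "length (snd (trans' (st t) (rd t))) = K"
  using trans'_wf(2)[OF _ length_rd rd_less] tape_bounds by blast

lemma st_Suc: "st (Suc t) = fst (snd (ent t))"
  by (simp add: st_def[of "Suc t"] cfg_Suc ent_def entry_def)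

lemma fst_ent [simp]: "fst (ent t) = st t"
  by (simp add: ent_def entry_def)

lemma fst_act: "j < K \<Longrightarrow> fst (act t j) = cell t j (pos t j)"
  by (simp add: act_def Let_def rd_nth)

lemma move_Suc:
  assumes "j < K"
  shows "cell (Suc t) j i = (if i = pos t j then fst (snd (act t j)) else cell t j i)"
    "pos (Suc t) j = move_head (snd (snd (act t j))) (pos t j)"
proof -
  obtain s d where a: "snd (trans' (st t) (rd t)) ! j = (s, d)" by (cases "snd (trans' (st t) (rd t)) ! j")
  obtain c p where c: "snd (cfg t) ! j = (c, p)" by (cases "snd (cfg t) ! j")
  have "snd (cfg (Suc t)) ! j = act_tape (s, d) (c, p)"
    using assms tape_bounds[of t] length_actions[of t] a c by (simp add: cfg_Suc)
  then show "cell (Suc t) j i = (if i = pos t j then fst (snd (act t j)) else cell t j i)"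
    "pos (Suc t) j = move_head (snd (snd (act t j))) (pos t j)"
    using a c by (cases d; simp add: cell_def pos_def act_def Let_def move_head_def)+
qed

lemma set_entry:
  assumes "length rs = K" "length (snd (trans' q rs)) = K"
  shows "(j, b) \<in> set (snd (snd (entry q rs))) \<longleftrightarrow>
    j < K \<and> b = (rs ! j, fst (snd (trans' q rs) ! j), dir_code (snd (snd (trans' q rs) ! j)))"
  using assms by (auto simp: entry_def in_set_zip intro: exI[of _ j])

lemma ent_actions: "(j, b) \<in> set (snd (snd (ent t))) \<longleftrightarrow> j < K \<and> b = act t j"
  unfolding ent_def by (simp add: set_entry length_rd length_actions act_def Let_def)

lemma tab_cases:
  assumes "e \<in> set tab"
  obtains q rs where "e = entry q rs" "q \<le> num_states M" "length rs = K" "\<forall>s\<in>set rs. s < num_symbols M"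
  using assms by (auto simp: tab_def set_states set_n_lists set_syms)

lemma ent_in_tab: "ent t \<in> set tab"
  using tape_bounds[of t] length_rd[of t] rd_less[of t]
  by (auto simp: tab_def set_states set_n_lists set_syms ent_def image_iff)

lemma act_in_actions: "j < K \<Longrightarrow> act t j \<in> set actions"
  using ent_in_tab[of t] ent_actions[of j "act t j" t] by (force simp: actions_def)

lemma pos_less: "t \<le> T \<Longrightarrow> j < K \<Longrightarrow> pos t j < P"
  using tape_bounds[of t] by (force simp: P_def)

lemma st_0 [simp]: "st 0 = 0" and pos_0 [simp]: "j < K \<Longrightarrow> pos 0 j = 0"
  using wf by (auto simp: st_def pos_def cfg_def init_config_def K_def wf_tm_def nth_Cons')

lemma K_pos: "0 < K"
  using wf by (simp add: K_def wf_tm_def)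

lemma cell_0:
  assumes "j < K"
  shows "\<not> (j = 0 \<and> D \<le> i \<and> i < D + length y) \<Longrightarrow> initial j i = [cell 0 j i]"
    "i < length y \<Longrightarrow> cell 0 0 (D + i) = bit_symbol (y ! i)"
proof -
  have c: "cell 0 j = (if j = 0 then tape_of (delimit x @ y) else tape_of [])"
    using assms K_pos by (auto simp: cell_def cfg_def init_config_def encode_pair_def K_def nth_Cons')
  have c0: "cell 0 0 = tape_of (delimit x @ y)"
    using K_pos by (simp add: cell_def cfg_def init_config_def encode_pair_def)
  show "initial j i = [cell 0 j i]" if "\<not> (j = 0 \<and> D \<le> i \<and> i < D + length y)"
    using that unfolding c initial_def by (auto simp: tape_of_def D_def nth_append bit_symbol_def)
  show "cell 0 0 (D + i) = bit_symbol (y ! i)" if "i < length y"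
    using that unfolding c0 by (auto simp: tape_of_def D_def nth_append)
qed

definition "accepting \<longleftrightarrow> st T = num_states M \<and> cell T 0 1 = 3 \<and> cell T 0 2 = 0"

end

section \<open>From an accepting run to an exact cover\<close>

context tableau_run begin

declare lab.simps [simp del] split_paired_Ex [simp del] split_paired_All [simp del]

text \<open>The tiles that depict the actual run; they form the cover.\<close>

fun good :: "tile \<Rightarrow> bool" where
  "good (Len l) \<longleftrightarrow> l = length y"
| "good (Guess i s) \<longleftrightarrow> i < length y \<and> s = bit_symbol (y ! i)"
| "good (Act t e) \<longleftrightarrow> t < T \<and> e = ent t"
| "good (Idle t j i s) \<longleftrightarrow> t < T \<and> j < K \<and> i < P \<and> i \<noteq> pos t j \<and> s = cell t j i"
| "good (Head t j i a) \<longleftrightarrow> t < T \<and> j < K \<and> i = pos t j \<and> a = act t j"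

lemma ent_eq [simp]:
  "(q, q', as) = ent t \<longleftrightarrow> q = st t \<and> q' = st (Suc t) \<and> as = snd (snd (ent t))"
  "(st t, snd (ent t)) = ent t"
  by (auto simp: prod_eq_iff st_Suc)

lemma good_in_tiles: "good \<tau> \<Longrightarrow> \<tau> \<in> set tiles"
proof (cases \<tau>)
  case (Idle t j i s)
  moreover assume "good \<tau>"
  ultimately show ?thesis using tape_bounds[of t] by (simp add: set_tiles)
qed (use y in \<open>auto simp: set_tiles bit_symbol_def ent_in_tab act_in_actions pos_less\<close>)

definition cell_tile :: "nat \<Rightarrow> nat \<Rightarrow> nat \<Rightarrow> tile" where
  "cell_tile t j i = (if i = pos t j then Head t j i (act t j) else Idle t j i (cell t j i))"

lemma good_cell_tile: "t < T \<Longrightarrow> j < K \<Longrightarrow> i < P \<Longrightarrow> good (cell_tile t j i)"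
  by (auto simp: cell_tile_def)

lemma cell_tile_eq [simp]:
  "Len l \<noteq> cell_tile t j i" "Guess k s \<noteq> cell_tile t j i" "Act t' e \<noteq> cell_tile t j i"
  "good (Idle t' j' i' s) \<Longrightarrow> Idle t' j' i' s = cell_tile t j i \<longleftrightarrow> t' = t \<and> j' = j \<and> i' = i"
  "good (Head t' j' i' a) \<Longrightarrow> Head t' j' i' a = cell_tile t j i \<longleftrightarrow> t' = t \<and> j' = j \<and> i' = i"
  by (auto simp: cell_tile_def)

text \<open>The first three alternatives but for the end of the run are providers, which cover the
  actual symbol of the cell: \<open>Len\<close>, \<open>Guess\<close> or the tile of the preceding
  step. The consumers, \<open>Len\<close> at time \<open>T\<close> and the tile of step
  \<open>t\<close> otherwise, cover the other symbols.\<close>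

lemma lab_4_good:
  assumes "good \<tau>" "j < K" "i < P" "s < num_symbols M"
  shows "[4, t, j, i, s] \<in> set (lab \<tau>) \<longleftrightarrow>
    (\<tau> = Len (length y) \<and> (t = T \<and> j = 0 \<and> (i = 1 \<and> s \<noteq> 3 \<or> i = 2 \<and> s \<noteq> 0) \<or>
       t = 0 \<and> s = cell 0 j i \<and> \<not> (j = 0 \<and> D \<le> i \<and> i < D + length y))) \<or>
    (t = 0 \<and> j = 0 \<and> D \<le> i \<and> i < D + length y \<and> s = cell 0 j i \<and> \<tau> = Guess (i - D) s) \<or>
    (\<exists>t'. t = Suc t' \<and> t' < T \<and> s = cell t j i \<and> \<tau> = cell_tile t' j i) \<or>
    (t < T \<and> s \<noteq> cell t j i \<and> \<tau> = cell_tile t j i)"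
proof (cases \<tau>)
  case (Len l)
  have "\<not> (j = 0 \<and> D \<le> i \<and> i < D + length y) \<Longrightarrow> initial j i = [s] \<longleftrightarrow> s = cell 0 j i"
    using cell_0(1)[OF assms(2), of i] by auto
  then show ?thesis unfolding lab_4 Len using assms Len by auto
next
  case (Guess i' s')
  then have "i' < length y" "s' = cell 0 0 (D + i')"
    using assms(1) cell_0(2)[OF assms(2), of i'] by auto
  then show ?thesis unfolding lab_4 Guess by auto
next
  case (Act t' e)
  then show ?thesis unfolding lab_4 by simp
next
  case (Idle t' j' i' s')
  have g: "good (Idle t' j' i' s')" using assms(1) Idle by simp
  then have "s' = cell t' j' i'" "cell (Suc t') j' i' = cell t' j' i'" "t' < T" by (auto simp: move_Suc)
  then show ?thesis unfolding lab_4 Idle cell_tile_eq(4)[OF g] using assms(4) by auto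
next
  case (Head t' j' i' a)
  have g: "good (Head t' j' i' a)" using assms(1) Head by simp
  then have "fst a = cell t' j' i'" "fst (snd a) = cell (Suc t') j' i'" "t' < T" by (auto simp: move_Suc fst_act)
  then show ?thesis unfolding lab_4 Head cell_tile_eq(5)[OF g] using assms(4) by auto
qed

theorem cover_if_accepting:
  assumes acc: accepting and u: "u \<in> set labels"
  shows "\<exists>!\<tau>. good \<tau> \<and> u \<in> set (lab \<tau>)"
  using u
proof (cases rule: labels_cases)
  case 1
  then show ?thesis by (intro ex1I[of _ "Len (length y)"]) (auto simp: lab_6)
next
  case (2 i)
  have "i < L" using u unfolding 2 set_labels by simp_all
  show ?thesis
  proof (cases "i < length y")
    case True
    then show ?thesis unfolding 2 by (intro ex1I[of _ "Guess i (bit_symbol (y ! i))"]) (auto simp: lab_7)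
  next
    case False
    then show ?thesis using \<open>i < L\<close> unfolding 2 by (intro ex1I[of _ "Len (length y)"]) (auto simp: lab_7)
  qed
next
  case (3 t)
  have "t < T" using u unfolding 3 set_labels by simp_all
  then show ?thesis unfolding 3 by (intro ex1I[of _ "Act t (ent t)"]) (auto simp: lab_0)
next
  case (4 t q)
  have t: "t \<le> T" "q \<le> num_states M" using u unfolding 4 set_labels by simp_all
  show ?thesis
  proof (cases "q = st t")
    case True
    show ?thesis
    proof (cases t)
      case 0
      with True T show ?thesis unfolding 4 by (intro ex1I[of _ "Len (length y)"]) (auto simp: lab_1[unfolded One_nat_def])
    next
      case (Suc t')
      with True t acc show ?thesis unfolding 4
        by (intro ex1I[of _ "Act t' (ent t')"]) (auto simp: lab_1[unfolded One_nat_def] st_Suc[symmetric] accepting_def)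
    qed
  next
    case False
    have prod: "q \<noteq> fst (snd e)" if "t = Suc t'" "good (Act t' e)" for t' e
      using False that by (auto simp: st_Suc)
    show ?thesis
    proof (cases "t = T")
      case True
      with False t acc T prod show ?thesis unfolding 4
        by (intro ex1I[of _ "Len (length y)"]) (auto simp: lab_1[unfolded One_nat_def] accepting_def)
    next
      case False
      with \<open>q \<noteq> st t\<close> t prod show ?thesis unfolding 4
        by (intro ex1I[of _ "Act t (ent t)"]) (auto simp: lab_1[unfolded One_nat_def])
    qed
  qed
next
  case (5 t j s s' d)
  have t: "t < T" "j < K" "(s, s', d) \<in> set actions" using u unfolding 5 set_labels by simp_all
  show ?thesis
  proof (cases "(s, s', d) = act t j")
    case True
    with t show ?thesis unfolding 5 by (intro ex1I[of _ "Act t (ent t)"]) (auto simp: lab_2 ent_actions)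
  next
    case False
    with t show ?thesis unfolding 5
      by (intro ex1I[of _ "Head t j (pos t j) (act t j)"]) (auto simp: lab_2 ent_actions)
  qed
next
  case (6 t j i)
  have "t < T" "j < K" "i < P" using u unfolding 6 set_labels by simp_all
  then show ?thesis unfolding 6
    by (intro ex1I[of _ "cell_tile t j i"]) (auto simp: lab_3 cell_tile_def)
next
  case (7 t j i s)
  have u': "s < num_symbols M" "t < T \<and> j < K \<and> i < P \<or> t = T \<and> j = 0 \<and> (i = 1 \<or> i = 2)"
    using u unfolding 7 set_labels by auto
  then have b: "j < K" "i < P" "t \<le> T" using K_pos by (auto simp: P_def)
  note lab = lab_4_good[OF _ b(1,2) u'(1)]
  show ?thesis
  proof (cases "s = cell t j i")
    case True
    have notT: "\<not> (t = T \<and> j = 0 \<and> (i = 1 \<and> s \<noteq> 3 \<or> i = 2 \<and> s \<noteq> 0))"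
      using acc True by (auto simp: accepting_def)
    show ?thesis
    proof (cases t)
      case 0
      show ?thesis
      proof (cases "j = 0 \<and> D \<le> i \<and> i < D + length y")
        case guess: True
        have "[4, t, j, i, s] \<in> set (lab \<tau>) \<longleftrightarrow> \<tau> = Guess (i - D) s" if "good \<tau>" for \<tau>
          using lab[OF that, of t] notT guess True 0 T by auto
        moreover have "good (Guess (i - D) s)" using guess cell_0(2)[OF b(1), of "i - D"] True 0 by auto
        ultimately show ?thesis unfolding 7 by blast
      next
        case False
        have "[4, t, j, i, s] \<in> set (lab \<tau>) \<longleftrightarrow> \<tau> = Len (length y)" if "good \<tau>" for \<tau>
          using lab[OF that, of t] notT False True 0 T by auto
        then show ?thesis unfolding 7 using good.simps(1) by blast
      qed
    next
      case (Suc t')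
      have "[4, t, j, i, s] \<in> set (lab \<tau>) \<longleftrightarrow> \<tau> = cell_tile t' j i" if "good \<tau>" for \<tau>
        using lab[OF that, of t] notT True b Suc by auto
      moreover have "good (cell_tile t' j i)" using good_cell_tile b Suc by simp
      ultimately show ?thesis unfolding 7 by blast
    qed
  next
    case False
    show ?thesis
    proof (cases "t = T")
      case True
      then have "j = 0 \<and> (i = 1 \<and> s \<noteq> 3 \<or> i = 2 \<and> s \<noteq> 0)"
        using u' False acc by (auto simp: accepting_def)
      then have "[4, t, j, i, s] \<in> set (lab \<tau>) \<longleftrightarrow> \<tau> = Len (length y)" if "good \<tau>" for \<tau>
        using lab[OF that, of t] False True T by auto
      then show ?thesis unfolding 7 using good.simps(1) by blast
    next
      case notT: False
      have "[4, t, j, i, s] \<in> set (lab \<tau>) \<longleftrightarrow> \<tau> = cell_tile t j i" if "good \<tau>" for \<tau>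
        using lab[OF that, of t] notT False b by auto
      moreover have "good (cell_tile t j i)" using good_cell_tile b notT by simp
      ultimately show ?thesis unfolding 7 by blast
    qed
  qed
next
  case (8 t j i)
  have t: "t < T" "j < K" "i < P" using u unfolding 8 set_labels by simp_all
  show ?thesis
  proof (cases "i = pos t j")
    case True
    show ?thesis
    proof (cases t)
      case 0
      with True t show ?thesis unfolding 8 by (intro ex1I[of _ "Len (length y)"]) (auto simp: lab_5)
    next
      case (Suc t')
      with True t show ?thesis unfolding 8
        by (intro ex1I[of _ "Head t' j (pos t' j) (act t' j)"]) (auto simp: lab_5 move_Suc)
    qed
  next
    case False
    have move: "move_head (snd (snd a)) i' = pos t j" if "t = Suc t'" "good (Head t' j i' a)" for t' i' a
      using that by (auto simp: move_Suc)
    have "[5, t, j, i] \<in> set (lab \<tau>) \<longleftrightarrow> \<tau> = Idle t j i (cell t j i)" if "good \<tau>" for \<tau>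
    proof (cases \<tau>)
      case (Head t' j' i' a)
      with that move[of t' i' a] False show ?thesis by (auto simp: lab_5 simp del: good.simps)
    next
      case (Len l)
      have "pos t j = 0" if "t = 0" using that t by simp
      with Len False show ?thesis by (auto simp: lab_5)
    qed (use that t False in \<open>auto simp: lab_5\<close>)
    moreover have "good (Idle t j i (cell t j i))" using t False by simp
    ultimately show ?thesis unfolding 8 by blast
  qed
qed


end

section \<open>From an exact cover to an accepting run\<close>

locale tableau_cover = tableau_run +
  fixes R :: "tile set"
  assumes R: "R \<subseteq> set tiles"
    and cover: "\<And>u. u \<in> set labels \<Longrightarrow> \<exists>!\<tau>. \<tau> \<in> R \<and> u \<in> set (lab \<tau>)"
    and Len: "Len (length y) \<in> R"
    and Guess: "\<And>i. i < length y \<Longrightarrow> Guess i (bit_symbol (y ! i)) \<in> R"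
begin

lemma unique: "u \<in> set labels \<Longrightarrow> \<tau> \<in> R \<Longrightarrow> \<tau>' \<in> R \<Longrightarrow> u \<in> set (lab \<tau>) \<Longrightarrow> u \<in> set (lab \<tau>') \<Longrightarrow> \<tau> = \<tau>'"
  using cover by blast

text \<open>The time at which the values provided by a tile become available; those of
  \<open>Len\<close> and \<open>Guess\<close> are there at the beginning.\<close>

fun end_time :: "tile \<Rightarrow> nat" where
  "end_time (Act t e) = Suc t"
| "end_time (Idle t j i s) = Suc t"
| "end_time (Head t j i a) = Suc t"
| "end_time \<tau> = 0"

definition past :: "nat \<Rightarrow> label \<Rightarrow> bool" where
  "past t u \<longleftrightarrow> (\<exists>\<tau>\<in>R. end_time \<tau> \<le> t \<and> u \<in> set (lab \<tau>))"

(* What the tiles of the steps before t leave to those of step t is the configuration at time t. *)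
definition front :: "nat \<Rightarrow> bool" where
  "front t \<longleftrightarrow> past t [1, t, st t] \<and> (\<forall>j<K. \<forall>i<P. past t [4, t, j, i, cell t j i]) \<and>
     (\<forall>j<K. \<forall>i<P. past t [5, t, j, i] \<longleftrightarrow> i = pos t j)"

definition filled :: "nat \<Rightarrow> bool" where
  "filled t \<longleftrightarrow> Act t (ent t) \<in> R \<and> (\<forall>j<K. \<forall>i<P. cell_tile t j i \<in> R)"

text \<open>A tile of step \<open>t\<close> has end time \<open>Suc t\<close>, so it cannot cover a
  label that the past covers at time \<open>t\<close>. It therefore does not have the actual value
  among its other values, that is, it consumes exactly this value.\<close>

lemma past_unique:
  "u \<in> set labels \<Longrightarrow> past t u \<Longrightarrow> \<tau> \<in> R \<Longrightarrow> u \<in> set (lab \<tau>) \<Longrightarrow> end_time \<tau> \<le> t"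
  unfolding past_def using unique by blast

lemma front_0: "front 0"
proof -
  have "past 0 [1, 0, st 0]"
    unfolding past_def using Len by (intro bexI[OF _ Len]) (simp add: lab_1[unfolded One_nat_def])
  moreover have "past 0 [4, 0, j, i, cell 0 j i]" if "j < K" "i < P" for j i
  proof (cases "j = 0 \<and> D \<le> i \<and> i < D + length y")
    case True
    then show ?thesis
      unfolding past_def using cell_0(2)[OF that(1), of "i - D"]
      by (intro bexI[OF _ Guess[of "i - D"]]) (auto simp: lab_4)
  next
    case False
    then show ?thesis
      unfolding past_def using that cell_0(1)[OF that(1) False] by (intro bexI[OF _ Len]) (auto simp: lab_4)
  qed
  moreover have "past 0 [5, 0, j, i] \<longleftrightarrow> i = pos 0 j" if "j < K" for j i
  proof
    assume "past 0 [5, 0, j, i]"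
    then obtain \<tau> where "end_time \<tau> \<le> 0" "[5, 0, j, i] \<in> set (lab \<tau>)" unfolding past_def by blast
    then show "i = pos 0 j" using that by (cases \<tau>) (auto simp: lab_5)
  next
    assume "i = pos 0 j"
    then show "past 0 [5, 0, j, i]"
      unfolding past_def using that by (intro bexI[OF _ Len]) (auto simp: lab_5)
  qed
  ultimately show ?thesis unfolding front_def by blast
qed

lemma front_Suc:
  assumes "filled t" "t < T"
  shows "front (Suc t)"
proof -
  have Act: "Act t (ent t) \<in> R" and tile: "\<And>j i. j < K \<Longrightarrow> i < P \<Longrightarrow> cell_tile t j i \<in> R"
    using assms(1) by (auto simp: filled_def)
  have end_tile: "end_time (cell_tile t j i) = Suc t" for j i by (simp add: cell_tile_def)
  have "past (Suc t) [1, Suc t, st (Suc t)]"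
    unfolding past_def by (rule bexI[OF _ Act]) (simp add: lab_1[unfolded One_nat_def] st_Suc)
  moreover have "past (Suc t) [4, Suc t, j, i, cell (Suc t) j i]" if "j < K" "i < P" for j i
    unfolding past_def using that
    by (intro bexI[OF _ tile[OF that]]) (auto simp: end_tile lab_4 cell_tile_def move_Suc)
  moreover have "past (Suc t) [5, Suc t, j, i] \<longleftrightarrow> i = pos (Suc t) j" if j: "j < K" for j i
  proof
    assume "past (Suc t) [5, Suc t, j, i]"
    then obtain \<tau> where \<tau>: "\<tau> \<in> R" "end_time \<tau> \<le> Suc t" "[5, Suc t, j, i] \<in> set (lab \<tau>)"
      unfolding past_def by blast
    from \<tau>(2,3) obtain i' a where \<tau>_eq: "\<tau> = Head t j i' a" "i = move_head (snd (snd a)) i'"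
      by (auto simp: lab_5)
    have "i' < P" using R \<tau>(1) \<tau>_eq(1) by (auto simp: set_tiles)
    \<comment> \<open>Each place has only one tile, by the label \<open>[3, t, j, i']\<close>; so no
      further head tile can send a head to cell \<open>i\<close>.\<close>
    then have "cell_tile t j i' = \<tau>"
      using unique[of "[3, t, j, i']" "cell_tile t j i'" \<tau>] assms(2) j tile \<tau>(1) \<tau>_eq(1)
      by (auto simp: set_labels lab_3 cell_tile_def)
    then show "i = pos (Suc t) j" using \<tau>_eq j by (auto simp: cell_tile_def move_Suc split: if_splits)
  next
    assume i: "i = pos (Suc t) j"
    have "cell_tile t j (pos t j) \<in> R" using tile[OF j] pos_less[of t j] assms(2) j by simp
    then have "Head t j (pos t j) (act t j) \<in> R" by (simp add: cell_tile_def)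
    then show "past (Suc t) [5, Suc t, j, i]"
      unfolding past_def i using j by (intro bexI) (auto simp: lab_5 move_Suc)
  qed
  ultimately show ?thesis unfolding front_def by blast
qed

text \<open>The labels of the past fix the state, the symbols and the places of the heads. The heads
  on different tapes are tied together by the action labels: each must perform the action in the one
  chosen transition, which therefore reads the scanned symbols and is the transition of the
  machine.\<close>

lemma filled_if_front:
  assumes "front t" "t < T"
  shows "filled t"
proof -
  note st_bound = conjunct1[OF conjunct2[OF tape_bounds[of t]]]
  obtain \<tau> where "\<tau> \<in> R" "[0, t] \<in> set (lab \<tau>)"
    using cover[of "[0, t]"] assms(2) by (auto simp: set_labels)
  then obtain e where Act: "Act t e \<in> R" by (auto simp: lab_0)
  then have "e \<in> set tab" using R by (auto simp: set_tiles)
  then obtain q rs where e: "e = entry q rs" and q: "q \<le> num_states M"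
    and rs: "length rs = K" "\<forall>s\<in>set rs. s < num_symbols M"
    by (rule tab_cases)
  have "q = st t"
  proof (rule ccontr)
    assume "q \<noteq> st t"
    then have "[1, t, st t] \<in> set (lab (Act t e))" unfolding lab_1 e using st_bound by (simp add: entry_def)
    with past_unique[OF _ _ Act, of "[1, t, st t]" t] assms st_bound show False
      unfolding front_def set_labels by simp
  qed
  have tile: "(\<exists>s. Idle t j i s \<in> R \<and> i \<noteq> pos t j \<and> s = cell t j i) \<or>
      (\<exists>a. Head t j i a \<in> R \<and> i = pos t j \<and> fst a = cell t j i)" if "j < K" "i < P" for j i
  proof -
    have cell_bound: "cell t j i < num_symbols M" using tape_bounds[of t] that by blast
    have past: "past t [4, t, j, i, cell t j i]" "past t [5, t, j, i] \<longleftrightarrow> i = pos t j"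
      using assms(1) that unfolding front_def by blast+
    have lb: "[4, t, j, i, cell t j i] \<in> set labels" "[5, t, j, i] \<in> set labels" "[3, t, j, i] \<in> set labels"
      using that assms(2) cell_bound by (simp_all add: set_labels)
    from cover[OF lb(3)] obtain \<tau> where \<tau>: "\<tau> \<in> R" "[3, t, j, i] \<in> set (lab \<tau>)" by blast
    from \<tau>(2)[unfolded lab_3] show ?thesis
    proof (elim disjE exE)
      fix s assume [simp]: "\<tau> = Idle t j i s"
      have "s = cell t j i"
        using past_unique[OF lb(1) past(1) \<tau>(1)] cell_bound by (auto simp: lab_4)
      moreover have "i \<noteq> pos t j"
      proof
        assume "i = pos t j"
        with past(2) have "past t [5, t, j, i]" by blast
        from past_unique[OF lb(2) this \<tau>(1)] show False by (simp add: lab_5)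
      qed
      ultimately show ?thesis using \<tau>(1) by auto
    next
      fix a assume [simp]: "\<tau> = Head t j i a"
      have "fst a = cell t j i"
        using past_unique[OF lb(1) past(1) \<tau>(1)] cell_bound by (intro ccontr[of "fst a = _"]) (auto simp: lab_4)
      moreover have "i = pos t j"
      proof (rule ccontr)
        assume "i \<noteq> pos t j"
        \<comment> \<open>The past does not cover \<open>[5, t, j, i]\<close> if no head is there;
          only an idle tile could do so, and it would compete with the head tile for the
          place.\<close>
        from cover[OF lb(2)] obtain \<rho> where \<rho>: "\<rho> \<in> R" "[5, t, j, i] \<in> set (lab \<rho>)" by blast
        from \<rho>(2)[unfolded lab_5] show False
        proof (elim disjE exE conjE)
          fix s assume "\<rho> = Idle t j i s"
          then have "[3, t, j, i] \<in> set (lab \<rho>)" "\<rho> \<noteq> \<tau>" by (simp_all add: lab_3)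
          with unique[OF lb(3) \<rho>(1) \<tau>(1) _ \<tau>(2)] show False by blast
        qed (use \<rho> past(2) \<open>i \<noteq> pos t j\<close> in \<open>auto simp: past_def\<close>)
      qed
      ultimately show ?thesis using \<tau>(1) by auto
    qed
  qed
  have len: "length (snd (trans' q rs)) = K" using trans'_wf(2)[OF q rs] .
  define b where "b j = (rs ! j, fst (snd (trans' q rs) ! j), dir_code (snd (snd (trans' q rs) ! j)))" for j
  have head: "Head t j (pos t j) (b j) \<in> R \<and> rs ! j = cell t j (pos t j)" if j: "j < K" for j
  proof -
    have "pos t j < P" using pos_less assms(2) j by simp
    from tile[OF j this] obtain a where a: "Head t j (pos t j) a \<in> R" "fst a = cell t j (pos t j)" by blast
    have in_e: "(j, b j) \<in> set (snd (snd e))" unfolding e set_entry[OF rs(1) len] b_def using j by simp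
    then have "b j \<in> set actions" using \<open>e \<in> set tab\<close> unfolding actions_def by force
    \<comment> \<open>A head with another action would cover the label of \<open>b j\<close>, which
      the transition tile covers already.\<close>
    have "a = b j"
    proof (rule ccontr)
      assume "a \<noteq> b j"
      obtain s s' d where bj: "b j = (s, s', d)" by (cases "b j")
      have "[2, t, j, s, s', d] \<in> set (lab (Act t e))" "[2, t, j, s, s', d] \<in> set (lab (Head t j (pos t j) a))"
        "[2, t, j, s, s', d] \<in> set labels"
        unfolding lab_2 set_labels using in_e \<open>a \<noteq> b j\<close> \<open>b j \<in> set actions\<close> assms(2) j bj by auto
      with unique[OF _ Act a(1)] show False by blast
    qed
    with a show ?thesis by (simp add: b_def)
  qed
  then have "rs = rd t" using rs(1) length_rd rd_nth by (intro nth_equalityI) auto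
  then have "e = ent t" "\<And>j. b j = act t j"
    using \<open>q = st t\<close> by (simp_all add: e ent_def b_def act_def Let_def)
  then show ?thesis
    unfolding filled_def cell_tile_def using Act head tile by fastforce
qed

lemma filled: "t < T \<Longrightarrow> filled t"
proof (induction t)
  case 0
  then show ?case using filled_if_front front_0 by blast
next
  case (Suc t)
  then show ?case using filled_if_front front_Suc Suc_lessD by blast
qed

text \<open>\<open>Len\<close> consumes the halting state and the accepting output at time
  \<open>T\<close>; any other value would be covered both by \<open>Len\<close> and by the tile of
  the last step that provides it.\<close>

theorem accepting_if_cover: accepting
proof -
  obtain t where t: "T = Suc t" using T gr0_conv_Suc by blast
  then have f: "filled t" using filled by simp
  have K: "0 < K" "1 < P" "2 < P" using K_pos by (auto simp: P_def)
  note bounds = tape_bounds[of T]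
  have act: "Act t (ent t) \<in> R" using f by (simp add: filled_def)
  have "st T = num_states M"
  proof (rule ccontr)
    assume "st T \<noteq> num_states M"
    then have "[1, T, st T] \<in> set (lab (Len (length y)))" unfolding lab_1 using bounds by simp
    moreover have "[1, T, st T] \<in> set (lab (Act t (ent t)))" unfolding lab_1 by (simp add: t st_Suc)
    moreover have "[1, T, st T] \<in> set labels" unfolding set_labels using bounds by simp
    ultimately show False using unique[OF _ Len act] by blast
  qed
  moreover have "cell T 0 i = c" if i: "i = 1 \<and> c = 3 \<or> i = 2 \<and> c = 0" for i c
  proof (rule ccontr)
    assume "cell T 0 i \<noteq> c"
    have tile: "cell_tile t 0 i \<in> R" using f K i by (auto simp: filled_def)
    have lt: "cell T 0 i < num_symbols M" using bounds K by blast
    have "[4, T, 0, i, cell T 0 i] \<in> set (lab (Len (length y)))"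
      unfolding lab_4 using i \<open>cell T 0 i \<noteq> c\<close> lt by auto
    moreover have "[4, T, 0, i, cell T 0 i] \<in> set (lab (cell_tile t 0 i))"
      unfolding lab_4 using K(1) by (auto simp: t cell_tile_def move_Suc)
    moreover have "[4, T, 0, i, cell T 0 i] \<in> set labels" unfolding set_labels using i lt by auto
    ultimately have "Len (length y) = cell_tile t 0 i" using unique[OF _ Len tile] by blast
    then show False by (simp add: cell_tile_def split: if_splits)
  qed
  ultimately show ?thesis by (simp add: accepting_def)
qed

end

text \<open>For a set of tiles, one position is chosen per tile, so repetitions in \<open>ts\<close>
  do no harm.\<close>

lemma exact_cover_map:
  "exact_cover U (map f ts) \<longleftrightarrow> (\<exists>R\<subseteq>set ts. \<forall>u\<in>set U. \<exists>!\<tau>. \<tau> \<in> R \<and> u \<in> set (f \<tau>))"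
proof
  assume "exact_cover U (map f ts)"
  then obtain A where A: "A \<subseteq> {..<length ts}" "\<forall>u\<in>set U. \<exists>!i. i \<in> A \<and> u \<in> set (map f ts ! i)"
    by (auto simp: exact_cover_def)
  have "\<exists>!\<tau>. \<tau> \<in> (!) ts ` A \<and> u \<in> set (f \<tau>)" if u: "u \<in> set U" for u
  proof -
    from A(2) u obtain i where i: "i \<in> A" "u \<in> set (map f ts ! i)"
      "\<And>j. j \<in> A \<Longrightarrow> u \<in> set (map f ts ! j) \<Longrightarrow> j = i" by blast
    have nth: "map f ts ! j = f (ts ! j)" if "j \<in> A" for j using that A(1) by (intro nth_map) auto
    show ?thesis
    proof (rule ex1I[of _ "ts ! i"])
      show "ts ! i \<in> (!) ts ` A \<and> u \<in> set (f (ts ! i))" using i(1,2) nth by simp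
      fix \<tau> assume "\<tau> \<in> (!) ts ` A \<and> u \<in> set (f \<tau>)"
      then obtain j where "j \<in> A" "\<tau> = ts ! j" "u \<in> set (f (ts ! j))" by blast
      then show "\<tau> = ts ! i" using i(3)[of j] nth by simp
    qed
  qed
  moreover have "(!) ts ` A \<subseteq> set ts" using A(1) by auto
  ultimately show "\<exists>R\<subseteq>set ts. \<forall>u\<in>set U. \<exists>!\<tau>. \<tau> \<in> R \<and> u \<in> set (f \<tau>)"
    by (intro exI[of _ "(!) ts ` A"] conjI ballI)
next
  assume "\<exists>R\<subseteq>set ts. \<forall>u\<in>set U. \<exists>!\<tau>. \<tau> \<in> R \<and> u \<in> set (f \<tau>)"
  then obtain R where R: "R \<subseteq> set ts" "\<forall>u\<in>set U. \<exists>!\<tau>. \<tau> \<in> R \<and> u \<in> set (f \<tau>)" by blast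
  from R(1) have "\<forall>\<tau>\<in>R. \<exists>i. i < length ts \<and> ts ! i = \<tau>" by (auto simp: in_set_conv_nth)
  then obtain g where g: "\<And>\<tau>. \<tau> \<in> R \<Longrightarrow> g \<tau> < length ts \<and> ts ! g \<tau> = \<tau>" by metis
  have "\<exists>!i. i \<in> g ` R \<and> u \<in> set (map f ts ! i)" if u: "u \<in> set U" for u
  proof -
    from R(2)[rule_format, OF u] obtain \<tau>
      where \<tau>: "\<tau> \<in> R" "u \<in> set (f \<tau>)" "\<And>\<rho>. \<rho> \<in> R \<Longrightarrow> u \<in> set (f \<rho>) \<Longrightarrow> \<rho> = \<tau>"
      unfolding Ex1_def by metis
    show ?thesis
    proof (rule ex1I[of _ "g \<tau>"])
      show "g \<tau> \<in> g ` R \<and> u \<in> set (map f ts ! g \<tau>)" using \<tau>(1,2) g[OF \<tau>(1)] by simp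
      show "i = g \<tau>" if "i \<in> g ` R \<and> u \<in> set (map f ts ! i)" for i
        using that \<tau>(3) g by (metis imageE nth_map)
    qed
  qed
  then show "exact_cover U (map f ts)"
    unfolding exact_cover_def using g by (intro exI[of _ "g ` R"] conjI) (simp_all add: image_subset_iff)
qed

lemma (in tableau_run) accepting_iff: "accepting \<longleftrightarrow> halts_with M (cfg T) [True]"
proof -
  have "snd (cfg T) \<noteq> []" using tape_bounds[of T] K_pos by auto
  then have hd: "hd (snd (cfg T)) = snd (cfg T) ! 0" by (rule hd_conv_nth)
  have range: "{1..Suc (length [True])} = {1, 2}" by auto
  have tape: "tape_of [True] 1 = 3" "tape_of [True] 2 = 0" by (simp_all add: tape_of_def bit_symbol_def)
  have ball: "(\<forall>i\<in>{1, 2 :: nat}. Q i) \<longleftrightarrow> Q 1 \<and> Q 2" for Q by blast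
  have "halts_with M (cfg T) [True] \<longleftrightarrow>
      fst (cfg T) = num_states M \<and> (\<forall>i\<in>{1..Suc (length [True])}. fst (hd (snd (cfg T))) i = tape_of [True] i)"
    unfolding halts_with_def by (rule case_prod_beta)
  then show ?thesis
    unfolding range ball tape hd accepting_def st_def cell_def by (rule sym)
qed

theorem tableau_iff:
  assumes wf: "wf_tm M" and T: "0 < T"
  shows "exact_cover (tableau_defs.labels M x L T) (map (tableau_defs.lab M x L T) (tableau_defs.tiles M x L T)) \<longleftrightarrow>
    (\<exists>y. length y \<le> L \<and> halts_with M ((step M ^^ T) (init_config M (encode_pair x y))) [True])"
proof -
  interpret tableau_defs M x L T .
  show ?thesis
  proof
    assume "exact_cover labels (map lab tiles)"
    then obtain R where R: "R \<subseteq> set tiles" and cov: "\<forall>u\<in>set labels. \<exists>!\<tau>. \<tau> \<in> R \<and> u \<in> set (lab \<tau>)"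
      unfolding exact_cover_map by (elim exE conjE) (rule that)
    have cover: "\<exists>!\<tau>. \<tau> \<in> R \<and> u \<in> set (lab \<tau>)" if "u \<in> set labels" for u
      using cov that by (rule bspec)
    obtain \<tau> where \<tau>: "\<tau> \<in> R" "[6] \<in> set (lab \<tau>)" "\<And>\<rho>. \<rho> \<in> R \<Longrightarrow> [6] \<in> set (lab \<rho>) \<Longrightarrow> \<rho> = \<tau>"
      using ex1_implies_ex[OF cover[OF set_labels(1)]] cover[OF set_labels(1)] by (metis (no_types, lifting))
    then obtain l where l: "Len l \<in> R" "\<And>l'. Len l' \<in> R \<Longrightarrow> l' = l"
      unfolding lab_6 by (metis tile.inject(1))
    have lL: "l \<le> L" using subsetD[OF R l(1)] by (simp only: set_tiles(1))
    \<comment> \<open>\<open>Len l\<close> leaves the labels \<open>[7, i]\<close> with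
      \<open>i < l\<close> to \<open>Guess\<close> tiles, which thus spell a certificate of length
      \<open>l\<close>.\<close>
    define y where "y = map (\<lambda>i. Guess i 3 \<in> R) [0..<l]"
    have guess: "Guess i (bit_symbol (y ! i)) \<in> R" if i: "i < length y" for i
    proof -
      have il: "i < l" using i by (simp add: y_def)
      then have "[7, i] \<in> set labels" using lL by (simp add: set_labels)
      from ex1_implies_ex[OF cover[OF this]] obtain \<rho> where \<rho>: "\<rho> \<in> R" "[7, i] \<in> set (lab \<rho>)" by blast
      from \<rho>(2)[unfolded lab_7] obtain s where s: "Guess i s \<in> R"
        using l(2) il \<rho>(1) by (metis not_le)
      then have "s = 2 \<or> s = 3" using subsetD[OF R s] by (simp only: set_tiles(2))
      with s show ?thesis using il by (auto simp: y_def bit_symbol_def)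
    qed
    interpret tableau_cover M x L T y R
    proof unfold_locales
      show "length y \<le> L" "Len (length y) \<in> R" using lL l(1) by (simp_all add: y_def)
    qed (fact wf T R cover guess)+
    from accepting_if_cover have "halts_with M ((step M ^^ T) (init_config M (encode_pair x y))) [True]"
      unfolding accepting_iff cfg_def .
    then show "\<exists>y. length y \<le> L \<and> halts_with M ((step M ^^ T) (init_config M (encode_pair x y))) [True]"
      using y by blast
  next
    assume "\<exists>y. length y \<le> L \<and> halts_with M ((step M ^^ T) (init_config M (encode_pair x y))) [True]"
    then obtain y where len: "length y \<le> L" and halts: "halts_with M ((step M ^^ T) (init_config M (encode_pair x y))) [True]"
      by blast
    interpret tableau_run M x L T y by unfold_locales (fact wf len T)+
    have "accepting" using halts unfolding accepting_iff cfg_def .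
    then show "exact_cover labels (map lab tiles)"
      unfolding exact_cover_map
      using cover_if_accepting good_in_tiles
      by (intro exI[of _ "Collect good"] conjI ballI subsetI) (simp_all only: mem_Collect_eq)
  qed
qed

lemma pt_others [pti]:
  assumes "pt (\<lambda>p. f (fst p) (snd p))" "pt v" "pt vs"
  shows "pt (\<lambda>x. others (f x) (v x) (vs x))"
  unfolding others_def by (intro pti assms pt_comp[OF assms(2)])

text \<open>With \<open>M\<close> fixed, what remains is list processing with unary bounds; it is
  affordable because \<open>L\<close> and \<open>T\<close> are themselves computed in polynomial
  time as unary numbers.\<close>

lemma pt_tableau:
  assumes "pt L" "pt T"
  shows "pt (\<lambda>x. cover_instance (tableau_defs.labels M x (L x) (T x))
    (map (tableau_defs.lab M x (L x) (T x)) (tableau_defs.tiles M x (L x) (T x))))"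
proof (rule pt_comp2[OF pt_cover_instance])
  note defs = tableau_defs.D_def tableau_defs.P_def tableau_defs.initial_def
  show "pt (\<lambda>x. tableau_defs.labels M x (L x) (T x))"
    unfolding tableau_defs.labels_def defs
    by (intro pti assms pt_comp[OF assms(1)] pt_comp[OF assms(2)])
  show "pt (\<lambda>x. map (tableau_defs.lab M x (L x) (T x)) (tableau_defs.tiles M x (L x) (T x)))"
    unfolding tableau_defs.tiles_def map_append map_concat map_map comp_def list.map
      tableau_defs.lab.simps defs move_head_def
    by (intro pti assms pt_comp[OF assms(1)] pt_comp[OF assms(2)])
qed

text \<open>Pads a run that halts early to the uniform number of steps of the diagram.\<close>

lemma halted: "fst cfg = num_states M \<Longrightarrow> (step M ^^ n) cfg = cfg"
  by (induction n) (auto simp: step_def split: prod.splits)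

text \<open>The output ends at the first blank, so a halted configuration has only one output;
  otherwise \<open>[True]\<close> on the tape would not determine the value of the verifier.\<close>

lemma tape_of_inject:
  assumes "\<forall>i\<in>{1..Suc (length xs)}. h i = tape_of xs i" "\<forall>i\<in>{1..Suc (length ys)}. h i = tape_of ys i"
  shows "xs = ys"
proof -
  have le: "length xs \<le> length ys"
    if "\<forall>i\<in>{1..Suc (length xs)}. h i = tape_of xs i" "\<forall>i\<in>{1..Suc (length ys)}. h i = tape_of ys i" for xs ys
  proof (rule ccontr)
    assume "\<not> length xs \<le> length ys"
    then have "h (Suc (length ys)) = tape_of xs (Suc (length ys))" "h (Suc (length ys)) = tape_of ys (Suc (length ys))"
      using that by auto
    with \<open>\<not> length xs \<le> length ys\<close> show False by (simp add: tape_of_def bit_symbol_def split: if_splits)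
  qed
  have len: "length xs = length ys" using le[OF assms] le[OF assms(2,1)] by simp
  show ?thesis
  proof (rule nth_equalityI[OF len])
    fix i assume "i < length xs"
    then have "tape_of xs (Suc i) = tape_of ys (Suc i)" using assms len by force
    then show "xs ! i = ys ! i"
      using \<open>i < length xs\<close> len by (auto simp: tape_of_def bit_symbol_def split: if_splits)
  qed
qed

lemma halts_with_unique: "halts_with M cfg xs \<Longrightarrow> halts_with M cfg ys \<Longrightarrow> xs = ys"
  unfolding halts_with_def case_prod_beta by (elim conjE) (rule tape_of_inject)

theorem problem_NP_hard: "NP_hard (min_spanning_forest_problem 2)"
  unfolding NP_hard_def
proof (intro allI impI)
  fix L' assume "in_NP L'"
  then obtain f r where f: "polytime f"
    and L': "\<And>x. x \<in> L' \<longleftrightarrow> (\<exists>y. length y \<le> poly r (length x) \<and> f (encode_pair x y) = [True])"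
    unfolding in_NP_def by blast
  from f obtain M p where wf: "wf_tm M"
    and M: "\<And>x. \<exists>t\<le>poly p (length x). halts_with M ((step M ^^ t) (init_config M x)) (f x)"
    unfolding polytime_def by blast
  define L where "L x = poly r (length x)" for x :: "bool list"
  \<comment> \<open>\<open>2 * length x + 1 + L x\<close> bounds the length of the verifier's input,
    and \<open>Suc\<close> makes the number of steps positive, as the diagram requires.\<close>
  define T where "T x = Suc (poly p (2 * length x + 1 + L x))" for x :: "bool list"
  define g where "g x = cover_instance (tableau_defs.labels M x (L x) (T x))
    (map (tableau_defs.lab M x (L x) (T x)) (tableau_defs.tiles M x (L x) (T x)))" for x
  have "pt L" unfolding L_def by (intro pti)
  moreover have "pt T" unfolding T_def mult_2 by (intro pti \<open>pt L\<close>)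
  ultimately have "polytime g" unfolding g_def by (intro polytime_if_pt pt_tableau)
  moreover have "x \<in> L' \<longleftrightarrow> g x \<in> min_spanning_forest_problem 2" for x
  proof -
    have run: "halts_with M ((step M ^^ T x) (init_config M (encode_pair x y))) (f (encode_pair x y))"
      if "length y \<le> L x" for y
    proof -
      let ?c = "\<lambda>t. (step M ^^ t) (init_config M (encode_pair x y))"
      obtain t where t: "t \<le> poly p (length (encode_pair x y))" "halts_with M (?c t) (f (encode_pair x y))"
        using M by blast
      have "length (encode_pair x y) \<le> 2 * length x + 1 + L x" using that by (simp add: encode_pair_def)
      then have "t \<le> T x" using t(1) poly_nat_mono[of _ _ p] unfolding T_def by (meson le_SucI le_trans)
      then have "?c (T x) = (step M ^^ (T x - t)) (?c t)" by (metis funpow_add comp_apply le_add_diff_inverse2)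
      also have "\<dots> = ?c t" using t(2) by (intro halted) (auto simp: halts_with_def)
      finally show ?thesis using t(2) by simp
    qed
    have "tableau_defs.labels M x (L x) (T x) \<noteq> []" by (simp add: tableau_defs.labels_def)
    then have "g x \<in> min_spanning_forest_problem 2 \<longleftrightarrow>
        (\<exists>y. length y \<le> L x \<and> halts_with M ((step M ^^ T x) (init_config M (encode_pair x y))) [True])"
      unfolding g_def by (simp add: cover_instance_iff tableau_iff[OF wf] T_def)
    also have "\<dots> \<longleftrightarrow> (\<exists>y. length y \<le> L x \<and> f (encode_pair x y) = [True])"
      using run halts_with_unique by metis
    also have "\<dots> \<longleftrightarrow> x \<in> L'" by (simp add: L' L_def)
    finally show ?thesis by simp
  qed
  ultimately show "polytime_reducible L' (min_spanning_forest_problem 2)"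
    unfolding polytime_reducible_def by blast
qed

theorem theorem2:
  shows "NP_complete (min_spanning_forest_problem 2)"
  using problem_in_NP problem_NP_hard by (simp add: NP_complete_def)

end
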